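(* Let $K$ be a compact space which is `nice', that is, $K$ contains a discrete subset $D$ with $|D|=w(K)$. Then: (i) if $K$ is finite dimensional and $w(K)$ is uncountable, then $\mathrm{basic}(K)=\mathrm{cof}([w(K)]^{\aleph_0},\subseteq)$; (ii) if $K$ is infinite dimensional, then $\mathrm{basic}(K)=|C(K)|=w(K)^{\aleph_0}$.
   Context: All topological spaces are Tychonoff (so compact spaces are Hausdorff). A subset $D$ of a space is discrete if its subspace topology is discrete. $C(X)$ is the set of all continuous functions $X\to\mathbb{R}$. A family $\Phi\subseteq C(X)$ is called basic for $X$ if every $f\in C(X)$ can be represented as $f=\sum_{i=1}^n g_i\circ\phi_i$ for some $n$, some $\phi_1,\ldots,\phi_n\in\Phi$ and some $g_1,\ldots,g_n\in C(\mathbb{R})$ (here $n$ may depend on $f$). Define $\mathrm{basic}(X)=\min\{|\Phi| : \Phi \text{ is a basic family for } X\}$. The weight $w(X)$ is the minimal size of a base for the topology of $X$. For a cardinal $\kappa$, $[\kappa]^{\aleph_0}$ is the set of countably infinite subsets of $\kappa$, and $\mathrm{cof}([\kappa]^{\aleph_0},\subseteq)$ is the minimal size of a subset of $[\kappa]^{\aleph_0}$ that is cofinal with respect to inclusion. Dimension means covering dimension. *)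

theory Defs
  imports "HOL-Analysis.Analysis"
begin

unbundle cardinal_syntax

section \<open>Minimal cardinalities\<close>

text \<open>
  Cardinals are represented, as in the library, by well-orders compared by \<open>=o\<close> and \<open>\<le>o\<close>.
  The choice below determines \<open>min {|A| : A \<in> F}\<close> up to \<open>=o\<close> only, and only for \<open>F \<noteq> {}\<close>.
\<close>

definition min_card :: "'b set set \<Rightarrow> 'b rel" where
  "min_card F = (SOME r. \<exists>A\<in>F. r = |A| \<and> (\<forall>B\<in>F. |A| \<le>o |B| ))"

lemma min_card_attained:
  assumes "F \<noteq> {}"
  shows "\<exists>A\<in>F. min_card F = |A| \<and> (\<forall>B\<in>F. |A| \<le>o |B| )"
proof -
  have "card_of ` F \<noteq> {}"
    using assms by simp
  moreover have "\<forall>r \<in> card_of ` F. Well_order r"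
    by (metis card_of_Well_order imageE)
  ultimately have "\<exists>r \<in> card_of ` F. \<forall>r' \<in> card_of ` F. r \<le>o r'"
    by (rule exists_minim_Well_order)
  then have "\<exists>r. \<exists>A\<in>F. r = |A| \<and> (\<forall>B\<in>F. |A| \<le>o |B| )"
    by blast
  then show ?thesis
    unfolding min_card_def by (rule someI_ex)
qed

section \<open>Weight\<close>

definition is_base :: "'a topology \<Rightarrow> 'a set set \<Rightarrow> bool" where
  "is_base X B \<longleftrightarrow> (\<forall>V\<in>B. openin X V) \<and>
     (\<forall>U x. openin X U \<and> x \<in> U \<longrightarrow> (\<exists>V\<in>B. x \<in> V \<and> V \<subseteq> U))"

definition weight :: "'a topology \<Rightarrow> 'a set rel" where
  "weight X = min_card {B. is_base X B}"

lemma ex_base: "{B. is_base X B} \<noteq> {}"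
proof -
  have "is_base X {U. openin X U}"
    by (auto simp: is_base_def)
  then show ?thesis by blast
qed

definition nice_space :: "'a topology \<Rightarrow> bool" where
  "nice_space X \<longleftrightarrow>
     (\<exists>D. D \<subseteq> topspace X \<and> subtopology X D = discrete_topology D \<and> |D| =o weight X)"

section \<open>Basic families\<close>

text \<open>
  Functions are taken extensional on the carrier, so that distinct elements are distinct
  as functions on the space and the cardinality of the set is the intended one.
\<close>

definition cont_funs :: "'a topology \<Rightarrow> ('a \<Rightarrow> real) set" where
  "cont_funs X = {f \<in> extensional (topspace X). continuous_map X euclideanreal f}"

definition basic_family :: "'a topology \<Rightarrow> ('a \<Rightarrow> real) set \<Rightarrow> bool" where
  "basic_family X \<Phi> \<longleftrightarrow> \<Phi> \<subseteq> cont_funs X \<and>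
     (\<forall>f \<in> cont_funs X. \<exists>(n::nat) (\<phi> :: nat \<Rightarrow> 'a \<Rightarrow> real) (g :: nat \<Rightarrow> real \<Rightarrow> real).
        (\<forall>i\<in>{1..n}. \<phi> i \<in> \<Phi> \<and> continuous_on UNIV (g i)) \<and>
        (\<forall>x \<in> topspace X. f x = (\<Sum>i=1..n. (g i \<circ> \<phi> i) x)))"

definition basic :: "'a topology \<Rightarrow> ('a \<Rightarrow> real) rel" where
  "basic X = min_card {\<Phi>. basic_family X \<Phi>}"

lemma ex_basic_family: "{\<Phi>. basic_family X \<Phi>} \<noteq> {}"
proof -
  have "basic_family X (cont_funs X)"
    unfolding basic_family_def
  proof (intro conjI ballI subset_refl)
    fix f assume "f \<in> cont_funs X"
    then show "\<exists>(n::nat) (\<phi> :: nat \<Rightarrow> 'a \<Rightarrow> real) (g :: nat \<Rightarrow> real \<Rightarrow> real).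
        (\<forall>i\<in>{1..n}. \<phi> i \<in> cont_funs X \<and> continuous_on UNIV (g i)) \<and>
        (\<forall>x \<in> topspace X. f x = (\<Sum>i=1..n. (g i \<circ> \<phi> i) x))"
      by (intro exI[of _ "1::nat"] exI[of _ "\<lambda>_. f"] exI[of _ "\<lambda>_ x. x"]) auto
  qed
  then show ?thesis by blast
qed

section \<open>Cofinality of the countably infinite subsets of a cardinal\<close>

definition ctbl_inf_subsets :: "'b rel \<Rightarrow> 'b set set" where
  "ctbl_inf_subsets \<kappa> = {S. S \<subseteq> Field \<kappa> \<and> countable S \<and> infinite S}"

definition cof_subset :: "'b set set \<Rightarrow> 'b set rel" where
  "cof_subset F = min_card {G. G \<subseteq> F \<and> (\<forall>S\<in>F. \<exists>T\<in>G. S \<subseteq> T)}"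

lemma ex_cofinal: "{G. G \<subseteq> F \<and> (\<forall>S\<in>F. \<exists>T\<in>G. S \<subseteq> T)} \<noteq> {}"
  by blast

section \<open>Covering dimension\<close>

text \<open>
  The definition by finite open covers, which is the standard one for normal spaces
  (in particular for compact Hausdorff spaces).
\<close>

definition covering_dim_le :: "'a topology \<Rightarrow> int \<Rightarrow> bool" where
  "covering_dim_le X n \<longleftrightarrow> - 1 \<le> n \<and>
     (\<forall>\<U>. finite \<U> \<and> (\<forall>U\<in>\<U>. openin X U) \<and> \<Union>\<U> = topspace X \<longrightarrow>
        (\<exists>\<V>. finite \<V> \<and> (\<forall>V\<in>\<V>. openin X V) \<and> \<Union>\<V> = topspace X \<and>
             (\<forall>V\<in>\<V>. \<exists>U\<in>\<U>. V \<subseteq> U) \<and>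
             (\<forall>x \<in> topspace X. int (card {V\<in>\<V>. x \<in> V}) \<le> n + 1)))"

definition finite_dimensional :: "'a topology \<Rightarrow> bool" where
  "finite_dimensional X \<longleftrightarrow> (\<exists>n. covering_dim_le X n)"

end

theory Submission
  imports Defs "HOL-Library.Nat_Bijection"
begin

text \<open>
  Write \<open>w\<close> for the weight of \<open>K\<close> and let \<open>D\<close> be a discrete subset of size \<open>w\<close>.

  \<^bold>\<open>Lower bounds.\<close>  If \<open>f\<close> is a superposition of the members of a finite set \<open>F\<close>, then \<open>f\<close> varies
  little wherever all of \<open>F\<close> vary little (\<open>controls\<close>).  Take \<open>S = {s 0, s 1, \<dots>} \<subseteq> D\<close> and a continuous
  \<open>f\<close> with value \<open>2^-k\<close> at \<open>s k\<close> and \<open>0\<close> on the rest of \<open>D\<close>.  If \<open>F\<close> controls \<open>f\<close>, then the image of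
  each \<open>s k\<close> under \<open>F\<close> is isolated in the image of \<open>D\<close>; but a subset of a Euclidean space has
  only countably many isolated points.  So the sets of isolated points, one for each finite part of
  a basic family \<open>\<Phi>\<close>, are cofinal among the countable subsets of \<open>D\<close>
  (\<open>countable_subset_isolated\<close>), whence \<open>cof \<le> |\<Phi>|\<close>; and since each of them contains only continuum
  many sequences, \<open>w ^ \<aleph>\<^sub>0 \<le> |\<Phi>|\<close> as soon as \<open>|\<Phi>|\<close> is at least the continuum.

  The latter holds in infinite dimension because there is a function \<open>f \<alpha>\<close> for each
  \<open>\<alpha> \<subseteq> \<nat>\<close> such that every finite \<open>F\<close> controls only finitely many of them
  (\<open>many_uncontrolled_functions\<close>).  Infinite dimension is used as the existence of arbitrarily large
  essential families of pairs of closed sets (\<open>covering_dim_le_if_inessential\<close>), and a family of more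
  than \<open>card F\<close> pairs which are separated by functions controlled by \<open>F\<close> is inessential, since small
  shifted cubical grids in the Euclidean space of dimension \<open>card F\<close> give partitions without a common
  point (\<open>inessential_if_controlled\<close>).

  \<^bold>\<open>Upper bounds.\<close>  A uniformly dense set of continuous functions can be indexed by a base
  (\<open>dense_indexed_by_base\<close>), so there are at most \<open>w ^ \<aleph>\<^sub>0\<close> continuous functions.  In finite
  dimension, any countable set of continuous functions has finitely many inner functions that serve
  for its whole uniform closure (\<open>countable_set_superposition\<close>), which is a version of the
  superposition theorem of Kolmogorov and Ostrand.  The union of these finite sets, over the members
  of a cofinal family of countable sets of indices, is a basic family.
\<close>

section \<open>Cardinal arithmetic\<close>

lemma card_of_Times_ordLeq:
  assumes "infinite C" and "|A| \<le>o |C|" and "|B| \<le>o |C|"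
  shows "|A \<times> B| \<le>o |C|"
  using assms by (intro card_of_Sigma_ordLeq_infinite) auto

lemma card_of_lists_ordLeq:
  assumes "infinite A"
  shows "|lists A| \<le>o |A|"
proof -
  have fixed_length: "|{xs \<in> lists A. length xs = n}| \<le>o |A|" for n
  proof (induction n)
    case 0
    have "{xs \<in> lists A. length xs = 0} = {[]}"
      by auto
    then show ?case
      using assms by (metis card_of_singl_ordLeq finite.emptyI)
  next
    case (Suc n)
    let ?L = "\<lambda>n. {xs \<in> lists A. length xs = n}"
    have "?L (Suc n) \<subseteq> (\<lambda>(x, xs). x # xs) ` (A \<times> ?L n)"
      by (force simp: length_Suc_conv)
    then have "|?L (Suc n)| \<le>o |A \<times> ?L n|"
      by (rule surj_imp_ordLeq)
    moreover have "|A \<times> ?L n| \<le>o |A|"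
      using assms Suc.IH by (simp add: card_of_Times_ordLeq ordIso_imp_ordLeq card_of_refl)
    ultimately show ?case
      by (rule ordLeq_transitive)
  qed
  have "lists A = (\<Union>n. {xs \<in> lists A. length xs = n})"
    by auto
  moreover have "|\<Union>n. {xs \<in> lists A. length xs = n}| \<le>o |A|"
    using assms fixed_length
    by (intro card_of_UNION_ordLeq_infinite) (auto simp: infinite_iff_card_of_nat)
  ultimately show ?thesis
    by simp
qed

lemma card_of_Fpow_ordLeq:
  assumes "infinite A"
  shows "|Fpow A| \<le>o |A|"
proof -
  have "Fpow A \<subseteq> set ` lists A"
    by (auto simp: Fpow_def image_iff) (metis finite_list in_lists_conv_set subsetD)
  then have "|Fpow A| \<le>o |lists A|"
    by (rule surj_imp_ordLeq)
  then show ?thesis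
    using card_of_lists_ordLeq[OF assms] ordLeq_transitive by blast
qed

lemma countable_ordLeq_infinite:
  assumes "countable A" and "infinite B"
  shows "|A| \<le>o |B|"
proof -
  have "|A| \<le>o |UNIV :: nat set|"
    using assms(1) by (metis card_of_ordLeq countable_def subset_UNIV)
  moreover have "|UNIV :: nat set| \<le>o |B|"
    using assms(2) infinite_iff_card_of_nat by blast
  ultimately show ?thesis
    by (rule ordLeq_transitive)
qed

section \<open>Continuous functions on a compact Hausdorff space\<close>

text \<open>
  On a compact space every superposition of members of \<open>F\<close> has this property, which is all that the
  lower bounds below use about a basic family.
\<close>
definition controls :: "'a topology \<Rightarrow> ('a \<Rightarrow> real) set \<Rightarrow> ('a \<Rightarrow> real) \<Rightarrow> bool" where
  "controls X F f \<longleftrightarrow> (\<forall>\<gamma>>0. \<exists>\<epsilon>>0. \<forall>x\<in>topspace X. \<forall>y\<in>topspace X.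
     (\<forall>\<phi>\<in>F. \<bar>\<phi> x - \<phi> y\<bar> < \<epsilon>) \<longrightarrow> \<bar>f x - f y\<bar> < \<gamma>)"

lemma geometric_series_tail:
  fixes r :: real and a :: "nat \<Rightarrow> real"
  assumes "0 < r" and "r < 1" and "\<And>k. 0 \<le> a k \<and> a k \<le> 1"
  shows "(\<Sum>k<n. r ^ k * a k) \<le> (\<Sum>k. r ^ k * a k)"
    and "(\<Sum>k. r ^ k * a k) \<le> (\<Sum>k<n. r ^ k * a k) + r ^ n / (1 - r)"
proof -
  have summ: "summable (\<lambda>k. r ^ k * a k)"
    by (rule summable_comparison_test[OF _ summable_geometric[of r]])
      (use assms in \<open>auto intro!: exI[of _ 0] mult_left_le simp: abs_mult\<close>)
  show "(\<Sum>k<n. r ^ k * a k) \<le> (\<Sum>k. r ^ k * a k)"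
    using assms by (intro sum_le_suminf[OF summ]) auto
  have summ': "summable (\<lambda>k. r ^ (k + n) * a (k + n))"
    using summ by (subst summable_iff_shift)
  have geo: "summable (\<lambda>k. r ^ n * r ^ k)"
    using assms by (intro summable_mult summable_geometric) auto
  have "(\<Sum>k. r ^ (k + n) * a (k + n)) \<le> (\<Sum>k. r ^ n * r ^ k)"
    using assms by (intro suminf_le[OF _ summ' geo])
      (auto simp: power_add mult.commute intro!: mult_left_le)
  also have "\<dots> = r ^ n / (1 - r)"
    using assms by (subst suminf_mult) (auto simp: suminf_geometric summable_geometric)
  finally show "(\<Sum>k. r ^ k * a k) \<le> (\<Sum>k<n. r ^ k * a k) + r ^ n / (1 - r)"
    using suminf_split_initial_segment[OF summ, of n] by simp
qed

lemma continuous_map_uniform_approx: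
  fixes f :: "'a \<Rightarrow> real"
  assumes "\<And>e. e > 0 \<Longrightarrow> \<exists>g. continuous_map X euclideanreal g \<and> (\<forall>x\<in>topspace X. \<bar>f x - g x\<bar> < e)"
  shows "continuous_map X euclideanreal f"
proof -
  have "\<forall>n. \<exists>g. continuous_map X euclideanreal g \<and>
      (\<forall>x\<in>topspace X. \<bar>f x - g x\<bar> < inverse (real (Suc n)))"
    using assms by simp
  then obtain g where g: "\<And>n. continuous_map X euclideanreal (g n)"
      "\<And>n x. x \<in> topspace X \<Longrightarrow> \<bar>f x - g n x\<bar> < inverse (real (Suc n))"
    by metis
  have "continuous_map X Met_TC.mtopology f"
  proof (rule Met_TC.continuous_map_uniform_limit[where f = g and F = sequentially])
    show "\<forall>\<^sub>F n in sequentially. continuous_map X Met_TC.mtopology (g n)"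
      using g(1) by (simp add: mtopology_is_euclidean)
    fix e :: real
    assume "e > 0"
    then obtain N where "inverse (real (Suc N)) < e"
      using reals_Archimedean by blast
    then have "\<forall>n\<ge>N. \<forall>x\<in>topspace X. f x \<in> UNIV \<and> dist (g n x) (f x) < e"
      by (smt (verit) g(2) UNIV_I dist_real_def inverse_le_iff_le of_nat_0_less_iff of_nat_le_iff
          not_less_eq_eq zero_less_Suc Suc_le_mono)
    then show "\<forall>\<^sub>F n in sequentially. \<forall>x\<in>topspace X. f x \<in> UNIV \<and> dist (g n x) (f x) < e"
      by (auto simp: eventually_sequentially)
  qed simp
  then show ?thesis
    by (simp add: mtopology_is_euclidean)
qed

lemma continuous_map_geometric_series:
  fixes r :: real and u :: "nat \<Rightarrow> 'a \<Rightarrow> real"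
  assumes r: "0 < r" "r < 1"
    and cont: "\<And>k. continuous_map X euclideanreal (u k)"
    and range: "\<And>k x. x \<in> topspace X \<Longrightarrow> 0 \<le> u k x \<and> u k x \<le> 1"
  shows "continuous_map X euclideanreal (\<lambda>x. \<Sum>k. r ^ k * u k x)"
proof (rule continuous_map_uniform_approx)
  fix e :: real
  assume "e > 0"
  then obtain n where n: "r ^ n < e * (1 - r)"
    using r real_arch_pow_inv[of "e * (1 - r)" r] by auto
  then have "r ^ n / (1 - r) < e"
    using r by (simp add: field_simps)
  moreover have "continuous_map X euclideanreal (\<lambda>x. \<Sum>k<n. r ^ k * u k x)"
    by (intro continuous_intros cont) auto
  moreover have "\<bar>(\<Sum>k. r ^ k * u k x) - (\<Sum>k<n. r ^ k * u k x)\<bar> \<le> r ^ n / (1 - r)"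
    if "x \<in> topspace X" for x
    using geometric_series_tail[OF r, of "\<lambda>k. u k x" n] range[OF that] by (simp add: abs_le_iff)
  ultimately show "\<exists>g. continuous_map X euclideanreal g \<and>
      (\<forall>x\<in>topspace X. \<bar>(\<Sum>k. r ^ k * u k x) - g x\<bar> < e)"
    by (meson order_le_less_trans)
qed

lemma closedin_le_level:
  assumes "continuous_map X euclideanreal f"
  shows "closedin X {x \<in> topspace X. f x \<le> c}"
  using closedin_continuous_map_preimage[OF assms, of "{..c}"] by simp

lemma closedin_ge_level:
  assumes "continuous_map X euclideanreal f"
  shows "closedin X {x \<in> topspace X. c \<le> f x}"
  using closedin_continuous_map_preimage[OF assms, of "{c..}"] by simp

lemma openin_less_level:
  assumes "continuous_map X euclideanreal f"
  shows "openin X {x \<in> topspace X. f x < c}"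
  using openin_continuous_map_preimage[OF assms, of "{..<c}"] by simp

lemma openin_greater_level:
  assumes "continuous_map X euclideanreal f"
  shows "openin X {x \<in> topspace X. c < f x}"
  using openin_continuous_map_preimage[OF assms, of "{c<..}"] by simp

lemma closedin_eq_level:
  assumes "continuous_map X euclideanreal f"
  shows "closedin X {x \<in> topspace X. f x = c}"
  using closedin_continuous_map_preimage[OF assms, of "{c}"] by simp

locale compact_Hausdorff =
  fixes K :: "'a topology"
  assumes compact: "compact_space K" and Hausdorff: "Hausdorff_space K"
begin

abbreviation cont :: "('a \<Rightarrow> real) \<Rightarrow> bool" where
  "cont \<equiv> continuous_map K euclideanreal"

lemma normal: "normal_space K"
  using compact Hausdorff compact_Hausdorff_or_regular_imp_normal_space by blast

lemma cont_bounded: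
  assumes "cont f"
  obtains M where "M > 0" and "\<And>x. x \<in> topspace K \<Longrightarrow> \<bar>f x\<bar> \<le> M"
proof -
  have "compactin euclideanreal (f ` topspace K)"
    using image_compactin[OF _ assms] compact by (simp add: compact_space_def)
  then have "bounded (f ` topspace K)"
    by (simp add: compact_imp_bounded)
  then show thesis
    using that by (auto simp: bounded_pos)
qed

lemma Urysohn_01:
  assumes "closedin K S" and "closedin K T" and "S \<inter> T = {}"
  obtains f where "cont f" and "\<And>x. x \<in> topspace K \<Longrightarrow> 0 \<le> f x \<and> f x \<le> 1"
    and "\<And>x. x \<in> S \<Longrightarrow> f x = 0" and "\<And>x. x \<in> T \<Longrightarrow> f x = 1"
proof -
  obtain f where f: "continuous_map K (top_of_set {0..1::real}) f" "f ` S \<subseteq> {0}" "f ` T \<subseteq> {1}"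
    using Urysohn_lemma[OF normal assms(1,2), of "0::real" 1] assms(3)
    by (auto simp: disjnt_def)
  then have "cont f" "f \<in> topspace K \<rightarrow> {0..1}"
    by (auto simp: continuous_map_in_subtopology)
  with f that show thesis
    by (fastforce simp: Pi_iff)
qed

text \<open>
  The number \<open>y\<close> ranges over all reals, since it will be a value of \<open>\<phi>\<close> or of a perturbation of \<open>\<phi>\<close>.
\<close>
lemma uniform_modulus:
  assumes "cont \<phi>" and "continuous_on UNIV (g :: real \<Rightarrow> real)" and "\<gamma> > 0" 
  obtains \<epsilon> where "\<epsilon> > 0" 
    "\<And>x y. x \<in> topspace K \<Longrightarrow> \<bar>y - \<phi> x\<bar> < \<epsilon> \<Longrightarrow> \<bar>g y - g (\<phi> x)\<bar> < \<gamma>"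
proof -
  obtain M where M: "\<And>x. x \<in> topspace K \<Longrightarrow> \<bar>\<phi> x\<bar> \<le> M"
    using cont_bounded[OF assms(1)] by blast
  have "uniformly_continuous_on {- M - 1..M + 1} g"
    using assms(2) by (intro compact_uniformly_continuous) (auto intro: continuous_on_subset)
  then obtain d where d: "d > 0"
      "\<And>s t. s \<in> {- M - 1..M + 1} \<Longrightarrow> t \<in> {- M - 1..M + 1} \<Longrightarrow> dist t s < d \<Longrightarrow> dist (g t) (g s) < \<gamma>"
    using \<open>\<gamma> > 0\<close> unfolding uniformly_continuous_on_def by meson
  show thesis
  proof (rule that[of "min d 1"])
    fix x y
    assume x: "x \<in> topspace K" and y: "\<bar>y - \<phi> x\<bar> < min d 1"
    have "\<phi> x \<in> {- M - 1..M + 1}" "y \<in> {- M - 1..M + 1}"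
      using M[OF x] y by (auto simp: abs_le_iff abs_less_iff)
    then show "\<bar>g y - g (\<phi> x)\<bar> < \<gamma>"
      using d(2)[of "\<phi> x" y] y by (simp add: dist_real_def)
  qed (use d in auto)
qed

lemma controls_superposition:
  assumes "finite I" and "\<And>i. i \<in> I \<Longrightarrow> cont (\<phi> i)"
    and "\<And>i. i \<in> I \<Longrightarrow> continuous_on UNIV (g i :: real \<Rightarrow> real)"
    and f: "\<And>x. x \<in> topspace K \<Longrightarrow> f x = (\<Sum>i\<in>I. g i (\<phi> i x))"
  shows "controls K (\<phi> ` I) f"
  unfolding controls_def
proof (intro allI impI)
  fix \<gamma> :: real
  assume "\<gamma> > 0"
  let ?\<gamma> = "\<gamma> / (card I + 1)"
  have "\<forall>i\<in>I. \<exists>\<epsilon>>0. \<forall>x\<in>topspace K. \<forall>y. \<bar>y - \<phi> i x\<bar> < \<epsilon> \<longrightarrow> \<bar>g i y - g i (\<phi> i x)\<bar> < ?\<gamma>"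
  proof
    fix i
    assume "i \<in> I"
    moreover have "?\<gamma> > 0"
      using \<open>\<gamma> > 0\<close> by simp
    ultimately show "\<exists>\<epsilon>>0. \<forall>x\<in>topspace K. \<forall>y. \<bar>y - \<phi> i x\<bar> < \<epsilon> \<longrightarrow> \<bar>g i y - g i (\<phi> i x)\<bar> < ?\<gamma>"
      using uniform_modulus[of "\<phi> i" "g i" ?\<gamma>] assms(2,3) by metis
  qed
  then obtain \<epsilon> where \<epsilon>: "\<And>i. i \<in> I \<Longrightarrow> \<epsilon> i > 0"
      "\<And>i x y. i \<in> I \<Longrightarrow> x \<in> topspace K \<Longrightarrow> \<bar>y - \<phi> i x\<bar> < \<epsilon> i \<Longrightarrow> \<bar>g i y - g i (\<phi> i x)\<bar> < ?\<gamma>"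
    by metis
  define e where "e = Min (insert 1 (\<epsilon> ` I))"
  have e: "e > 0" "\<And>i. i \<in> I \<Longrightarrow> e \<le> \<epsilon> i"
    using assms(1) \<epsilon>(1) by (auto simp: e_def)
  show "\<exists>\<epsilon>>0. \<forall>x\<in>topspace K. \<forall>y\<in>topspace K.
      (\<forall>\<psi>\<in>\<phi> ` I. \<bar>\<psi> x - \<psi> y\<bar> < \<epsilon>) \<longrightarrow> \<bar>f x - f y\<bar> < \<gamma>"
  proof (intro exI[of _ e] conjI ballI impI e(1))
    fix x y
    assume xy: "x \<in> topspace K" "y \<in> topspace K" and near: "\<forall>\<psi>\<in>\<phi> ` I. \<bar>\<psi> x - \<psi> y\<bar> < e"
    have "\<bar>f x - f y\<bar> = \<bar>\<Sum>i\<in>I. g i (\<phi> i x) - g i (\<phi> i y)\<bar>"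
      by (simp add: f xy sum_subtractf)
    also have "\<dots> \<le> (\<Sum>i\<in>I. \<bar>g i (\<phi> i x) - g i (\<phi> i y)\<bar>)"
      by (rule sum_abs)
    also have "\<dots> \<le> (\<Sum>i\<in>I. ?\<gamma>)"
      using \<epsilon>(2) e(2) near xy by (intro sum_mono) (metis imageI less_imp_le order_less_le_trans)
    also have "\<dots> < \<gamma>"
      using \<open>\<gamma> > 0\<close> by (simp add: field_simps)
    finally show "\<bar>f x - f y\<bar> < \<gamma>" .
  qed
qed

lemma basic_family_controls:
  assumes "basic_family K \<Phi>" and "cont f"
  obtains F where "finite F" and "F \<subseteq> \<Phi>" and "controls K F f"
proof -
  have "restrict f (topspace K) \<in> cont_funs K"
    using assms(2) by (auto simp: cont_funs_def intro: continuous_map_eq)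
  then obtain n :: nat and \<phi> and g :: "nat \<Rightarrow> real \<Rightarrow> real"
    where \<phi>: "\<forall>i\<in>{1..n}. \<phi> i \<in> \<Phi> \<and> continuous_on UNIV (g i)"
      and rep: "\<forall>x\<in>topspace K. restrict f (topspace K) x = (\<Sum>i=1..n. (g i \<circ> \<phi> i) x)"
    using assms(1) unfolding basic_family_def by blast
  have "controls K (\<phi> ` {1..n}) f"
    by (rule controls_superposition[where g = g])
      (use \<phi> rep assms(1) in \<open>auto simp: basic_family_def cont_funs_def\<close>)
  then show thesis
    using that \<phi> by blast
qed

end

section \<open>Essential families and covering dimension\<close>

definition disjoint_closed_pairs ::
    "'a topology \<Rightarrow> 'i set \<Rightarrow> ('i \<Rightarrow> 'a set) \<Rightarrow> ('i \<Rightarrow> 'a set) \<Rightarrow> bool" where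
  "disjoint_closed_pairs X I A B \<longleftrightarrow>
     (\<forall>i\<in>I. closedin X (A i) \<and> closedin X (B i) \<and> A i \<inter> B i = {})"

text \<open>
  The complement of \<open>A' i \<union> B' i\<close> is a thickened partition between \<open>A i\<close> and \<open>B i\<close>; a family of
  pairs is inessential when such partitions can be chosen without a common point.  The set \<open>Z\<close>
  restricts where the partitions must not meet, while the pairs live on the whole space.
\<close>
definition inessential ::
    "'a topology \<Rightarrow> 'a set \<Rightarrow> 'i set \<Rightarrow> ('i \<Rightarrow> 'a set) \<Rightarrow> ('i \<Rightarrow> 'a set) \<Rightarrow> bool" where
  "inessential X Z I A B \<longleftrightarrow>
     (\<exists>A' B'. disjoint_closed_pairs X I A' B' \<and> (\<forall>i\<in>I. A i \<subseteq> A' i \<and> B i \<subseteq> B' i) \<and>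
        Z \<subseteq> (\<Union>i\<in>I. A' i \<union> B' i))"

lemma inessential_mono:
  assumes "inessential X Z J A B" and "J \<subseteq> I" and "disjoint_closed_pairs X I A B"
  shows "inessential X Z I A B"
proof -
  obtain A' B' where *: "disjoint_closed_pairs X J A' B'" "\<forall>i\<in>J. A i \<subseteq> A' i \<and> B i \<subseteq> B' i"
      "Z \<subseteq> (\<Union>i\<in>J. A' i \<union> B' i)"
    using assms(1) unfolding inessential_def by blast
  let ?A = "\<lambda>i. if i \<in> J then A' i else A i" and ?B = "\<lambda>i. if i \<in> J then B' i else B i"
  have "disjoint_closed_pairs X I ?A ?B" "\<forall>i\<in>I. A i \<subseteq> ?A i \<and> B i \<subseteq> ?B i"
    using * assms(3) by (auto simp: disjoint_closed_pairs_def)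
  moreover have "(\<Union>i\<in>J. A' i \<union> B' i) \<subseteq> (\<Union>i\<in>I. ?A i \<union> ?B i)"
    using assms(2) by fastforce
  ultimately show ?thesis
    unfolding inessential_def using *(3) by (meson order_trans)
qed

lemma inessential_antimono:
  assumes "inessential X Z I A' B'" and "\<And>i. i \<in> I \<Longrightarrow> A i \<subseteq> A' i \<and> B i \<subseteq> B' i"
  shows "inessential X Z I A B"
proof -
  obtain A'' B'' where "disjoint_closed_pairs X I A'' B''" "\<forall>i\<in>I. A' i \<subseteq> A'' i \<and> B' i \<subseteq> B'' i"
      "Z \<subseteq> (\<Union>i\<in>I. A'' i \<union> B'' i)"
    using assms(1) unfolding inessential_def by blast
  then show ?thesis
    unfolding inessential_def using assms(2) by blast
qed

lemma inessential_reindex: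
  assumes "inessential X Z I (\<lambda>i. A (b i)) (\<lambda>i. B (b i))" and "inj_on b I"
  shows "inessential X Z (b ` I) A B"
proof -
  obtain A' B' where *: "disjoint_closed_pairs X I A' B'"
      "\<forall>i\<in>I. A (b i) \<subseteq> A' i \<and> B (b i) \<subseteq> B' i" "Z \<subseteq> (\<Union>i\<in>I. A' i \<union> B' i)"
    using assms(1) unfolding inessential_def by blast
  have inv: "inv_into I b (b i) = i" if "i \<in> I" for i
    using that assms(2) by simp
  show ?thesis
    unfolding inessential_def
    by (rule exI[of _ "A' \<circ> inv_into I b"], rule exI[of _ "B' \<circ> inv_into I b"])
      (use * in \<open>auto simp: disjoint_closed_pairs_def inv\<close>)
qed


text \<open>
  Enlarging the pairs only shrinks the gaps between them, so partitions for all the subfamilies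
  can be arranged one subfamily after another.
\<close>
lemma simultaneous_partitions:
  assumes "finite \<I>" and "disjoint_closed_pairs X R A B" and "\<And>I. I \<in> \<I> \<Longrightarrow> I \<subseteq> R"
    and small: "\<And>I A B. I \<in> \<I> \<Longrightarrow> disjoint_closed_pairs X I A B \<Longrightarrow> inessential X Z I A B"
  shows "\<exists>A' B'. disjoint_closed_pairs X R A' B' \<and> (\<forall>i\<in>R. A i \<subseteq> A' i \<and> B i \<subseteq> B' i) \<and>
           (\<forall>I\<in>\<I>. Z \<subseteq> (\<Union>i\<in>I. A' i \<union> B' i))"
  using assms(1,3,4)
proof (induction \<I>)
  case empty
  then show ?case
    using assms(2) by blast
next
  case (insert I \<I>)
  have "\<exists>A' B'. disjoint_closed_pairs X R A' B' \<and> (\<forall>i\<in>R. A i \<subseteq> A' i \<and> B i \<subseteq> B' i) \<and>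
      (\<forall>I\<in>\<I>. Z \<subseteq> (\<Union>i\<in>I. A' i \<union> B' i))"
    using insert.prems by (intro insert.IH) auto
  then obtain A1 B1 where 1: "disjoint_closed_pairs X R A1 B1"
      "\<forall>i\<in>R. A i \<subseteq> A1 i \<and> B i \<subseteq> B1 i" "\<forall>I\<in>\<I>. Z \<subseteq> (\<Union>i\<in>I. A1 i \<union> B1 i)"
    by blast
  have "disjoint_closed_pairs X I A1 B1"
    using 1(1) insert.prems(1)[of I] by (auto simp: disjoint_closed_pairs_def)
  then have "inessential X Z I A1 B1"
    using insert.prems(2) by blast
  then obtain A2 B2 where 2: "disjoint_closed_pairs X I A2 B2"
      "\<forall>i\<in>I. A1 i \<subseteq> A2 i \<and> B1 i \<subseteq> B2 i" "Z \<subseteq> (\<Union>i\<in>I. A2 i \<union> B2 i)"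
    unfolding inessential_def by blast
  let ?A = "\<lambda>i. if i \<in> I then A2 i else A1 i" and ?B = "\<lambda>i. if i \<in> I then B2 i else B1 i"
  have sub: "A1 i \<union> B1 i \<subseteq> ?A i \<union> ?B i" for i
    using 2(2) by auto
  show ?case
  proof (rule exI[of _ ?A], rule exI[of _ ?B], intro conjI)
    show "disjoint_closed_pairs X R ?A ?B"
      using 1(1) 2(1) by (auto simp: disjoint_closed_pairs_def)
    show "\<forall>i\<in>R. A i \<subseteq> ?A i \<and> B i \<subseteq> ?B i"
      using 1(2) 2(2) by fastforce
    have "Z \<subseteq> (\<Union>i\<in>L. ?A i \<union> ?B i)" if "L \<in> insert I \<I>" for L
    proof (cases "L = I")
      case True
      then show ?thesis
        using 2(3) by simp
    next
      case False
      then have "Z \<subseteq> (\<Union>i\<in>L. A1 i \<union> B1 i)"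
        using that 1(3) by blast
      then show ?thesis
        using sub by blast
    qed
    then show "\<forall>L\<in>insert I \<I>. Z \<subseteq> (\<Union>i\<in>L. ?A i \<union> ?B i)"
      by blast
  qed
qed

context compact_Hausdorff
begin

lemma closed_shrinking:
  assumes "finite \<U>" and "\<And>U. U \<in> \<U> \<Longrightarrow> openin K U" and "\<Union>\<U> = topspace K"
  obtains C where "\<And>U. U \<in> \<U> \<Longrightarrow> closedin K (C U)" and "\<And>U. U \<in> \<U> \<Longrightarrow> C U \<subseteq> U"
    and "topspace K \<subseteq> (\<Union>U\<in>\<U>. C U)"
proof -
  have reg: "neighbourhood_base_of (closedin K) K"
    using compact_Hausdorff_imp_regular_space[OF compact Hausdorff]
    by (simp add: neighbourhood_base_of_closedin)
  have "\<exists>t. fst t \<in> \<U> \<and> openin K (fst (snd t)) \<and> closedin K (snd (snd t)) \<and>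
      x \<in> fst (snd t) \<and> fst (snd t) \<subseteq> snd (snd t) \<and> snd (snd t) \<subseteq> fst t"
    if x: "x \<in> topspace K" for x
  proof -
    obtain U where U: "U \<in> \<U>" "x \<in> U"
      using x assms(3) by blast
    have "\<exists>O' C. openin K O' \<and> closedin K C \<and> x \<in> O' \<and> O' \<subseteq> C \<and> C \<subseteq> U"
      using U(2) assms(2)[OF U(1)] by (intro reg[unfolded neighbourhood_base_of, rule_format] conjI)
    then obtain O' C where "openin K O'" "closedin K C" "x \<in> O'" "O' \<subseteq> C" "C \<subseteq> U"
      by (elim exE conjE)
    with U show ?thesis
      by (intro exI[of _ "(U, O', C)"]) simp
  qed
  then obtain t where t: "\<forall>x\<in>topspace K. fst (t x) \<in> \<U> \<and> openin K (fst (snd (t x))) \<and>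
      closedin K (snd (snd (t x))) \<and> x \<in> fst (snd (t x)) \<and> fst (snd (t x)) \<subseteq> snd (snd (t x)) \<and>
      snd (snd (t x)) \<subseteq> fst (t x)"
    using bchoice[of "topspace K" "\<lambda>x t. fst t \<in> \<U> \<and> openin K (fst (snd t)) \<and>
      closedin K (snd (snd t)) \<and> x \<in> fst (snd t) \<and> fst (snd t) \<subseteq> snd (snd t) \<and>
      snd (snd t) \<subseteq> fst t"] by blast
  define u o' c where "u = fst \<circ> t" and "o' = fst \<circ> snd \<circ> t" and "c = snd \<circ> snd \<circ> t"
  then have uoc: "\<And>x. x \<in> topspace K \<Longrightarrow> u x \<in> \<U> \<and> openin K (o' x) \<and>
      closedin K (c x) \<and> x \<in> o' x \<and> o' x \<subseteq> c x \<and> c x \<subseteq> u x"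
    using t by simp
  have "topspace K \<subseteq> \<Union>(o' ` topspace K)" "\<forall>U\<in>o' ` topspace K. openin K U"
    using uoc by blast+
  then obtain \<F> where \<F>: "finite \<F>" "\<F> \<subseteq> o' ` topspace K" "topspace K \<subseteq> \<Union>\<F>"
    using compact[unfolded compact_space_alt, rule_format, of "o' ` topspace K"] by blast
  obtain S where S: "S \<subseteq> topspace K" "finite S" "\<F> = o' ` S"
    using finite_subset_image[OF \<F>(1,2)] by (elim exE conjE)
  show thesis
  proof (rule that[of "\<lambda>U. \<Union>(c ` {x \<in> S. u x = U})"])
    show "closedin K (\<Union>(c ` {x \<in> S. u x = U}))" for U
      using S uoc by (intro closedin_Union) auto
    show "\<Union>(c ` {x \<in> S. u x = U}) \<subseteq> U" for U
    proof (rule UN_least)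
      fix x
      assume "x \<in> {x \<in> S. u x = U}"
      then show "c x \<subseteq> U"
        using uoc[of x] S(1) by auto
    qed
    show "topspace K \<subseteq> (\<Union>U\<in>\<U>. \<Union>(c ` {x \<in> S. u x = U}))"
    proof
      fix y
      assume "y \<in> topspace K"
      then obtain x where x: "x \<in> S" "y \<in> o' x"
        using \<F>(3) S(3) by auto
      then have "u x \<in> \<U>" "y \<in> c x"
        using uoc[of x] S(1) by auto
      with x show "y \<in> (\<Union>U\<in>\<U>. \<Union>(c ` {x \<in> S. u x = U}))"
        by auto
    qed
  qed
qed

text \<open>
  Shrink a cover \<open>U 0, \<dots>, U (r - 1)\<close> to closed sets \<open>A i\<close> and enlarge the pairs of \<open>A i\<close> and the
  complement of \<open>U i\<close> until no point lies in the gaps of \<open>c\<close> of these pairs.  The open sets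
  \<open>Q i = (K - B' i) \<inter> (\<Inter>j<i. K - A' j)\<close> refine the cover.  Since a point of both \<open>Q i\<close> and \<open>Q j\<close>
  with \<open>j < i\<close> lies in the gap of the \<open>j\<close>-th pair, the order of this refinement is at most \<open>c\<close>.
\<close>
lemma covering_dim_le_if_inessential:
  assumes iness: "\<And>(I::nat set) A B. finite I \<Longrightarrow> card I = c \<Longrightarrow> disjoint_closed_pairs K I A B \<Longrightarrow>
      inessential K (topspace K) I A B"
  shows "covering_dim_le K (int c - 1)"
  unfolding covering_dim_le_def
proof (intro conjI allI impI)
  fix \<U>
  assume U: "finite \<U> \<and> (\<forall>U\<in>\<U>. openin K U) \<and> \<Union>\<U> = topspace K"
  obtain C where C: "\<And>U. U \<in> \<U> \<Longrightarrow> closedin K (C U)" "\<And>U. U \<in> \<U> \<Longrightarrow> C U \<subseteq> U"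
      "topspace K \<subseteq> (\<Union>U\<in>\<U>. C U)"
    by (rule closed_shrinking[of \<U>]) (use U in auto)
  define r where "r = card \<U>"
  obtain u where u: "bij_betw u {..<r} \<U>"
    using ex_bij_betw_nat_finite[of \<U>] U unfolding r_def lessThan_atLeast0 by auto
  have u_in: "u i \<in> \<U>" if "i < r" for i
    using u that by (auto simp: bij_betw_def)
  have u_ex: "\<exists>i<r. V = u i" if "V \<in> \<U>" for V
    using u that by (auto simp: bij_betw_def)
  let ?A = "\<lambda>i. C (u i)" and ?B = "\<lambda>i. topspace K - u i"
  have "disjoint_closed_pairs K {..<r} ?A ?B"
    unfolding disjoint_closed_pairs_def
  proof (intro ballI conjI)
    fix i
    assume "i \<in> {..<r}"
    then have "u i \<in> \<U>"
      using u_in by simp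
    then show "closedin K (C (u i))" "closedin K (topspace K - u i)" "C (u i) \<inter> (topspace K - u i) = {}"
      using C(1,2)[of "u i"] U by auto
  qed
  then have "\<exists>A' B'. disjoint_closed_pairs K {..<r} A' B' \<and>
      (\<forall>i\<in>{..<r}. ?A i \<subseteq> A' i \<and> ?B i \<subseteq> B' i) \<and>
      (\<forall>I\<in>{I. I \<subseteq> {..<r} \<and> card I = c}. topspace K \<subseteq> (\<Union>i\<in>I. A' i \<union> B' i))"
    by (intro simultaneous_partitions iness) (auto intro: finite_subset)
  then obtain A' B' where AB: "disjoint_closed_pairs K {..<r} A' B'"
      "\<forall>i\<in>{..<r}. ?A i \<subseteq> A' i \<and> ?B i \<subseteq> B' i"
      "\<forall>I\<in>{I. I \<subseteq> {..<r} \<and> card I = c}. topspace K \<subseteq> (\<Union>i\<in>I. A' i \<union> B' i)"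
    by (elim exE conjE)
  define Q where "Q i = topspace K - (B' i \<union> (\<Union>j<i. A' j))" for i
  have openQ: "openin K (Q i)" if "i < r" for i
    unfolding Q_def using AB(1) that
    by (intro openin_diff closedin_Un closedin_Union) (auto simp: disjoint_closed_pairs_def)
  have coverQ: "\<exists>i<r. x \<in> Q i" if x: "x \<in> topspace K" for x
  proof -
    obtain V where "V \<in> \<U>" "x \<in> C V"
      using x C(3) by auto
    moreover obtain k where "k < r" "V = u k"
      using u_ex[OF \<open>V \<in> \<U>\<close>] by auto
    ultimately have ex: "\<exists>i. i < r \<and> x \<in> A' i"
      using AB(2) by (intro exI[of _ k]) auto
    define i where "i = (LEAST i. i < r \<and> x \<in> A' i)"
    have i: "i < r" "x \<in> A' i"
      using LeastI_ex[OF ex] by (auto simp: i_def)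
    moreover have "x \<notin> A' j" if "j < i" for j
      using not_less_Least[OF that[unfolded i_def]] that i(1) by auto
    ultimately have "x \<in> Q i"
      using AB(1) x by (auto simp: Q_def disjoint_closed_pairs_def)
    with i show ?thesis by auto
  qed
  have orderQ: "card {i. i < r \<and> x \<in> Q i} \<le> c" if "x \<in> topspace K" for x
  proof (rule ccontr)
    \<comment> \<open>all indices but the largest one belong to gaps containing \<open>x\<close>\<close>
    let ?R = "{i. i < r \<and> x \<in> Q i}"
    assume "\<not> card ?R \<le> c"
    then have "card ?R > 0"
      by simp
    then have "?R \<noteq> {}"
      by (metis card.empty less_irrefl)
    then have "c \<le> card (?R - {Max ?R})"
      using \<open>\<not> card ?R \<le> c\<close> Max_in[of ?R] by (simp add: card_Diff_singleton)
    then obtain I where I: "I \<subseteq> ?R - {Max ?R}" "card I = c"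
      by (meson obtain_subset_with_card_n)
    have "x \<in> Q (Max ?R)"
      using Max_in[OF _ \<open>?R \<noteq> {}\<close>] by simp
    have "x \<notin> A' j \<union> B' j" if "j \<in> I" for j
    proof -
      have "j \<in> ?R - {Max ?R}"
        using I(1) that by (rule subsetD)
      then have "j \<in> ?R" "j \<noteq> Max ?R"
        by auto
      moreover have "j \<le> Max ?R"
        using \<open>j \<in> ?R\<close> by (intro Max_ge) auto
      ultimately have "j < Max ?R"
        by linarith
      then show ?thesis
        using \<open>x \<in> Q (Max ?R)\<close> \<open>j \<in> ?R\<close> by (auto simp: Q_def)
    qed
    moreover have "I \<subseteq> {..<r}"
      using I by auto
    ultimately show False
      using AB(3)[rule_format, of I] I(2) \<open>x \<in> topspace K\<close> by auto
  qed
  show "\<exists>\<V>. finite \<V> \<and> (\<forall>V\<in>\<V>. openin K V) \<and> \<Union>\<V> = topspace K \<and> (\<forall>V\<in>\<V>. \<exists>U\<in>\<U>. V \<subseteq> U) \<and>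
      (\<forall>x\<in>topspace K. int (card {V \<in> \<V>. x \<in> V}) \<le> int c - 1 + 1)"
  proof (intro exI[of _ "Q ` {..<r}"] conjI ballI)
    show "\<Union>(Q ` {..<r}) = topspace K"
    proof
      show "\<Union>(Q ` {..<r}) \<subseteq> topspace K"
        by (auto simp: Q_def)
      show "topspace K \<subseteq> \<Union>(Q ` {..<r})"
        using coverQ by auto
    qed
    show "\<exists>U\<in>\<U>. V \<subseteq> U" if V: "V \<in> Q ` {..<r}" for V
    proof -
      obtain i where i: "i < r" "V = Q i"
        using V by auto
      then have "V \<subseteq> u i"
        using AB(2) by (auto simp: Q_def)
      with u_in[OF i(1)] show ?thesis ..
    qed
    show "int (card {V \<in> Q ` {..<r}. x \<in> V}) \<le> int c - 1 + 1" if "x \<in> topspace K" for x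
    proof -
      have "{V \<in> Q ` {..<r}. x \<in> V} = Q ` {i. i < r \<and> x \<in> Q i}"
        by auto
      then have "card {V \<in> Q ` {..<r}. x \<in> V} \<le> card {i. i < r \<and> x \<in> Q i}"
        by (simp add: card_image_le)
      then show ?thesis
        using orderQ[OF that] by simp
    qed
  qed (use openQ in auto)
qed simp

text \<open>
  If the conclusion fails, any \<open>card \<Z> * card I\<close> pairs can be split into one group for each \<open>Z\<close>, each of which has
  partitions without a common point in its \<open>Z\<close>; this bounds the covering dimension.
\<close>
lemma infinite_dimensional_piece:
  fixes I :: "nat set"
  assumes "\<not> finite_dimensional K" and "finite \<Z>" and "topspace K \<subseteq> \<Union>\<Z>" and "finite I"
  obtains (piece) Z A B where "Z \<in> \<Z>" and "disjoint_closed_pairs K I A B"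
    and "\<not> inessential K Z I A B"
proof (rule ccontr)
  assume no: "\<not> thesis"
  have iness: "inessential K Z I A B" if "Z \<in> \<Z>" "disjoint_closed_pairs K I A B" for Z A B
  proof (rule ccontr)
    assume "\<not> inessential K Z I A B"
    with that have thesis by (rule piece)
    with no show False ..
  qed
  have "inessential K (topspace K) J A B"
    if J: "finite J" "card J = card (\<Z> \<times> I)" and pairs: "disjoint_closed_pairs K J A B"
    for J :: "nat set" and A B
  proof -
    obtain b where b: "bij_betw b (\<Z> \<times> I) J"
      using finite_same_card_bij[of "\<Z> \<times> I" J] assms J by auto
    have "\<forall>Z\<in>\<Z>. \<exists>p. disjoint_closed_pairs K I (fst p) (snd p) \<and>
        (\<forall>i\<in>I. A (b (Z, i)) \<subseteq> fst p i \<and> B (b (Z, i)) \<subseteq> snd p i) \<and>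
        Z \<subseteq> (\<Union>i\<in>I. fst p i \<union> snd p i)"
    proof
      fix Z
      assume "Z \<in> \<Z>"
      then have "inessential K Z I (\<lambda>i. A (b (Z, i))) (\<lambda>i. B (b (Z, i)))"
        using pairs b by (intro iness) (auto simp: disjoint_closed_pairs_def bij_betw_def)
      then show "\<exists>p. disjoint_closed_pairs K I (fst p) (snd p) \<and>
          (\<forall>i\<in>I. A (b (Z, i)) \<subseteq> fst p i \<and> B (b (Z, i)) \<subseteq> snd p i) \<and>
          Z \<subseteq> (\<Union>i\<in>I. fst p i \<union> snd p i)"
        unfolding inessential_def by simp
    qed
    from bchoice[OF this] obtain p where p:
        "\<forall>Z\<in>\<Z>. disjoint_closed_pairs K I (fst (p Z)) (snd (p Z)) \<and>
          (\<forall>i\<in>I. A (b (Z, i)) \<subseteq> fst (p Z) i \<and> B (b (Z, i)) \<subseteq> snd (p Z) i) \<and>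
          Z \<subseteq> (\<Union>i\<in>I. fst (p Z) i \<union> snd (p Z) i)"
      by (elim exE)
    have "inessential K (topspace K) (\<Z> \<times> I) (\<lambda>p. A (b p)) (\<lambda>p. B (b p))"
      unfolding inessential_def
    proof (intro exI conjI)
      show "disjoint_closed_pairs K (\<Z> \<times> I) (\<lambda>z. fst (p (fst z)) (snd z))
          (\<lambda>z. snd (p (fst z)) (snd z))"
        using p by (simp add: disjoint_closed_pairs_def)
      show "\<forall>z\<in>\<Z> \<times> I. A (b z) \<subseteq> fst (p (fst z)) (snd z) \<and> B (b z) \<subseteq> snd (p (fst z)) (snd z)"
        using p by simp
      show "topspace K \<subseteq> (\<Union>z\<in>\<Z> \<times> I. fst (p (fst z)) (snd z) \<union> snd (p (fst z)) (snd z))"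
      proof
        fix x
        assume "x \<in> topspace K"
        then obtain Z where Z: "Z \<in> \<Z>" "x \<in> Z"
          using assms(3) by auto
        then obtain i where "i \<in> I" "x \<in> fst (p Z) i \<union> snd (p Z) i"
          using bspec[OF p Z(1)] by auto
        with Z(1) show "x \<in> (\<Union>z\<in>\<Z> \<times> I. fst (p (fst z)) (snd z) \<union> snd (p (fst z)) (snd z))"
          by (intro UN_I[of "(Z, i)"]) auto
      qed
    qed
    then have "inessential K (topspace K) (b ` (\<Z> \<times> I)) A B"
      using b by (intro inessential_reindex) (auto simp: bij_betw_def)
    then show ?thesis
      using b by (simp add: bij_betw_def)
  qed
  then have "covering_dim_le K (int (card (\<Z> \<times> I)) - 1)"
    by (rule covering_dim_le_if_inessential)
  with assms(1) show False
    unfolding finite_dimensional_def by blast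
qed

end

section \<open>Essential families are not controlled by few functions\<close>

lemma closedin_Collect_Ball:
  assumes "finite F" and "closedin X Z" and "\<And>\<phi>. \<phi> \<in> F \<Longrightarrow> closedin X (S \<phi>)"
  shows "closedin X {x \<in> Z. \<forall>\<phi>\<in>F. x \<in> S \<phi>}"
  using assms(1,3)
proof (induction F)
  case empty
  then show ?case
    using assms(2) by simp
next
  case (insert \<phi> F)
  have "{x \<in> Z. \<forall>\<psi>\<in>insert \<phi> F. x \<in> S \<psi>} = {x \<in> Z. \<forall>\<psi>\<in>F. x \<in> S \<psi>} \<inter> S \<phi>"
    by auto
  then show ?case
    using insert by (simp add: closedin_Int)
qed

text \<open>
  The lattices \<open>b / m + \<int>\<close> with \<open>b < m\<close> are at distance at least \<open>1 / m\<close> from each other, so a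
  number is closer than \<open>1 / (2 m)\<close> to at most one of them.
\<close>
lemma far_from_shifted_lattice:
  fixes r :: "'f \<Rightarrow> real" and b :: "'i \<Rightarrow> nat"
  assumes F: "finite F" "card F < card I" and b: "inj_on b I" "\<And>i. i \<in> I \<Longrightarrow> b i < m"
  obtains (far) i where "i \<in> I" and "\<And>\<phi> k. \<phi> \<in> F \<Longrightarrow> 1 / (2 * real m) \<le> \<bar>r \<phi> - real (b i) / real m - of_int k\<bar>"
proof (rule ccontr)
  assume no: "\<not> thesis"
  have "\<exists>\<phi>. \<phi> \<in> F \<and> (\<exists>k. \<bar>r \<phi> - real (b i) / real m - of_int k\<bar> < 1 / (2 * real m))"
    if "i \<in> I" for i
  proof (rule ccontr)
    assume "\<not> ?thesis"
    then have "1 / (2 * real m) \<le> \<bar>r \<phi> - real (b i) / real m - of_int k\<bar>" if "\<phi> \<in> F" for \<phi> k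
      using that by (auto simp: not_less)
    with \<open>i \<in> I\<close> have thesis
      by (rule far)
    with no show False ..
  qed
  then have "\<forall>i\<in>I. \<exists>p. fst p \<in> F \<and>
      \<bar>r (fst p) - real (b i) / real m - of_int (snd p)\<bar> < 1 / (2 * real m)"
    by simp
  from bchoice[OF this] obtain p where p: "\<forall>i\<in>I. fst (p i) \<in> F \<and>
      \<bar>r (fst (p i)) - real (b i) / real m - of_int (snd (p i))\<bar> < 1 / (2 * real m)"
    by (elim exE)
  define \<phi> k where "\<phi> i = fst (p i)" and "k i = snd (p i)" for i
  have \<phi>: "\<And>i. i \<in> I \<Longrightarrow> \<phi> i \<in> F"
      "\<And>i. i \<in> I \<Longrightarrow> \<bar>r (\<phi> i) - real (b i) / real m - of_int (k i)\<bar> < 1 / (2 * real m)"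
    using p by (auto simp: \<phi>_def k_def)
  have "inj_on \<phi> I"
  proof (rule inj_onI)
    fix i j
    assume ij: "i \<in> I" "j \<in> I" "\<phi> i = \<phi> j"
    have m: "real m > 0"
      using b(2)[OF ij(1)] by simp
    let ?r = "r (\<phi> i)"
    have "(?r - real (b i) / real m - of_int (k i)) - (?r - real (b j) / real m - of_int (k j)) =
        (real (b j) - real (b i)) / real m + (of_int (k j) - of_int (k i))"
      by (simp add: diff_divide_distrib)
    then have "\<bar>(real (b j) - real (b i)) / real m + (of_int (k j) - of_int (k i))\<bar> <
        1 / (2 * real m) + 1 / (2 * real m)"
      using \<phi>(2)[OF ij(1)] \<phi>(2)[OF ij(2)] unfolding ij(3) by linarith
    also have "\<dots> = 1 / real m"
      by (simp add: field_simps)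
    finally have "real m * \<bar>(real (b j) - real (b i)) / real m + (of_int (k j) - of_int (k i))\<bar> < 1"
      using m by (simp add: pos_less_divide_eq mult.commute)
    moreover have "real m * \<bar>(real (b j) - real (b i)) / real m + (of_int (k j) - of_int (k i))\<bar> =
        \<bar>real m * ((real (b j) - real (b i)) / real m + (of_int (k j) - of_int (k i)))\<bar>"
      using m by (simp add: abs_mult)
    moreover have "real m * ((real (b j) - real (b i)) / real m + (of_int (k j) - of_int (k i))) =
        real (b j) - real (b i) + real m * (of_int (k j) - of_int (k i))"
      using m by (simp add: distrib_left)
    ultimately have "\<bar>real (b j) - real (b i) + real m * (of_int (k j) - of_int (k i))\<bar> < 1"
      by simp
    then have "of_int \<bar>int (b j) - int (b i) + int m * (k j - k i)\<bar> < (1 :: real)"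
      by simp
    then have "int (b j) - int (b i) + int m * (k j - k i) = 0"
      by linarith
    then have eq: "int (b j) - int (b i) = int m * (k i - k j)"
      by (simp add: algebra_simps)
    have "\<bar>int (b j) - int (b i)\<bar> < int m"
      using b(2)[OF ij(1)] b(2)[OF ij(2)] by linarith
    then have "int m * \<bar>k i - k j\<bar> < int m * 1"
      unfolding eq by (simp add: abs_mult)
    then have "\<bar>k i - k j\<bar> < 1"
      using mult_left_mono[of 1 "\<bar>k i - k j\<bar>" "int m"] by linarith
    then have "int (b j) - int (b i) = 0"
      unfolding eq by simp
    then show "i = j"
      using b(1) ij by (simp add: inj_on_eq_iff)
  qed
  then have "card I \<le> card F"
    using \<phi>(1) F(1) by (intro card_inj_on_le) auto
  with F(2) show False
    by simp
qed

context compact_Hausdorff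
begin

text \<open>
  The functions in \<open>F\<close> map \<open>K\<close> into a Euclidean space of dimension \<open>card F < card I\<close>.  There the
  \<open>card I\<close> shifted copies of a fine cubical grid have no common point, and, slightly thickened, they
  serve as partitions: the cells of the \<open>i\<close>-th grid are so small that within \<open>Z\<close> none of them meets
  both \<open>A i\<close> and \<open>B i\<close>.
\<close>
lemma inessential_if_controlled:
  assumes F: "finite F" "card F < card I" "\<And>\<phi>. \<phi> \<in> F \<Longrightarrow> cont \<phi>"
    and I: "finite I" and Z: "closedin K Z" and pairs: "disjoint_closed_pairs K I A B"
    and controls: "\<And>i. i \<in> I \<Longrightarrow> controls K F (f i)"
    and gap: "\<gamma> > 0" "\<And>i x y. i \<in> I \<Longrightarrow> x \<in> A i \<inter> Z \<Longrightarrow> y \<in> B i \<inter> Z \<Longrightarrow> \<gamma> \<le> \<bar>f i x - f i y\<bar>"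
  shows "inessential K Z I A B"
proof -
  have "\<forall>i\<in>I. \<exists>\<epsilon>>0. \<forall>x\<in>topspace K. \<forall>y\<in>topspace K.
      (\<forall>\<phi>\<in>F. \<bar>\<phi> x - \<phi> y\<bar> < \<epsilon>) \<longrightarrow> \<bar>f i x - f i y\<bar> < \<gamma>"
    using controls gap(1) unfolding controls_def by blast
  from bchoice[OF this] obtain \<epsilon> where \<epsilon>: "\<forall>i\<in>I. \<epsilon> i > 0 \<and> (\<forall>x\<in>topspace K. \<forall>y\<in>topspace K.
      (\<forall>\<phi>\<in>F. \<bar>\<phi> x - \<phi> y\<bar> < \<epsilon> i) \<longrightarrow> \<bar>f i x - f i y\<bar> < \<gamma>)"
    by (elim exE)
  define t where "t = Min (\<epsilon> ` I)"
  have "I \<noteq> {}"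
    using F(2) by auto
  then have t: "t > 0" "\<And>i. i \<in> I \<Longrightarrow> t \<le> \<epsilon> i"
    using I \<epsilon> by (auto simp: t_def)
  define m where "m = card I"
  have m: "real m > 0"
    using I \<open>I \<noteq> {}\<close> by (simp add: m_def card_gt_0_iff)
  obtain b where "bij_betw b I {0..<m}"
    using ex_bij_betw_finite_nat[OF I] by (auto simp: m_def)
  then have b: "inj_on b I" "\<And>i. i \<in> I \<Longrightarrow> b i < m"
    by (auto simp: bij_betw_def)
  define y where "y i \<phi> x = \<phi> x / t - real (b i) / real m" for i and \<phi> :: "'a \<Rightarrow> real" and x
  have y_cont: "cont (y i \<phi>)" if "\<phi> \<in> F" for i \<phi>
    unfolding y_def divide_inverse using F(3)[OF that] by (intro continuous_intros)
  \<comment> \<open>\<open>key i x\<close> is the cell of \<open>x\<close> in the \<open>i\<close>-th grid, and \<open>box i v\<close> is the cell \<open>v\<close> shrunk by \<open>\<rho>\<close>\<close>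
  define key where "key i x = (\<lambda>\<phi>\<in>F. \<lfloor>y i \<phi> x\<rfloor>)" for i x
  have fin_key: "finite (key i ` topspace K)" for i
  proof -
    have "finite ((\<lambda>x. \<lfloor>y i \<phi> x\<rfloor>) ` topspace K)" if \<phi>: "\<phi> \<in> F" for \<phi>
    proof -
      obtain M where M: "\<And>x. x \<in> topspace K \<Longrightarrow> \<bar>y i \<phi> x\<bar> \<le> M"
        by (rule cont_bounded[OF y_cont[OF \<phi>]]) auto
      have "(\<lambda>x. \<lfloor>y i \<phi> x\<rfloor>) ` topspace K \<subseteq> {\<lfloor>- M\<rfloor>..\<lfloor>M\<rfloor>}"
        using M by (auto simp: abs_le_iff intro!: floor_mono) (smt (verit))
      then show ?thesis
        by (rule finite_subset) simp
    qed
    then have "finite (PiE F (\<lambda>\<phi>. (\<lambda>x. \<lfloor>y i \<phi> x\<rfloor>) ` topspace K))"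
      using F(1) by (intro finite_PiE)
    moreover have "key i ` topspace K \<subseteq> PiE F (\<lambda>\<phi>. (\<lambda>x. \<lfloor>y i \<phi> x\<rfloor>) ` topspace K)"
      by (auto simp: key_def)
    ultimately show ?thesis
      by (rule finite_subset[rotated])
  qed
  define \<rho> where "\<rho> = 1 / (2 * real m)"
  have \<rho>: "\<rho> > 0"
    using m by (simp add: \<rho>_def)
  define box where "box i v = {x \<in> Z. \<forall>\<phi>\<in>F. x \<in> {x \<in> topspace K. of_int (v \<phi>) + \<rho> \<le> y i \<phi> x} \<inter>
      {x \<in> topspace K. y i \<phi> x \<le> of_int (v \<phi>) + 1 - \<rho>}}" for i v
  have Z_sub: "Z \<subseteq> topspace K"
    using Z by (rule closedin_subset)
  have box_closed: "closedin K (box i v)" for i v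
    unfolding box_def using y_cont
    by (intro closedin_Collect_Ball F(1) Z closedin_Int closedin_le_level closedin_ge_level)
  have box_key: "v \<phi> = key i x \<phi>" if "x \<in> box i v" "\<phi> \<in> F" for i x v \<phi>
  proof -
    have "\<lfloor>y i \<phi> x\<rfloor> = v \<phi>"
      using that \<rho> by (intro floor_unique) (auto simp: box_def)
    then show ?thesis
      using that(2) by (simp add: key_def)
  qed
  have box_key_eq: "v = key i x" if "x \<in> box i v" "v \<in> key i ` topspace K" for i x v
  proof (rule extensionalityI[of v F])
    show "v \<in> extensional F" "key i x \<in> extensional F"
      using that(2) by (auto simp: key_def)
    show "v \<phi> = key i x \<phi>" if "\<phi> \<in> F" for \<phi>
      using box_key[OF \<open>x \<in> box i v\<close> that] .
  qed
  have box_small: "\<bar>f i x - f i z\<bar> < \<gamma>" if i: "i \<in> I" and xz: "x \<in> box i v" "z \<in> box i v" for i x z v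
  proof -
    have "\<bar>\<phi> x - \<phi> z\<bar> < \<epsilon> i" if "\<phi> \<in> F" for \<phi>
    proof -
      have "of_int (v \<phi>) + \<rho> \<le> y i \<phi> x \<and> y i \<phi> x \<le> of_int (v \<phi>) + 1 - \<rho>"
          "of_int (v \<phi>) + \<rho> \<le> y i \<phi> z \<and> y i \<phi> z \<le> of_int (v \<phi>) + 1 - \<rho>"
        using xz that by (simp_all add: box_def)
      then have "\<bar>y i \<phi> x - y i \<phi> z\<bar> < 1"
        using \<rho> by linarith
      then have "\<bar>\<phi> x / t - \<phi> z / t\<bar> < 1"
        by (simp add: y_def)
      then have "\<bar>\<phi> x - \<phi> z\<bar> < t"
        using t(1) by (simp flip: diff_divide_distrib)
      with t(2)[OF i] show ?thesis
        by linarith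
    qed
    moreover have "x \<in> topspace K" "z \<in> topspace K"
      using xz Z_sub by (auto simp: box_def)
    ultimately show ?thesis
      using \<epsilon> i by auto
  qed
  \<comment> \<open>a cell is added to \<open>A i\<close> if it meets \<open>A i\<close>, and to \<open>B i\<close> otherwise\<close>
  define P where "P i = {v \<in> key i ` topspace K. box i v \<inter> A i \<noteq> {}}" for i
  define N where "N i = {v \<in> key i ` topspace K. box i v \<inter> A i = {}}" for i
  have good: "\<exists>i\<in>I. x \<in> box i (key i x)" if x: "x \<in> Z" for x
  proof -
    obtain i where i: "i \<in> I"
        "\<And>\<phi> k. \<phi> \<in> F \<Longrightarrow> 1 / (2 * real m) \<le> \<bar>\<phi> x / t - real (b i) / real m - of_int k\<bar>"
      by (rule far_from_shifted_lattice[OF F(1,2) b, where r = "\<lambda>\<phi>. \<phi> x / t"]) auto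
    have "of_int \<lfloor>y i \<phi> x\<rfloor> + \<rho> \<le> y i \<phi> x \<and> y i \<phi> x \<le> of_int \<lfloor>y i \<phi> x\<rfloor> + 1 - \<rho>" if "\<phi> \<in> F" for \<phi>
    proof -
      have far: "\<rho> \<le> \<bar>y i \<phi> x - of_int k\<bar>" for k
        using i(2)[OF that, of k] by (simp add: \<rho>_def y_def)
      show ?thesis
        using far[of "\<lfloor>y i \<phi> x\<rfloor>"] far[of "\<lfloor>y i \<phi> x\<rfloor> + 1"] of_int_floor_le[of "y i \<phi> x"]
          floor_correct[of "y i \<phi> x"]
        by (simp add: abs_if split: if_splits)
    qed
    then have "x \<in> box i (key i x)"
      using x Z_sub by (auto simp: box_def key_def)
    with i(1) show ?thesis ..
  qed
  have cover: "\<exists>i\<in>I. x \<in> (A i \<union> (\<Union>v\<in>P i. box i v)) \<union> (B i \<union> (\<Union>v\<in>N i. box i v))"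
    if x: "x \<in> Z" for x
  proof -
    obtain i where i: "i \<in> I" "x \<in> box i (key i x)"
      using good[OF x] by (elim bexE)
    have "key i x \<in> P i \<union> N i"
      using x Z_sub by (auto simp: P_def N_def)
    with i(2) have "x \<in> (\<Union>v\<in>P i. box i v) \<union> (\<Union>v\<in>N i. box i v)"
      by auto
    then show ?thesis
      by (intro bexI[OF _ i(1)]) auto
  qed
  show ?thesis
    unfolding inessential_def
  proof (rule exI[of _ "\<lambda>i. A i \<union> (\<Union>v\<in>P i. box i v)"],
      rule exI[of _ "\<lambda>i. B i \<union> (\<Union>v\<in>N i. box i v)"], intro conjI)
    show "Z \<subseteq> (\<Union>i\<in>I. (A i \<union> (\<Union>v\<in>P i. box i v)) \<union> (B i \<union> (\<Union>v\<in>N i. box i v)))"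
      using cover by auto
    show "disjoint_closed_pairs K I (\<lambda>i. A i \<union> (\<Union>v\<in>P i. box i v)) (\<lambda>i. B i \<union> (\<Union>v\<in>N i. box i v))"
      unfolding disjoint_closed_pairs_def
    proof (intro ballI conjI)
      fix i
      assume i: "i \<in> I"
      show "closedin K (A i \<union> (\<Union>v\<in>P i. box i v))" "closedin K (B i \<union> (\<Union>v\<in>N i. box i v))"
        using pairs i fin_key[of i] box_closed
        by (auto simp: disjoint_closed_pairs_def P_def N_def intro!: closedin_Un closedin_Union)
      have PB: "x \<notin> B i" if vx: "v \<in> P i" "x \<in> box i v" for v x
      proof
        assume "x \<in> B i"
        obtain a where a: "a \<in> box i v" "a \<in> A i"
          using vx(1) by (auto simp: P_def)
        then have "\<gamma> \<le> \<bar>f i a - f i x\<bar>"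
          using vx(2) \<open>x \<in> B i\<close> by (intro gap(2) i) (auto simp: box_def)
        with box_small[OF i a(1) vx(2)] show False
          by simp
      qed
      have PN: "x \<notin> box i w" if vw: "v \<in> P i" "w \<in> N i" "x \<in> box i v" for v w x
      proof
        assume "x \<in> box i w"
        then have "v = w"
          using vw box_key_eq[of x i v] box_key_eq[of x i w] by (simp add: P_def N_def)
        with vw(1,2) show False
          by (simp add: P_def N_def)
      qed
      have AN: "x \<notin> A i" if "w \<in> N i" "x \<in> box i w" for w x
        using that by (auto simp: N_def)
      have AB: "A i \<inter> B i = {}"
        using pairs i by (simp add: disjoint_closed_pairs_def)
      show "(A i \<union> (\<Union>v\<in>P i. box i v)) \<inter> (B i \<union> (\<Union>v\<in>N i. box i v)) = {}"
      proof (rule equals0I)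
        fix x
        assume "x \<in> (A i \<union> (\<Union>v\<in>P i. box i v)) \<inter> (B i \<union> (\<Union>v\<in>N i. box i v))"
        then have "x \<in> A i \<or> (\<exists>v\<in>P i. x \<in> box i v)" "x \<in> B i \<or> (\<exists>w\<in>N i. x \<in> box i w)"
          by simp_all
        then show False
          using AB PB PN AN by (elim disjE bexE) auto
      qed
    qed
  qed auto
qed

text \<open>
  Infinite dimension allows essential families of any size on a closed set where prescribed
  functions are almost constant, because finitely many such sets cover the space.
\<close>
lemma essential_family_on_small_oscillation:
  fixes I :: "nat set"
  assumes inf: "\<not> finite_dimensional K" and E: "finite E"
      "\<And>f. f \<in> E \<Longrightarrow> cont f \<and> (\<forall>x\<in>topspace K. 0 \<le> f x \<and> f x \<le> 1)"
    and "\<eta> > 0" and I: "finite I"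
  obtains (level) Z and e :: "nat \<Rightarrow> 'a \<Rightarrow> real" where "closedin K Z"
    and "\<And>i. cont (e i)" and "\<And>i x. x \<in> topspace K \<Longrightarrow> 0 \<le> e i x \<and> e i x \<le> 1"
    and "\<And>f x y. f \<in> E \<Longrightarrow> x \<in> Z \<Longrightarrow> y \<in> Z \<Longrightarrow> \<bar>f x - f y\<bar> \<le> \<eta>"
    and "\<not> inessential K Z I (\<lambda>i. {x \<in> topspace K. e i x = 0}) (\<lambda>i. {x \<in> topspace K. e i x = 1})"
proof -
  obtain p :: nat where p: "p > 0" "1 / real p \<le> \<eta>"
    using real_arch_inverse[of \<eta>] \<open>\<eta> > 0\<close> by (auto simp: inverse_eq_divide intro: less_imp_le)
  define box where "box v = {x \<in> topspace K. \<forall>f\<in>E. x \<in> {x \<in> topspace K. real (v f) / real p \<le> f x} \<inter>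
      {x \<in> topspace K. f x \<le> (real (v f) + 1) / real p}}" for v :: "('a \<Rightarrow> real) \<Rightarrow> nat"
  have box_closed: "closedin K (box v)" for v
    unfolding box_def using E(2)
    by (intro closedin_Collect_Ball E(1) closedin_topspace closedin_Int closedin_le_level
        closedin_ge_level) auto
  have box_small: "\<bar>f x - f y\<bar> \<le> \<eta>" if "f \<in> E" "x \<in> box v" "y \<in> box v" for f x y v
  proof -
    have "real (v f) / real p \<le> f x \<and> f x \<le> (real (v f) + 1) / real p"
        "real (v f) / real p \<le> f y \<and> f y \<le> (real (v f) + 1) / real p"
      using that by (auto simp: box_def)
    then show ?thesis
      using p by (simp add: add_divide_distrib abs_le_iff)
  qed
  have "finite (box ` PiE E (\<lambda>_. {0..p}))"
    using E(1) by (intro finite_imageI finite_PiE) auto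
  moreover have "topspace K \<subseteq> \<Union>(box ` PiE E (\<lambda>_. {0..p}))"
  proof
    fix x
    assume x: "x \<in> topspace K"
    let ?v = "\<lambda>f\<in>E. nat \<lfloor>f x * real p\<rfloor>"
    have v: "nat \<lfloor>f x * real p\<rfloor> \<le> p" "real (nat \<lfloor>f x * real p\<rfloor>) \<le> f x * real p"
        "f x * real p \<le> real (nat \<lfloor>f x * real p\<rfloor>) + 1" if "f \<in> E" for f
    proof -
      have f: "0 \<le> f x" "f x \<le> 1"
        using E(2)[OF that] x by auto
      have "f x * real p \<le> real p"
        using f by (simp add: mult_left_le_one_le)
      then show "nat \<lfloor>f x * real p\<rfloor> \<le> p"
        by linarith
      have "\<lfloor>f x * real p\<rfloor> \<ge> 0"
        using f by simp
      then have *: "real (nat \<lfloor>f x * real p\<rfloor>) = of_int \<lfloor>f x * real p\<rfloor>"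
        by simp
      show "real (nat \<lfloor>f x * real p\<rfloor>) \<le> f x * real p"
          "f x * real p \<le> real (nat \<lfloor>f x * real p\<rfloor>) + 1"
        unfolding * by linarith+
    qed
    have "?v \<in> PiE E (\<lambda>_. {0..p})"
      using v(1) by auto
    moreover have "x \<in> box ?v"
      using x v(2,3) p(1) by (simp add: box_def pos_divide_le_eq pos_le_divide_eq)
    ultimately show "x \<in> \<Union>(box ` PiE E (\<lambda>_. {0..p}))"
      by blast
  qed
  ultimately obtain Z A B where Z: "Z \<in> box ` PiE E (\<lambda>_. {0..p})"
      "disjoint_closed_pairs K I A B" "\<not> inessential K Z I A B"
    by (rule infinite_dimensional_piece[OF inf _ _ I])
  have "\<forall>i. \<exists>e. cont e \<and> (\<forall>x\<in>topspace K. 0 \<le> e x \<and> e x \<le> 1) \<and>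
      (i \<in> I \<longrightarrow> (\<forall>x\<in>A i. e x = 0) \<and> (\<forall>x\<in>B i. e x = 1))"
  proof
    fix i
    show "\<exists>e. cont e \<and> (\<forall>x\<in>topspace K. 0 \<le> e x \<and> e x \<le> 1) \<and>
        (i \<in> I \<longrightarrow> (\<forall>x\<in>A i. e x = 0) \<and> (\<forall>x\<in>B i. e x = 1))"
    proof (cases "i \<in> I")
      case True
      then have "closedin K (A i)" "closedin K (B i)" "A i \<inter> B i = {}"
        using Z(2) by (auto simp: disjoint_closed_pairs_def)
      then obtain e where "cont e" "\<And>x. x \<in> topspace K \<Longrightarrow> 0 \<le> e x \<and> e x \<le> 1"
          "\<And>x. x \<in> A i \<Longrightarrow> e x = 0" "\<And>x. x \<in> B i \<Longrightarrow> e x = 1"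
        by (rule Urysohn_01) auto
      then show ?thesis
        by (intro exI[of _ e]) auto
    next
      case False
      then show ?thesis
        by (intro exI[of _ "\<lambda>_. 0"]) auto
    qed
  qed
  from choice[OF this] obtain e where e: "\<forall>i. cont (e i) \<and> (\<forall>x\<in>topspace K. 0 \<le> e i x \<and> e i x \<le> 1) \<and>
      (i \<in> I \<longrightarrow> (\<forall>x\<in>A i. e i x = 0) \<and> (\<forall>x\<in>B i. e i x = 1))"
    by (elim exE)
  have sub: "A i \<subseteq> {x \<in> topspace K. e i x = 0} \<and> B i \<subseteq> {x \<in> topspace K. e i x = 1}" if "i \<in> I" for i
  proof -
    have "A i \<subseteq> topspace K" "B i \<subseteq> topspace K"
      using Z(2) that by (auto simp: disjoint_closed_pairs_def dest: closedin_subset)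
    then show ?thesis
      using e that by auto
  qed
  show thesis
  proof (rule level[of Z e])
    show "closedin K Z"
      using Z(1) box_closed by auto
    show "\<bar>f x - f y\<bar> \<le> \<eta>" if "f \<in> E" "x \<in> Z" "y \<in> Z" for f x y
      using Z(1) that box_small by auto
    show "\<not> inessential K Z I (\<lambda>i. {x \<in> topspace K. e i x = 0}) (\<lambda>i. {x \<in> topspace K. e i x = 1})"
    proof
      assume "inessential K Z I (\<lambda>i. {x \<in> topspace K. e i x = 0}) (\<lambda>i. {x \<in> topspace K. e i x = 1})"
      then have "inessential K Z I A B"
        using sub by (rule inessential_antimono)
      with Z(3) show False ..
    qed
  qed (use e in auto)
qed

end

lemma finite_nat_sets_separated:
  fixes \<A> :: "nat set set"
  assumes "finite \<A>"
  obtains n where "inj_on (\<lambda>\<alpha>. \<alpha> \<inter> {..<n}) \<A>"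
proof -
  have "\<exists>k. \<alpha> \<noteq> \<beta> \<longrightarrow> (k \<in> \<alpha>) \<noteq> (k \<in> \<beta>)" for \<alpha> \<beta> :: "nat set"
    by (metis subsetI subset_antisym)
  then obtain d where d: "\<And>\<alpha> \<beta> :: nat set. \<alpha> \<noteq> \<beta> \<Longrightarrow> (d \<alpha> \<beta> \<in> \<alpha>) \<noteq> (d \<alpha> \<beta> \<in> \<beta>)"
    by metis
  define n where "n = Suc (Max ((\<lambda>(\<alpha>, \<beta>). d \<alpha> \<beta>) ` (\<A> \<times> \<A>)))"
  have "inj_on (\<lambda>\<alpha>. \<alpha> \<inter> {..<n}) \<A>"
  proof (rule inj_onI, rule ccontr)
    fix \<alpha> \<beta>
    assume *: "\<alpha> \<in> \<A>" "\<beta> \<in> \<A>" "\<alpha> \<inter> {..<n} = \<beta> \<inter> {..<n}" "\<alpha> \<noteq> \<beta>"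
    have "d \<alpha> \<beta> \<le> Max ((\<lambda>(\<alpha>, \<beta>). d \<alpha> \<beta>) ` (\<A> \<times> \<A>))"
      using assms * by (intro Max_ge) auto
    then have "d \<alpha> \<beta> \<in> {..<n}"
      by (simp add: n_def)
    with d[OF *(4)] *(3) show False
      by blast
  qed
  then show thesis
    by (rule that)
qed

context compact_Hausdorff
begin

text \<open>
  The branch \<open>\<alpha>\<close> of the binary tree gets the function \<open>f \<alpha> = (\<Sum>n. 10^-n * e n (\<alpha> \<inter> {..<n}))\<close>, where
  the functions \<open>e n s\<close>, one for each node \<open>s\<close> of level \<open>n\<close>, separate an essential family of \<open>2^n\<close>
  pairs on a closed set where all functions of lower levels are almost constant.  On that set \<open>f \<alpha>\<close>
  separates the pair of the node below \<open>\<alpha>\<close>.  If \<open>F\<close> controls \<open>f \<alpha>\<close> for more than \<open>card F\<close> branches, look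
  at a level where these are distinct: their pairs would be inessential.
\<close>
lemma many_uncontrolled_functions:
  assumes inf: "\<not> finite_dimensional K"
  obtains f :: "nat set \<Rightarrow> 'a \<Rightarrow> real" where "\<And>\<alpha>. cont (f \<alpha>)"
    and "\<And>F. finite F \<Longrightarrow> (\<And>\<phi>. \<phi> \<in> F \<Longrightarrow> cont \<phi>) \<Longrightarrow> finite {\<alpha>. controls K F (f \<alpha>)}"
proof -
  define code where "code n \<alpha> = set_encode (\<alpha> \<inter> {..<n})" for n and \<alpha> :: "nat set"
  have fin_code: "finite (range (code n))" for n
  proof -
    have "range (code n) \<subseteq> set_encode ` Pow {..<n}"
      by (auto simp: code_def)
    then show ?thesis
      by (rule finite_subset) simp
  qed
  \<comment> \<open>The state \<open>(E, Z, e)\<close> of level \<open>n\<close> consists of the functions of the lower levels, a set where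
    they are almost constant, and the functions of the level.  The bound \<open>10^-n / 20\<close> keeps the lower
    levels together from closing the gap of size \<open>10^-n\<close> that level \<open>n\<close> opens.\<close>
  define unit where "unit f \<longleftrightarrow> cont f \<and> (\<forall>x\<in>topspace K. 0 \<le> f x \<and> f x \<le> 1)" for f
  define P where "P n s \<longleftrightarrow> (case s of (E, Z, e :: nat \<Rightarrow> 'a \<Rightarrow> real) \<Rightarrow>
      finite E \<and> (\<forall>f\<in>E. unit f) \<and> closedin K Z \<and> (\<forall>i. unit (e i)) \<and>
      (\<forall>f\<in>E. \<forall>x\<in>Z. \<forall>y\<in>Z. \<bar>f x - f y\<bar> \<le> 1 / 20 * (1 / 10) ^ n) \<and>
      \<not> inessential K Z (range (code n)) (\<lambda>i. {x \<in> topspace K. e i x = 0})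
          (\<lambda>i. {x \<in> topspace K. e i x = 1}))" for n s
  define Q where "Q n s s' \<longleftrightarrow> (case s of (E, Z, e) \<Rightarrow> fst s' = E \<union> e ` range (code n))"
    for n and s s' :: "('a \<Rightarrow> real) set \<times> 'a set \<times> (nat \<Rightarrow> 'a \<Rightarrow> real)"
  have ex: "\<exists>Z e. P n (E, Z, e)" if E: "finite E" "\<forall>f\<in>E. unit f" for E n
  proof -
    have unit_E: "cont f \<and> (\<forall>x\<in>topspace K. 0 \<le> f x \<and> f x \<le> 1)" if "f \<in> E" for f
      using E(2) that by (simp add: unit_def)
    have pos: "(1 / 20 * (1 / 10) ^ n :: real) > 0"
      by simp
    obtain Z e where "closedin K Z"
      "\<And>i. cont (e i)" "\<And>i x. x \<in> topspace K \<Longrightarrow> 0 \<le> e i x \<and> e i x \<le> 1"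
      "\<And>f x y. f \<in> E \<Longrightarrow> x \<in> Z \<Longrightarrow> y \<in> Z \<Longrightarrow> \<bar>f x - f y\<bar> \<le> 1 / 20 * (1 / 10) ^ n"
      "\<not> inessential K Z (range (code n)) (\<lambda>i. {x \<in> topspace K. e i x = 0}) (\<lambda>i. {x \<in> topspace K. e i x = 1})"
      by (rule essential_family_on_small_oscillation[OF inf E(1) unit_E pos fin_code]) auto
    then have "P n (E, Z, e)"
      using E by (simp add: P_def unit_def)
    then show ?thesis
      by blast
  qed
  have "\<exists>s. \<forall>n. P n (s n) \<and> Q n (s n) (s (Suc n))"
  proof (rule dependent_nat_choice)
    show "\<exists>s. P 0 s"
      using ex[of "{}" 0] by auto
  next
    fix s n
    assume Ps: "P n s"
    obtain E Z e where s: "s = (E, Z, e)"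
      by (cases s)
    have "finite (E \<union> e ` range (code n))" "\<forall>f\<in>E \<union> e ` range (code n). unit f"
      using Ps fin_code unfolding s P_def by auto
    from ex[OF this, of "Suc n"] obtain Z' e' where "P (Suc n) (E \<union> e ` range (code n), Z', e')"
      by (elim exE)
    moreover have "Q n s (E \<union> e ` range (code n), Z', e')"
      by (simp add: s Q_def)
    ultimately show "\<exists>s'. P (Suc n) s' \<and> Q n s s'"
      by (intro exI conjI)
  qed
  then obtain s where s: "\<And>n. P n (s n)" "\<And>n. Q n (s n) (s (Suc n))"
    by (elim exE) auto
  define E Z e where "E n = fst (s n)" and "Z n = fst (snd (s n))" and "e n = snd (snd (s n))" for n
  have s_eq: "s n = (E n, Z n, e n)" for n
    by (simp add: E_def Z_def e_def)
  have P: "P n (E n, Z n, e n)" and E_Suc: "E (Suc n) = E n \<union> e n ` range (code n)" for n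
    using s(1)[of n] s(2)[of n] by (simp_all add: Q_def flip: s_eq) (simp add: s_eq)
  have unit: "unit (e n i)" for n i
    using P[of n] by (simp add: P_def)
  have earlier: "e k (code k \<alpha>) \<in> E n" if "k < n" for k n \<alpha>
    using that
  proof (induction n)
    case (Suc n)
    then show ?case
      by (cases "k = n") (auto simp: E_Suc)
  qed simp
  have small: "\<bar>e k (code k \<alpha>) x - e k (code k \<alpha>) y\<bar> \<le> 1 / 20 * (1 / 10) ^ n"
    if "k < n" "x \<in> Z n" "y \<in> Z n" for k n \<alpha> x y
    using P[of n] earlier[OF that(1), of \<alpha>] that(2,3) by (simp add: P_def)
  define f where "f \<alpha> x = (\<Sum>k. (1 / 10) ^ k * e k (code k \<alpha>) x)" for \<alpha> x
  have separated: "1 / 2 * (1 / 10) ^ n \<le> \<bar>f \<alpha> x - f \<alpha> y\<bar>"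
    if xy: "x \<in> Z n" "y \<in> Z n" and x: "e n (code n \<alpha>) x = 0" and y: "e n (code n \<alpha>) y = 1"
    for n \<alpha> x y
  proof -
    let ?u = "\<lambda>x k. e k (code k \<alpha>) x"
    have "Z n \<subseteq> topspace K"
      using P[of n] by (auto simp: P_def dest: closedin_subset)
    then have range: "\<And>k. 0 \<le> ?u x k \<and> ?u x k \<le> 1" "\<And>k. 0 \<le> ?u y k \<and> ?u y k \<le> 1"
      using unit xy by (auto simp: unit_def)
    have "f \<alpha> x \<le> (\<Sum>k<Suc n. (1 / 10) ^ k * ?u x k) + (1 / 10) ^ Suc n / (1 - 1 / 10)"
      unfolding f_def by (rule geometric_series_tail(2)[OF _ _ range(1)]) auto
    then have "f \<alpha> x \<le> (\<Sum>k<n. (1 / 10) ^ k * ?u x k) + (1 / 10) ^ n / 9"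
      using x by simp
    moreover have "(\<Sum>k<Suc n. (1 / 10) ^ k * ?u y k) \<le> f \<alpha> y"
      unfolding f_def by (rule geometric_series_tail(1)[OF _ _ range(2)]) auto
    then have "(\<Sum>k<n. (1 / 10) ^ k * ?u y k) + (1 / 10) ^ n \<le> f \<alpha> y"
      using y by simp
    moreover have "(\<Sum>k<n. (1 / 10) ^ k * ?u x k) \<le>
        (\<Sum>k<n. (1 / 10) ^ k * ?u y k) + (\<Sum>k<n. (1 / 10) ^ k * (1 / 20 * (1 / 10) ^ n))"
    proof -
      have "(1 / 10) ^ k * ?u x k \<le> (1 / 10) ^ k * ?u y k + (1 / 10) ^ k * (1 / 20 * (1 / 10) ^ n)"
        if "k < n" for k
      proof -
        have "?u x k \<le> ?u y k + 1 / 20 * (1 / 10) ^ n"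
          using small[OF that xy, of \<alpha>] by linarith
        then have "(1 / 10) ^ k * ?u x k \<le> (1 / 10) ^ k * (?u y k + 1 / 20 * (1 / 10) ^ n)"
          by (intro mult_left_mono) auto
        then show ?thesis
          by (simp add: distrib_left)
      qed
      then show ?thesis
        unfolding sum.distrib[symmetric] by (intro sum_mono) simp
    qed
    moreover have "(\<Sum>k<n. (1 / 10) ^ k * (1 / 20 * (1 / 10) ^ n :: real)) \<le> 1 / 18 * (1 / 10) ^ n"
    proof -
      have "(\<Sum>k<n. (1 / 10) ^ k :: real) \<le> 10 / 9"
        by (subst sum_gp_strict) auto
      then have "(\<Sum>k<n. (1 / 10) ^ k :: real) * (1 / 20 * (1 / 10) ^ n) \<le> 10 / 9 * (1 / 20 * (1 / 10) ^ n)"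
        by (intro mult_right_mono) auto
      also have "\<dots> = 1 / 18 * (1 / 10) ^ n"
        by simp
      finally show ?thesis
        unfolding sum_distrib_right .
    qed
    moreover have "(1 / 10 :: real) ^ n > 0"
      by simp
    ultimately have "1 / 2 * (1 / 10) ^ n \<le> f \<alpha> y - f \<alpha> x"
      by linarith
    then show ?thesis
      by linarith
  qed
  have few: "card \<A> \<le> card F"
    if F: "finite F" "\<And>\<phi>. \<phi> \<in> F \<Longrightarrow> cont \<phi>" and \<A>: "finite \<A>" "\<A> \<subseteq> {\<alpha>. controls K F (f \<alpha>)}" for F \<A>
  proof (rule ccontr)
    assume "\<not> card \<A> \<le> card F"
    then have less: "card F < card \<A>"
      by simp
    obtain n where n: "inj_on (\<lambda>\<alpha>. \<alpha> \<inter> {..<n}) \<A>"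
      by (rule finite_nat_sets_separated[OF \<A>(1)])
    have inj: "inj_on (code n) \<A>"
    proof (rule inj_onI)
      fix \<alpha> \<beta>
      assume *: "\<alpha> \<in> \<A>" "\<beta> \<in> \<A>" "code n \<alpha> = code n \<beta>"
      then have "\<alpha> \<inter> {..<n} = \<beta> \<inter> {..<n}"
        using inj_onD[OF inj_on_set_encode, of "\<alpha> \<inter> {..<n}" "\<beta> \<inter> {..<n}"] by (simp add: code_def)
      with * n show "\<alpha> = \<beta>"
        by (meson inj_onD)
    qed
    let ?A = "\<lambda>i. {x \<in> topspace K. e n i x = 0}" and ?B = "\<lambda>i. {x \<in> topspace K. e n i x = 1}"
    have pairs: "disjoint_closed_pairs K I ?A ?B" for I
      using unit by (auto simp: disjoint_closed_pairs_def unit_def closedin_eq_level)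
    have "inessential K (Z n) \<A> (\<lambda>\<alpha>. ?A (code n \<alpha>)) (\<lambda>\<alpha>. ?B (code n \<alpha>))"
    proof (rule inessential_if_controlled[OF F(1) less F(2) \<A>(1), where f = f])
      show "closedin K (Z n)"
        using P[of n] by (simp add: P_def)
      show "disjoint_closed_pairs K \<A> (\<lambda>\<alpha>. ?A (code n \<alpha>)) (\<lambda>\<alpha>. ?B (code n \<alpha>))"
        using pairs[of UNIV] by (simp add: disjoint_closed_pairs_def)
      show "1 / 2 * (1 / 10) ^ n \<le> \<bar>f \<alpha> x - f \<alpha> y\<bar>"
        if "x \<in> ?A (code n \<alpha>) \<inter> Z n" "y \<in> ?B (code n \<alpha>) \<inter> Z n" for \<alpha> x y
        using that by (intro separated) auto
    qed (use \<A>(2) in auto)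
    then have "inessential K (Z n) (code n ` \<A>) ?A ?B"
      using inj by (rule inessential_reindex)
    then have "inessential K (Z n) (range (code n)) ?A ?B"
      by (rule inessential_mono[OF _ _ pairs]) auto
    then show False
      using P[of n] by (simp add: P_def)
  qed
  show thesis
  proof (rule that[of f])
    show "cont (f \<alpha>)" for \<alpha>
      unfolding f_def using unit
      by (intro continuous_map_geometric_series) (auto simp: unit_def)
    show "finite {\<alpha>. controls K F (f \<alpha>)}" if F: "finite F" "\<And>\<phi>. \<phi> \<in> F \<Longrightarrow> cont \<phi>" for F
    proof (rule ccontr)
      assume "infinite {\<alpha>. controls K F (f \<alpha>)}"
      then obtain \<A> where "finite \<A>" "card \<A> = Suc (card F)" "\<A> \<subseteq> {\<alpha>. controls K F (f \<alpha>)}"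
        using infinite_arbitrarily_large by blast
      with few[OF F] show False
        by fastforce
    qed
  qed
qed

text \<open>
  The finite subsets of a basic family cover the continuum by finite sets.
\<close>
lemma continuum_ordLeq_basic_family:
  assumes \<Phi>: "basic_family K \<Phi>" and inf: "\<not> finite_dimensional K"
  shows "infinite \<Phi>" and "|UNIV :: nat set set| \<le>o |\<Phi>|"
proof -
  obtain f :: "nat set \<Rightarrow> 'a \<Rightarrow> real" where f: "\<And>\<alpha>. cont (f \<alpha>)"
      "\<And>F. finite F \<Longrightarrow> (\<And>\<phi>. \<phi> \<in> F \<Longrightarrow> cont \<phi>) \<Longrightarrow> finite {\<alpha>. controls K F (f \<alpha>)}"
    by (rule many_uncontrolled_functions[OF inf]) auto
  let ?C = "\<lambda>F. {\<alpha>. controls K F (f \<alpha>)}"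
  have union: "UNIV = (\<Union>F\<in>Fpow \<Phi>. ?C F)"
  proof -
    have "\<alpha> \<in> (\<Union>F\<in>Fpow \<Phi>. ?C F)" for \<alpha>
    proof -
      obtain F where "finite F" "F \<subseteq> \<Phi>" "controls K F (f \<alpha>)"
        by (rule basic_family_controls[OF \<Phi> f(1)])
      then show ?thesis
        by (auto simp: Fpow_def)
    qed
    then show ?thesis
      by auto
  qed
  have fin: "finite (?C F)" if "F \<in> Fpow \<Phi>" for F
    using that \<Phi> by (intro f(2)) (auto simp: Fpow_def basic_family_def cont_funs_def)
  show "infinite \<Phi>"
  proof
    assume "finite \<Phi>"
    then have "finite (\<Union>F\<in>Fpow \<Phi>. ?C F)"
      using fin by (auto simp: Fpow_Pow_finite)
    then have "finite (UNIV :: nat set set)"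
      using union by simp
    then show False
      by (simp add: Finite_Set.finite_set)
  qed
  then have "|\<Union>F\<in>Fpow \<Phi>. ?C F| \<le>o |\<Phi>|"
    using fin by (intro card_of_UNION_ordLeq_infinite card_of_Fpow_ordLeq)
      (auto intro: countable_ordLeq_infinite countable_finite)
  then show "|UNIV :: nat set set| \<le>o |\<Phi>|"
    using union by simp
qed

end

section \<open>Isolated values of finitely many functions\<close>

text \<open>
  For finite \<open>F\<close> these are the points of \<open>D\<close> whose image under \<open>F\<close>, as a map to a Euclidean
  space, is isolated in the image of \<open>D\<close> and is the image of no other point of \<open>D\<close>.
\<close>
definition isolated_by :: "'a set \<Rightarrow> ('a \<Rightarrow> real) set \<Rightarrow> 'a set" where
  "isolated_by D F = {d \<in> D. \<exists>\<epsilon>>0. \<forall>d'\<in>D. d' \<noteq> d \<longrightarrow> (\<exists>\<phi>\<in>F. \<epsilon> \<le> \<bar>\<phi> d - \<phi> d'\<bar>)}"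

text \<open>
  This is the countability of the set of isolated points of a subset of a Euclidean space: the points
  at distance at least \<open>1 / n\<close> from all others in the maximum norm lie in different
  cells of the cubical grid of size \<open>1 / n\<close>.
\<close>
lemma countable_isolated_by:
  assumes "finite F"
  shows "countable (isolated_by D F)"
proof -
  define T where "T n = {d \<in> D. \<forall>d'\<in>D. d' \<noteq> d \<longrightarrow> (\<exists>\<phi>\<in>F. 1 / real (Suc n) \<le> \<bar>\<phi> d - \<phi> d'\<bar>)}" for n
  have "countable (T n)" for n
  proof -
    let ?key = "\<lambda>d. \<lambda>\<phi>\<in>F. \<lfloor>\<phi> d * real (Suc n)\<rfloor>"
    have "inj_on ?key (T n)"
    proof (rule inj_onI, rule ccontr)
      fix d d'
      assume d: "d \<in> T n" "d' \<in> T n" "?key d = ?key d'" "d \<noteq> d'"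
      then have "\<exists>\<phi>\<in>F. 1 / real (Suc n) \<le> \<bar>\<phi> d - \<phi> d'\<bar>"
        unfolding T_def by auto
      then obtain \<phi> where \<phi>: "\<phi> \<in> F" "1 / real (Suc n) \<le> \<bar>\<phi> d - \<phi> d'\<bar>"
        by (elim bexE)
      have "\<lfloor>\<phi> d * real (Suc n)\<rfloor> = \<lfloor>\<phi> d' * real (Suc n)\<rfloor>"
        using fun_cong[OF d(3), of \<phi>] \<phi>(1) by (simp only: restrict_apply if_True)
      then have "\<bar>\<phi> d * real (Suc n) - \<phi> d' * real (Suc n)\<bar> < 1"
        by linarith
      also have "\<phi> d * real (Suc n) - \<phi> d' * real (Suc n) = (\<phi> d - \<phi> d') * real (Suc n)"
        by (rule left_diff_distrib[symmetric])
      finally have "\<bar>\<phi> d - \<phi> d'\<bar> * real (Suc n) < 1"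
        by (simp only: abs_mult abs_of_nat)
      moreover have "1 \<le> \<bar>\<phi> d - \<phi> d'\<bar> * real (Suc n)"
        using \<phi>(2) by (subst (asm) pos_divide_le_eq) auto
      ultimately show False
        by linarith
    qed
    moreover have "countable (?key ` T n)"
    proof (rule countable_subset)
      show "?key ` T n \<subseteq> PiE F (\<lambda>_. UNIV :: int set)"
        by auto
      show "countable (PiE F (\<lambda>_. UNIV :: int set))"
        using assms by (intro countable_PiE) auto
    qed
    ultimately show ?thesis
      by (intro countable_image_inj_on[of ?key "T n"])
  qed
  moreover have "isolated_by D F \<subseteq> (\<Union>n. T n)"
  proof
    fix d
    assume "d \<in> isolated_by D F"
    then obtain \<epsilon> where \<epsilon>: "d \<in> D" "\<epsilon> > 0" "\<forall>d'\<in>D. d' \<noteq> d \<longrightarrow> (\<exists>\<phi>\<in>F. \<epsilon> \<le> \<bar>\<phi> d - \<phi> d'\<bar>)"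
      unfolding isolated_by_def by auto
    obtain n where "inverse (real (Suc n)) < \<epsilon>"
      using reals_Archimedean[OF \<epsilon>(2)] by (elim exE)
    then have n: "1 / real (Suc n) \<le> \<epsilon>"
      by (simp add: inverse_eq_divide)
    have "\<exists>\<phi>\<in>F. 1 / real (Suc n) \<le> \<bar>\<phi> d - \<phi> d'\<bar>" if d': "d' \<in> D" "d' \<noteq> d" for d'
    proof -
      obtain \<phi> where "\<phi> \<in> F" "\<epsilon> \<le> \<bar>\<phi> d - \<phi> d'\<bar>"
        using \<epsilon>(3) d' by auto
      with n show ?thesis
        by (intro bexI[of _ \<phi>]) auto
    qed
    then have "d \<in> T n"
      using \<epsilon>(1) unfolding T_def by auto
    then show "d \<in> (\<Union>n. T n)"
      by auto
  qed
  ultimately show ?thesis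
    using countable_subset[of "isolated_by D F" "\<Union>n. T n"] by simp
qed

lemma discrete_subset_neighbourhood:
  assumes "subtopology X D = discrete_topology D" and "d \<in> D"
  obtains U where "openin X U" and "U \<inter> D = {d}"
proof -
  have "openin (subtopology X D) {d}"
    using assms by simp
  then obtain U where "openin X U" "{d} = U \<inter> D"
    unfolding openin_subtopology by (elim exE conjE)
  then show thesis
    by (intro that[of U]) auto
qed

context compact_Hausdorff
begin

text \<open>
  A continuous function equal to \<open>2^-k\<close> at \<open>s k\<close> and to \<open>0\<close> elsewhere on \<open>D\<close> keeps each \<open>s k\<close> at a
  distance from the rest of \<open>D\<close>, and so do the functions controlling it.
\<close>
lemma countable_subset_isolated:
  assumes \<Phi>: "basic_family K \<Phi>" and D: "D \<subseteq> topspace K" "subtopology K D = discrete_topology D"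
    and S: "S \<subseteq> D" "countable S" "infinite S"
  obtains F where "F \<in> Fpow \<Phi>" and "S \<subseteq> isolated_by D F"
proof -
  define s where "s = from_nat_into S"
  have s: "bij_betw s UNIV S"
    unfolding s_def by (rule bij_betw_from_nat_into[OF S(2,3)])
  have inj: "s j = s k \<longleftrightarrow> j = k" and sS: "s k \<in> S" and sD: "s k \<in> D" for j k
    using s S(1) by (auto simp: bij_betw_def inj_on_def)
  have "\<exists>u. cont u \<and> (\<forall>x\<in>topspace K. 0 \<le> u x \<and> u x \<le> 1) \<and> u (s k) = 1 \<and> (\<forall>d\<in>D - {s k}. u d = 0)" for k
  proof -
    obtain U where U: "openin K U" "U \<inter> D = {s k}"
      by (rule discrete_subset_neighbourhood[OF D(2) sD])
    have "closedin K {s k}"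
      using Hausdorff D(1) sD by (simp add: closedin_Hausdorff_sing_eq subsetD)
    moreover have "closedin K (topspace K - U)" "(topspace K - U) \<inter> {s k} = {}"
      using U by auto
    ultimately obtain u where u: "cont u" "\<And>x. x \<in> topspace K \<Longrightarrow> 0 \<le> u x \<and> u x \<le> 1"
        "\<And>x. x \<in> topspace K - U \<Longrightarrow> u x = 0" "\<And>x. x \<in> {s k} \<Longrightarrow> u x = 1"
      using Urysohn_01[of "topspace K - U" "{s k}"] by metis
    have "u d = 0" if "d \<in> D - {s k}" for d
      using that U(2) D(1) by (intro u(3)) auto
    with u show ?thesis
      by (intro exI[of _ u]) auto
  qed
  then have "\<forall>k. \<exists>u. cont u \<and> (\<forall>x\<in>topspace K. 0 \<le> u x \<and> u x \<le> 1) \<and> u (s k) = 1 \<and> (\<forall>d\<in>D - {s k}. u d = 0)"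
    by simp
  from choice[OF this] obtain u where u: "\<And>k. cont (u k)" "\<And>k x. x \<in> topspace K \<Longrightarrow> 0 \<le> u k x \<and> u k x \<le> 1"
      "\<And>k. u k (s k) = 1" "\<And>k d. d \<in> D \<Longrightarrow> d \<noteq> s k \<Longrightarrow> u k d = 0"
    by (elim exE) auto
  define f where "f x = (\<Sum>k. (1 / 2) ^ k * u k x)" for x
  have f_cont: "cont f"
    unfolding f_def using u(1,2) by (intro continuous_map_geometric_series) auto
  have f_s: "f (s k) = (1 / 2) ^ k" for k
  proof -
    have "f (s k) = (\<Sum>j\<in>{k}. (1 / 2) ^ j * u j (s k))"
      unfolding f_def using u(4)[OF sD] inj by (intro suminf_finite) auto
    then show ?thesis
      by (simp add: u(3))
  qed
  have f_0: "f d = 0" if "d \<in> D" "d \<notin> S" for d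
  proof -
    have "u k d = 0" for k
      using that sS by (intro u(4)) auto
    then show ?thesis
      by (simp add: f_def)
  qed
  have gap: "(1 / 2) ^ Suc k \<le> \<bar>f (s k) - f d\<bar>" if d: "d \<in> D" "d \<noteq> s k" for k d
  proof (cases "d \<in> S")
    case True
    then obtain j where j: "d = s j"
      using s by (auto simp: bij_betw_def)
    then have "j < k \<or> k < j"
      using d(2) by (metis nat_neq_iff)
    then show ?thesis
    proof
      assume "j < k"
      then have "(1 / 2 :: real) ^ k \<le> (1 / 2) ^ Suc j"
        by (intro power_decreasing) auto
      moreover have "(1 / 2 :: real) ^ k > 0"
        by simp
      ultimately show ?thesis
        unfolding j f_s power_Suc by linarith
    next
      assume "k < j"
      then have "(1 / 2 :: real) ^ j \<le> (1 / 2) ^ Suc k"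
        by (intro power_decreasing) auto
      then show ?thesis
        unfolding j f_s power_Suc by linarith
    qed
  next
    case False
    then show ?thesis
      using d by (simp add: f_s f_0)
  qed
  obtain F where F: "finite F" "F \<subseteq> \<Phi>" "controls K F f"
    by (rule basic_family_controls[OF \<Phi> f_cont])
  have "s k \<in> isolated_by D F" for k
  proof -
    have "(1 / 2 :: real) ^ Suc k > 0"
      by simp
    then obtain \<epsilon> where \<epsilon>: "\<epsilon> > 0" "\<forall>x\<in>topspace K. \<forall>y\<in>topspace K.
        (\<forall>\<phi>\<in>F. \<bar>\<phi> x - \<phi> y\<bar> < \<epsilon>) \<longrightarrow> \<bar>f x - f y\<bar> < (1 / 2) ^ Suc k"
      using F(3) unfolding controls_def by blast
    have "\<exists>\<phi>\<in>F. \<epsilon> \<le> \<bar>\<phi> (s k) - \<phi> d\<bar>" if d: "d \<in> D" "d \<noteq> s k" for d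
    proof (rule ccontr)
      assume "\<not> ?thesis"
      then have "\<forall>\<phi>\<in>F. \<bar>\<phi> (s k) - \<phi> d\<bar> < \<epsilon>"
        by (simp add: not_le)
      then have "\<bar>f (s k) - f d\<bar> < (1 / 2) ^ Suc k"
        using \<epsilon>(2) D(1) sD[of k] d(1) by (simp add: subset_iff)
      with gap[OF d] show False
        by linarith
    qed
    then show ?thesis
      using \<epsilon>(1) sD by (auto simp: isolated_by_def)
  qed
  moreover have "S = range s"
    using s by (simp add: bij_betw_def)
  ultimately have "S \<subseteq> isolated_by D F"
    by auto
  then show thesis
    using F that by (auto simp: Fpow_def)
qed

end

section \<open>Cardinal lower bounds for basic families\<close>

text \<open>
  Finitely many countable sets miss some point of an uncountable set.
\<close>
lemma uncountable_cofinal_infinite: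
  assumes "uncountable (Field \<kappa>)" and G: "G \<subseteq> ctbl_inf_subsets \<kappa>"
    and cofinal: "\<forall>S\<in>ctbl_inf_subsets \<kappa>. \<exists>T\<in>G. S \<subseteq> T"
  shows "infinite G"
proof
  assume "finite G"
  then have "countable (\<Union>T\<in>G. T)"
    using G by (intro countable_UN) (auto simp: ctbl_inf_subsets_def intro: countable_finite)
  then have "countable (\<Union>G)"
    by simp
  then obtain x where x: "x \<in> Field \<kappa>" "x \<notin> \<Union>G"
    using assms(1) by (meson countable_subset subsetI)
  have "infinite (Field \<kappa>)"
    using assms(1) countable_finite by auto
  then obtain S where S: "S \<subseteq> Field \<kappa>" "countable S" "infinite S"
    using infinite_countable_subset' by blast
  then have "insert x S \<in> ctbl_inf_subsets \<kappa>"
    using x(1) by (simp add: ctbl_inf_subsets_def)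
  then obtain T where "T \<in> G" "insert x S \<subseteq> T"
    using cofinal by (meson bspec)
  with x(2) show False
    by auto
qed

lemma nat_functions_ordLeq_continuum:
  "|UNIV :: (nat \<Rightarrow> nat) set| \<le>o |UNIV :: nat set set|"
proof -
  have "inj (\<lambda>f :: nat \<Rightarrow> nat. range (\<lambda>n. prod_encode (n, f n)))"
  proof (rule injI, rule ext)
    fix f g :: "nat \<Rightarrow> nat" and n
    assume "range (\<lambda>n. prod_encode (n, f n)) = range (\<lambda>n. prod_encode (n, g n))"
    then have "prod_encode (n, f n) \<in> range (\<lambda>n. prod_encode (n, g n))"
      by auto
    then show "f n = g n"
      by auto
  qed
  then show ?thesis
    by (intro card_of_ordLeq[THEN iffD1] exI conjI) auto
qed

context compact_Hausdorff
begin

text \<open>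
  The sets \<open>isolated_by D F\<close> with finite \<open>F \<subseteq> \<Phi>\<close>, carried over to \<open>\<kappa>\<close>, are cofinal.  An infinite
  set \<open>S0\<close> is added to them because they may be finite.
\<close>
lemma cof_subset_ordLeq_basic_family:
  assumes \<Phi>: "basic_family K \<Phi>" and D: "D \<subseteq> topspace K" "subtopology K D = discrete_topology D"
    and b: "bij_betw b D (Field \<kappa>)" and unc: "uncountable (Field \<kappa>)"
  shows "cof_subset (ctbl_inf_subsets \<kappa>) \<le>o |\<Phi>|"
proof -
  have "infinite D"
    using b unc by (meson bij_betw_finite countable_finite)
  then obtain S0 where S0: "S0 \<subseteq> D" "countable S0" "infinite S0"
    using infinite_countable_subset' by blast
  define T where "T F = b ` (isolated_by D F \<union> S0)" for F
  have inj: "inj_on b D" and range: "b ` D = Field \<kappa>"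
    using b by (auto simp: bij_betw_def)
  have sub: "T ` Fpow \<Phi> \<subseteq> ctbl_inf_subsets \<kappa>"
  proof
    fix S
    assume "S \<in> T ` Fpow \<Phi>"
    then obtain F where F: "finite F" "S = T F"
      by (auto simp: Fpow_def)
    have "infinite (b ` S0)"
      using S0 inj by (metis finite_imageD inj_on_subset)
    then have "infinite S"
      by (simp add: F T_def image_Un)
    moreover have "countable S"
      using F S0(2) countable_isolated_by[OF F(1)] by (simp add: T_def)
    moreover have "S \<subseteq> Field \<kappa>"
      unfolding F T_def range[symmetric] using S0(1) by (intro image_mono) (auto simp: isolated_by_def)
    ultimately show "S \<in> ctbl_inf_subsets \<kappa>"
      by (simp add: ctbl_inf_subsets_def)
  qed
  have cofinal: "\<forall>S\<in>ctbl_inf_subsets \<kappa>. \<exists>T'\<in>T ` Fpow \<Phi>. S \<subseteq> T'"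
  proof
    fix S
    assume "S \<in> ctbl_inf_subsets \<kappa>"
    then have S: "S \<subseteq> b ` D" "countable S" "infinite S"
      by (auto simp: ctbl_inf_subsets_def range)
    let ?S = "inv_into D b ` S"
    have "inj_on (inv_into D b) S"
      using S(1) by (rule inj_on_inv_into)
    then have "?S \<subseteq> D" "countable ?S" "infinite ?S"
      using S by (auto simp: finite_image_iff intro: inv_into_into)
    then obtain F where F: "F \<in> Fpow \<Phi>" "?S \<subseteq> isolated_by D F"
      by (rule countable_subset_isolated[OF \<Phi> D]) auto
    have "S = b ` ?S"
      using S(1) by (simp add: image_inv_into_cancel)
    then have "S \<subseteq> T F"
      using F(2) unfolding T_def by auto
    with F(1) show "\<exists>T'\<in>T ` Fpow \<Phi>. S \<subseteq> T'"
      by auto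
  qed
  have "infinite (T ` Fpow \<Phi>)"
    by (rule uncountable_cofinal_infinite[OF unc sub cofinal])
  then have "infinite \<Phi>"
    by (auto simp: Fpow_Pow_finite)
  have "\<forall>G\<in>{G. G \<subseteq> ctbl_inf_subsets \<kappa> \<and> (\<forall>S\<in>ctbl_inf_subsets \<kappa>. \<exists>T\<in>G. S \<subseteq> T)}.
      cof_subset (ctbl_inf_subsets \<kappa>) \<le>o |G|"
    unfolding cof_subset_def
    using min_card_attained[OF ex_cofinal[of "ctbl_inf_subsets \<kappa>"]] by (elim bexE conjE) simp
  then have "cof_subset (ctbl_inf_subsets \<kappa>) \<le>o |T ` Fpow \<Phi>|"
    using sub cofinal by simp
  also have "|T ` Fpow \<Phi>| \<le>o |Fpow \<Phi>|"
    by (rule card_of_image)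
  also have "|Fpow \<Phi>| \<le>o |\<Phi>|"
    by (rule card_of_Fpow_ordLeq[OF \<open>infinite \<Phi>\<close>])
  finally show ?thesis .
qed

text \<open>
  A sequence in \<open>D\<close> is determined by a finite \<open>F \<subseteq> \<Phi>\<close> whose isolated points contain it and by a
  sequence of indices in this countable set.
\<close>
lemma sequences_ordLeq_basic_family:
  assumes \<Phi>: "basic_family K \<Phi>" and inf: "\<not> finite_dimensional K"
    and D: "D \<subseteq> topspace K" "subtopology K D = discrete_topology D" "infinite D"
  shows "|Func (UNIV :: nat set) D| \<le>o |\<Phi>|"
proof -
  obtain S0 where S0: "S0 \<subseteq> D" "countable S0" "infinite S0"
    using infinite_countable_subset'[OF D(3)] by auto
  have "\<forall>t\<in>Func (UNIV :: nat set) D. \<exists>F. F \<in> Fpow \<Phi> \<and> range t \<subseteq> isolated_by D F"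
  proof
    fix t :: "nat \<Rightarrow> 'a"
    assume "t \<in> Func UNIV D"
    then have "range t \<union> S0 \<subseteq> D"
      using S0(1) by (auto simp: Func_def)
    moreover have "countable (range t \<union> S0)" "infinite (range t \<union> S0)"
      using S0(2,3) by auto
    ultimately obtain F where "F \<in> Fpow \<Phi>" "range t \<union> S0 \<subseteq> isolated_by D F"
      by (rule countable_subset_isolated[OF \<Phi> D(1,2)]) auto
    then show "\<exists>F. F \<in> Fpow \<Phi> \<and> range t \<subseteq> isolated_by D F"
      by (intro exI[of _ F]) simp
  qed
  from bchoice[OF this] obtain F where F: "\<forall>t\<in>Func (UNIV :: nat set) D. F t \<in> Fpow \<Phi> \<and>
      range t \<subseteq> isolated_by D (F t)"
    by (elim exE)
  define c where "c t = (F t, \<lambda>k. to_nat_on (isolated_by D (F t)) (t k))" for t :: "nat \<Rightarrow> 'a"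
  have "inj_on c (Func UNIV D)"
  proof (rule inj_onI, rule ext)
    fix s t :: "nat \<Rightarrow> 'a" and k
    assume st: "s \<in> Func UNIV D" "t \<in> Func UNIV D" "c s = c t"
    have mem: "finite (F s)" "s k \<in> isolated_by D (F s)" "t k \<in> isolated_by D (F t)"
      using F st(1,2) by (auto simp: Fpow_def)
    have "F s = F t" and eq: "to_nat_on (isolated_by D (F s)) (s k) = to_nat_on (isolated_by D (F t)) (t k)"
      using st(3) by (auto simp: c_def dest: fun_cong[of _ _ k])
    then show "s k = t k"
      using mem countable_isolated_by[of "F s" D] by simp
  qed
  moreover have "c ` Func UNIV D \<subseteq> Fpow \<Phi> \<times> UNIV"
    using F by (auto simp: c_def)
  ultimately have "|Func (UNIV :: nat set) D| \<le>o |Fpow \<Phi> \<times> (UNIV :: (nat \<Rightarrow> nat) set)|"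
    by (intro card_of_ordLeq[THEN iffD1] exI conjI)
  also have "|Fpow \<Phi> \<times> (UNIV :: (nat \<Rightarrow> nat) set)| \<le>o |\<Phi>|"
  proof (rule card_of_Times_ordLeq)
    show "infinite \<Phi>"
      by (rule continuum_ordLeq_basic_family(1)[OF \<Phi> inf])
    then show "|Fpow \<Phi>| \<le>o |\<Phi>|"
      by (rule card_of_Fpow_ordLeq)
    show "|UNIV :: (nat \<Rightarrow> nat) set| \<le>o |\<Phi>|"
      using nat_functions_ordLeq_continuum continuum_ordLeq_basic_family(2)[OF \<Phi> inf]
      by (rule ordLeq_transitive)
  qed
  finally show ?thesis .
qed

section \<open>A uniformly dense set of functions\<close>

lemma closedin_finite_base_cover:
  assumes B: "is_base K B" and C: "closedin K C" and U: "openin K U" "C \<subseteq> U"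
  obtains P where "P \<in> Fpow B" and "C \<subseteq> \<Union>P" and "\<Union>P \<subseteq> U"
proof -
  have "compactin K C"
    using closedin_compact_space[OF compact C] .
  moreover have "\<forall>V\<in>{V \<in> B. V \<subseteq> U}. openin K V"
    using B by (simp add: is_base_def)
  moreover have "C \<subseteq> \<Union>{V \<in> B. V \<subseteq> U}"
  proof
    fix x
    assume "x \<in> C"
    then obtain V where "V \<in> B" "x \<in> V" "V \<subseteq> U"
      using B U unfolding is_base_def by (meson subsetD)
    then show "x \<in> \<Union>{V \<in> B. V \<subseteq> U}"
      by auto
  qed
  ultimately obtain P where "finite P" "P \<subseteq> {V \<in> B. V \<subseteq> U}" "C \<subseteq> \<Union>P"
    unfolding compactin_def by (metis (no_types, lifting))
  then show thesis
    by (intro that[of P]) (auto simp: Fpow_def)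
qed

definition separates :: "'a set set \<times> 'a set set \<Rightarrow> ('a \<Rightarrow> real) \<Rightarrow> bool" where
  "separates PQ u \<longleftrightarrow> cont u \<and> (\<forall>x\<in>topspace K. 0 \<le> u x \<and> u x \<le> 1) \<and>
     (\<forall>x\<in>topspace K \<inter> \<Union>(fst PQ). u x = 0) \<and> (\<forall>x\<in>topspace K \<inter> \<Union>(snd PQ). u x = 1)"

lemma separating_finite_unions:
  assumes B: "is_base K B" and C: "closedin K C" "closedin K D" "C \<inter> D = {}"
  obtains P Q u where "P \<in> Fpow B" and "Q \<in> Fpow B" and "C \<subseteq> \<Union>P" and "D \<subseteq> \<Union>Q"
    and "separates (P, Q) u"
proof -
  obtain w where w: "cont w" "\<And>x. x \<in> C \<Longrightarrow> w x = 0" "\<And>x. x \<in> D \<Longrightarrow> w x = 1"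
    using Urysohn_01[OF C] by metis
  have sub: "C \<subseteq> topspace K" "D \<subseteq> topspace K"
    using C(1,2) closedin_subset by auto
  obtain P where P: "P \<in> Fpow B" "C \<subseteq> \<Union>P" "\<Union>P \<subseteq> {x \<in> topspace K. w x < 1 / 3}"
    by (rule closedin_finite_base_cover[OF B C(1) openin_less_level[OF w(1), of "1 / 3"]])
      (use w sub in auto)
  obtain Q where Q: "Q \<in> Fpow B" "D \<subseteq> \<Union>Q" "\<Union>Q \<subseteq> {x \<in> topspace K. 2 / 3 < w x}"
    by (rule closedin_finite_base_cover[OF B C(2) openin_greater_level[OF w(1), of "2 / 3"]])
      (use w sub in auto)
  have "separates (P, Q) (\<lambda>x. max 0 (min 1 (3 * w x - 1)))"
    unfolding separates_def
  proof (intro conjI ballI)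
    show "cont (\<lambda>x. max 0 (min 1 (3 * w x - 1)))"
      by (intro continuous_intros w(1))
    show "max 0 (min 1 (3 * w x - 1)) = 0" if "x \<in> topspace K \<inter> \<Union>(fst (P, Q))" for x
      using P(3) that by force
    show "max 0 (min 1 (3 * w x - 1)) = 1" if "x \<in> topspace K \<inter> \<Union>(snd (P, Q))" for x
      using Q(3) that by force
  qed auto
  with P(1,2) Q(1,2) show thesis
    by (intro that)
qed

text \<open>
  Here \<open>a i\<close> is the value of the \<open>i\<close>-th layer at a point where the function to be approximated,
  multiplied by the number of layers per unit, has the value \<open>y\<close>.
\<close>
lemma layer_sum_approx:
  fixes a :: "nat \<Rightarrow> real"
  assumes "\<And>i. 0 \<le> a i \<and> a i \<le> 1" and "\<And>i. real i + 1 \<le> y \<Longrightarrow> a i = 1"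
    and "\<And>i. y \<le> real i \<Longrightarrow> a i = 0" and "0 \<le> y"
  shows "\<bar>(\<Sum>i<L. a i) - min y (real L)\<bar> \<le> 1"
proof (induction L)
  case 0
  then show ?case
    using \<open>0 \<le> y\<close> by simp
next
  case (Suc L)
  show ?case
  proof (cases "y \<le> real L")
    case True
    then show ?thesis
      using Suc.IH assms(3)[of L] by simp
  next
    case False
    then have "(\<Sum>i<L. a i) = (\<Sum>i<L. 1)"
      by (intro sum.cong assms(2)) auto
    then have "(\<Sum>i<Suc L. a i) = real L + a L"
      by simp
    then show ?thesis
      using False assms(1)[of L] by (auto simp: min_def abs_le_iff)
  qed
qed

text \<open>
  A function \<open>f\<close> with \<open>0 \<le> f \<le> M\<close> is approximated, up to \<open>1 / N\<close>, by \<open>1 / N\<close> times the sum of Urysohn functions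
  for its level sets \<open>{f \<le> i / N}\<close> and \<open>{f \<ge> (i + 1) / N}\<close>, where \<open>i < M * N\<close>.  By compactness one Urysohn function for
  each pair of finite unions of basic sets is enough for this.
\<close>
lemma dense_indexed_by_base:
  assumes B: "is_base K B" "infinite B"
  obtains d :: "'a set \<Rightarrow> 'a \<Rightarrow> real" where "\<And>V. cont (d V)"
    and "\<And>f e. cont f \<Longrightarrow> e > 0 \<Longrightarrow> \<exists>V\<in>B. \<forall>x\<in>topspace K. \<bar>f x - d V x\<bar> < e"
proof -
  define u where "u PQ = (if Ex (separates PQ) then Eps (separates PQ) else (\<lambda>_. 0))" for PQ
  have u_sep: "separates PQ (u PQ)" if "Ex (separates PQ)" for PQ
    unfolding u_def using someI_ex[OF that] that by simp
  have u_cont: "cont (u PQ)" for PQ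
  proof (cases "Ex (separates PQ)")
    case True
    then show ?thesis
      using u_sep[of PQ] by (simp add: separates_def)
  next
    case False
    then have "u PQ = (\<lambda>_. 0)"
      unfolding u_def by (rule if_not_P)
    then show ?thesis
      by simp
  qed
  define F where "F t x = (\<Sum>i<length (fst t). u (fst t ! i) x) / real (Suc (fst (snd t))) -
      real (snd (snd t))" for t :: "('a set set \<times> 'a set set) list \<times> nat \<times> nat" and x
  have F_cont: "cont (F t)" for t
    unfolding F_def divide_inverse using u_cont by (intro continuous_intros) auto
  let ?T = "lists (Fpow B \<times> Fpow B) \<times> (UNIV :: nat set) \<times> (UNIV :: nat set)"
  have Fpow2: "|Fpow B \<times> Fpow B| \<le>o |B|"
    using B(2) by (intro card_of_Times_ordLeq card_of_Fpow_ordLeq)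
  have "infinite (Fpow B \<times> Fpow B)"
  proof
    assume "finite (Fpow B \<times> Fpow B)"
    then have "finite (Fpow B)"
      by (metis finite_cartesian_productD1 Fpow_not_empty)
    moreover have "inj_on (\<lambda>x. {x}) B" "(\<lambda>x. {x}) ` B \<subseteq> Fpow B"
      by (auto simp: Fpow_def)
    ultimately show False
      using B(2) by (meson finite_imageD finite_subset)
  qed
  then have "|lists (Fpow B \<times> Fpow B)| \<le>o |B|"
    using card_of_lists_ordLeq Fpow2 ordLeq_transitive by blast
  moreover have "|UNIV :: nat set| \<le>o |B|"
    using B(2) by (intro countable_ordLeq_infinite) auto
  ultimately have "|?T| \<le>o |B|"
    using B(2) by (intro card_of_Times_ordLeq)
  moreover have "?T \<noteq> {}"
    by auto
  ultimately obtain h where h: "h ` B = ?T"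
    using card_of_ordLeq2[of ?T B] by auto
  show thesis
  proof (rule that[of "\<lambda>V. F (h V)"])
    show "cont (F (h V))" for V
      by (rule F_cont)
    fix f :: "'a \<Rightarrow> real" and e :: real
    assume f: "cont f" and e: "e > 0"
    obtain M0 where M0: "\<And>x. x \<in> topspace K \<Longrightarrow> \<bar>f x\<bar> \<le> M0"
      using cont_bounded[OF f] by metis
    obtain M :: nat where "M0 \<le> real M"
      using real_arch_simple by auto
    with M0 have M: "\<bar>f x\<bar> \<le> real M" if "x \<in> topspace K" for x
      using that by (meson order_trans)
    obtain p where p: "inverse (real (Suc p)) < e"
      using reals_Archimedean[OF e] by (elim exE)
    define N where "N = real (Suc p)"
    have N: "N > 0" "1 / N < e"
      using p by (auto simp: N_def inverse_eq_divide)
    define g where "g x = N * (f x + real M)" for x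
    have g_cont: "cont g"
      unfolding g_def by (intro continuous_intros f)
    define L where "L = Suc p * (2 * M)"
    have g_range: "0 \<le> g x" "g x \<le> real L" if "x \<in> topspace K" for x
    proof -
      have "0 \<le> f x + real M" "f x + real M \<le> real (2 * M)"
        using M[OF that] by auto
      then have "0 \<le> g x" "g x \<le> N * real (2 * M)"
        using N(1) unfolding g_def by (auto intro: mult_left_mono)
      then show "0 \<le> g x" "g x \<le> real L"
        by (simp_all only: L_def N_def of_nat_mult)
    qed
    have "\<forall>i. \<exists>PQ. PQ \<in> Fpow B \<times> Fpow B \<and> Ex (separates PQ) \<and>
        {x \<in> topspace K. g x \<le> real i} \<subseteq> \<Union>(fst PQ) \<and> {x \<in> topspace K. real i + 1 \<le> g x} \<subseteq> \<Union>(snd PQ)"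
    proof
      fix i :: nat
      have "{x \<in> topspace K. g x \<le> real i} \<inter> {x \<in> topspace K. real i + 1 \<le> g x} = {}"
        by auto
      then obtain P Q v where "P \<in> Fpow B" "Q \<in> Fpow B" "{x \<in> topspace K. g x \<le> real i} \<subseteq> \<Union>P"
          "{x \<in> topspace K. real i + 1 \<le> g x} \<subseteq> \<Union>Q" "separates (P, Q) v"
        by (rule separating_finite_unions[OF B(1) closedin_le_level[OF g_cont] closedin_ge_level[OF g_cont]]) auto
      then show "\<exists>PQ. PQ \<in> Fpow B \<times> Fpow B \<and> Ex (separates PQ) \<and>
          {x \<in> topspace K. g x \<le> real i} \<subseteq> \<Union>(fst PQ) \<and> {x \<in> topspace K. real i + 1 \<le> g x} \<subseteq> \<Union>(snd PQ)"
        by (intro exI[of _ "(P, Q)"]) auto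
    qed
    from choice[OF this] obtain PQ where "\<forall>i. PQ i \<in> Fpow B \<times> Fpow B \<and> Ex (separates (PQ i)) \<and>
        {x \<in> topspace K. g x \<le> real i} \<subseteq> \<Union>(fst (PQ i)) \<and>
        {x \<in> topspace K. real i + 1 \<le> g x} \<subseteq> \<Union>(snd (PQ i))"
      by (elim exE)
    then have PQ: "\<And>i. PQ i \<in> Fpow B \<times> Fpow B" "\<And>i. Ex (separates (PQ i))"
        "\<And>i. {x \<in> topspace K. g x \<le> real i} \<subseteq> \<Union>(fst (PQ i))"
        "\<And>i. {x \<in> topspace K. real i + 1 \<le> g x} \<subseteq> \<Union>(snd (PQ i))"
      by (simp_all only: simp_thms)
    have sep: "separates (PQ i) (u (PQ i))" for i
      by (rule u_sep[OF PQ(2)])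
    let ?t = "(map PQ [0..<L], p, M)"
    have approx: "\<bar>f x - F ?t x\<bar> < e" if x: "x \<in> topspace K" for x
    proof -
      have "\<bar>(\<Sum>i<L. u (PQ i) x) - min (g x) (real L)\<bar> \<le> 1"
      proof (rule layer_sum_approx)
        show "0 \<le> u (PQ i) x \<and> u (PQ i) x \<le> 1" for i
          using sep[of i] x by (simp add: separates_def)
        show "u (PQ i) x = 1" if "real i + 1 \<le> g x" for i
          using sep[of i] x PQ(4)[of i] that by (auto simp: separates_def)
        show "u (PQ i) x = 0" if "g x \<le> real i" for i
          using sep[of i] x PQ(3)[of i] that by (auto simp: separates_def)
      qed (use g_range x in auto)
      then have "\<bar>(\<Sum>i<L. u (PQ i) x) - g x\<bar> / N \<le> 1 / N"
        using g_range[OF x] N(1) by (intro divide_right_mono) auto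
      moreover have "\<bar>(\<Sum>i<L. u (PQ i) x) - g x\<bar> / N = \<bar>F ?t x - f x\<bar>"
      proof -
        have "((\<Sum>i<L. u (PQ i) x) - g x) / N = F ?t x - f x"
          using N(1) by (simp add: F_def g_def N_def diff_divide_distrib)
        then show ?thesis
          using N(1) by (metis abs_divide abs_of_pos)
      qed
      ultimately show ?thesis
        using N(2) by linarith
    qed
    have "map PQ [0..<L] \<in> lists (Fpow B \<times> Fpow B)"
      unfolding in_lists_conv_set using PQ(1) by (metis ex_map_conv)
    then have "?t \<in> ?T"
      by simp
    then obtain V where "V \<in> B" "h V = ?t"
      using h by (metis (no_types, lifting) imageE)
    with approx show "\<exists>V\<in>B. \<forall>x\<in>topspace K. \<bar>f x - F (h V) x\<bar> < e"
      by (intro bexI[of _ V]) auto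
  qed
qed

text \<open>
  A function is determined by a sequence of approximations from the dense set.
\<close>
lemma card_cont_funs_ordLeq:
  assumes B: "is_base K B" "infinite B"
  shows "|cont_funs K| \<le>o |B| ^c natLeq"
proof -
  obtain d :: "'a set \<Rightarrow> 'a \<Rightarrow> real" where d: "\<And>V. cont (d V)"
      "\<And>f e. cont f \<Longrightarrow> e > 0 \<Longrightarrow> \<exists>V\<in>B. \<forall>x\<in>topspace K. \<bar>f x - d V x\<bar> < e"
    by (rule dense_indexed_by_base[OF B]) auto
  have "\<forall>f\<in>cont_funs K. \<exists>s :: nat \<Rightarrow> 'a set. s \<in> Func UNIV B \<and>
      (\<forall>n. \<forall>x\<in>topspace K. \<bar>f x - d (s n) x\<bar> < inverse (real (Suc n)))"
  proof
    fix f
    assume "f \<in> cont_funs K"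
    then have "\<forall>n. \<exists>V. V \<in> B \<and> (\<forall>x\<in>topspace K. \<bar>f x - d V x\<bar> < inverse (real (Suc n)))"
      using d(2)[of f] by (auto simp: cont_funs_def Bex_def)
    from choice[OF this] obtain s where
      "\<forall>n. s n \<in> B \<and> (\<forall>x\<in>topspace K. \<bar>f x - d (s n) x\<bar> < inverse (real (Suc n)))"
      by (elim exE)
    then show "\<exists>s :: nat \<Rightarrow> 'a set. s \<in> Func UNIV B \<and>
        (\<forall>n. \<forall>x\<in>topspace K. \<bar>f x - d (s n) x\<bar> < inverse (real (Suc n)))"
      by (intro exI[of _ s]) (auto simp: Func_def)
  qed
  from bchoice[OF this] obtain s where s: "\<forall>f\<in>cont_funs K. s f \<in> Func (UNIV :: nat set) B \<and>
      (\<forall>n. \<forall>x\<in>topspace K. \<bar>f x - d (s f n) x\<bar> < inverse (real (Suc n)))"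
    by (elim exE)
  have "inj_on s (cont_funs K)"
  proof (rule inj_onI)
    fix f g
    assume fg: "f \<in> cont_funs K" "g \<in> cont_funs K" "s f = s g"
    show "f = g"
    proof (rule extensionalityI[of f "topspace K"])
      show "f x = g x" if x: "x \<in> topspace K" for x
      proof (rule ccontr)
        assume "f x \<noteq> g x"
        then have "0 < \<bar>f x - g x\<bar> / 2"
          by simp
        from reals_Archimedean[OF this] obtain n where n: "inverse (real (Suc n)) < \<bar>f x - g x\<bar> / 2"
          by (elim exE)
        have near: "\<bar>f x - d (s f n) x\<bar> < inverse (real (Suc n))"
            "\<bar>g x - d (s f n) x\<bar> < inverse (real (Suc n))"
          using s fg x by auto
        have "\<bar>f x - g x\<bar> \<le> \<bar>f x - d (s f n) x\<bar> + \<bar>g x - d (s f n) x\<bar>"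
          by linarith
        also have "\<dots> < inverse (real (Suc n)) + inverse (real (Suc n))"
          by (rule add_strict_mono[OF near])
        also have "\<dots> = 2 * inverse (real (Suc n))"
          by simp
        also have "\<dots> < 2 * (\<bar>f x - g x\<bar> / 2)"
          by (rule mult_strict_left_mono[OF n]) simp
        finally show False
          by simp
      qed
    qed (use fg in \<open>auto simp: cont_funs_def\<close>)
  qed
  moreover have "s ` cont_funs K \<subseteq> Func UNIV B"
    using s by auto
  ultimately have "|cont_funs K| \<le>o |Func (UNIV :: nat set) B|"
    by (intro card_of_ordLeq[THEN iffD1] exI conjI)
  then show ?thesis
    by (simp add: cexp_def Field_natLeq Field_card_of)
qed

text \<open>
  Points of a Hausdorff space are told apart by the basic sets containing them, so a finite base
  forces the space to be finite and discrete, and its points form a refinement of any cover.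
\<close>
lemma finite_base_finite_dimensional:
  assumes B: "is_base K B" and "finite B"
  shows "finite_dimensional K"
proof -
  have "inj_on (\<lambda>x. {V \<in> B. x \<in> V}) (topspace K)"
  proof (rule inj_onI, rule ccontr)
    fix x y
    assume xy: "x \<in> topspace K" "y \<in> topspace K" "{V \<in> B. x \<in> V} = {V \<in> B. y \<in> V}" "x \<noteq> y"
    then obtain U where U: "openin K U" "x \<in> U" "y \<notin> U"
      using Hausdorff_imp_t1_space[OF Hausdorff] unfolding t1_space_def by metis
    then obtain V where "V \<in> B" "x \<in> V" "V \<subseteq> U"
      using B unfolding is_base_def by metis
    with xy(3) U(3) show False
      by blast
  qed
  moreover have "(\<lambda>x. {V \<in> B. x \<in> V}) ` topspace K \<subseteq> Pow B"
    by auto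
  ultimately have fin: "finite (topspace K)"
    using \<open>finite B\<close> by (meson finite_Pow_iff finite_imageD finite_subset)
  have "K = discrete_topology (topspace K)"
    using finite_t1_space_imp_discrete_topology[OF refl fin] Hausdorff_imp_t1_space[OF Hausdorff] by simp
  then have "openin K S" if "S \<subseteq> topspace K" for S
    using that by (metis openin_discrete_topology)
  moreover have "{V \<in> (\<lambda>x. {x}) ` topspace K. x \<in> V} \<subseteq> {{x}}" for x
    by auto
  then have "card {V \<in> (\<lambda>x. {x}) ` topspace K. x \<in> V} \<le> 1" for x
    using card_mono[of "{{x}}"] by fastforce
  ultimately have "covering_dim_le K 0"
    unfolding covering_dim_le_def using fin
    by (intro conjI allI impI exI[of _ "(\<lambda>x. {x}) ` topspace K"]) auto
  then show ?thesis
    unfolding finite_dimensional_def ..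
qed

lemma weight_attained:
  obtains B where "is_base K B" and "weight K = |B|"
  using min_card_attained[OF ex_base, of K] that unfolding weight_def by auto

lemma basic_attained:
  obtains \<Phi> where "basic_family K \<Phi>" and "basic K = |\<Phi>|"
    and "\<And>\<Psi>. basic_family K \<Psi> \<Longrightarrow> basic K \<le>o |\<Psi>|"
  using min_card_attained[OF ex_basic_family, of K] that unfolding basic_def by fastforce

text \<open>
  Since all continuous functions together form a basic family, the inequalities
  \<open>basic K \<le> |C(K)| \<le> w ^ \<aleph>\<^sub>0 = |D| ^ \<aleph>\<^sub>0 \<le> basic K\<close> close up.
\<close>
lemma basic_infinite_dimensional:
  assumes nice: "nice_space K" and inf: "\<not> finite_dimensional K"
  shows "basic K =o |cont_funs K|" and "|cont_funs K| =o weight K ^c natLeq"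
proof -
  obtain B where B: "is_base K B" "weight K = |B|"
    by (rule weight_attained)
  have "infinite B"
    using finite_base_finite_dimensional[OF B(1)] inf by auto
  obtain D where D: "D \<subseteq> topspace K" "subtopology K D = discrete_topology D" "|D| =o |B|"
    using nice unfolding nice_space_def B(2) by auto
  have "infinite D"
    using \<open>infinite B\<close> card_of_ordIso_finite[OF D(3)] by simp
  obtain \<Phi> where \<Phi>: "basic_family K \<Phi>" "basic K = |\<Phi>|" "\<And>\<Psi>. basic_family K \<Psi> \<Longrightarrow> basic K \<le>o |\<Psi>|"
    by (rule basic_attained) auto
  have "\<Phi> \<subseteq> cont_funs K"
    using \<Phi>(1) by (simp add: basic_family_def)
  then have 1: "|\<Phi>| \<le>o |cont_funs K|"
    by (rule card_of_mono1)
  have 2: "|cont_funs K| \<le>o |B| ^c natLeq"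
    by (rule card_cont_funs_ordLeq[OF B(1) \<open>infinite B\<close>])
  have "|B| ^c natLeq \<le>o |D| ^c natLeq"
    using ordIso_imp_ordLeq[OF ordIso_symmetric[OF D(3)]] natLeq_Card_order by (rule cexp_mono1)
  also have "|D| ^c natLeq \<le>o |\<Phi>|"
    using sequences_ordLeq_basic_family[OF \<Phi>(1) inf D(1,2) \<open>infinite D\<close>]
    by (simp add: cexp_def Field_natLeq Field_card_of)
  finally have 3: "|B| ^c natLeq \<le>o |\<Phi>|" .
  show "basic K =o |cont_funs K|"
    using 1 ordLeq_transitive[OF 2 3] by (simp add: \<Phi>(2) ordIso_iff_ordLeq)
  show "|cont_funs K| =o weight K ^c natLeq"
    using 2 ordLeq_transitive[OF 3 1] by (simp add: B(2) ordIso_iff_ordLeq)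
qed

end

section \<open>Approximate superpositions in finite dimension\<close>

text \<open>
  Distinct values on the pieces of a family make room for prescribing an outer function freely on
  each piece.
\<close>
lemma distinct_perturbation:
  fixes a :: "'b \<Rightarrow> real"
  assumes "finite I" and "\<eta> > 0"
  shows "\<exists>c. inj_on c I \<and> (\<forall>s\<in>I. \<bar>c s - a s\<bar> < \<eta>)"
  using assms(1)
proof (induction I)
  case empty
  then show ?case
    by simp
next
  case (insert s I)
  then obtain c where c: "inj_on c I" "\<forall>s\<in>I. \<bar>c s - a s\<bar> < \<eta>"
    by (elim exE conjE)
  have "infinite ({a s - \<eta><..<a s + \<eta>} - c ` I)"
    using \<open>\<eta> > 0\<close> insert.hyps(1) by (intro Diff_infinite_finite) auto
  then obtain t where t: "t \<in> {a s - \<eta><..<a s + \<eta>}" "t \<notin> c ` I"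
    by (metis Diff_iff all_not_in_conv finite.emptyI)
  have "inj_on (c(s := t)) (insert s I)"
    using c(1) t(2) insert.hyps(2) by (auto simp: inj_on_def image_iff)
  moreover have "\<forall>r\<in>insert s I. \<bar>(c(s := t)) r - a r\<bar> < \<eta>"
    using c(2) t(1) by (auto simp: abs_less_iff)
  ultimately show ?case
    by blast
qed

lemma bounded_interpolation:
  fixes c v :: "'b \<Rightarrow> real"
  assumes "finite I" and "inj_on c I" and "\<And>s. s \<in> I \<Longrightarrow> \<bar>v s\<bar> \<le> M" and "0 \<le> M"
  obtains g where "continuous_on UNIV g" and "\<And>y. \<bar>g y\<bar> \<le> M" and "\<And>s. s \<in> I \<Longrightarrow> g (c s) = v s"
proof -
  let ?f = "\<lambda>y. v (inv_into I c y)"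
  have inv: "inv_into I c (c s) = s" if "s \<in> I" for s
    using that assms(2) by simp
  obtain g where "continuous_on UNIV g" "\<And>y. y \<in> c ` I \<Longrightarrow> g y = ?f y" "\<And>y. y \<in> UNIV \<Longrightarrow> norm (g y) \<le> M"
  proof (rule Tietze[of "c ` I" ?f UNIV M])
    show "continuous_on (c ` I) ?f"
      using assms(1) by (intro continuous_on_finite) auto
    show "closedin (top_of_set UNIV) (c ` I)"
      using assms(1) by (simp add: finite_imp_closed)
    show "norm (?f y) \<le> M" if "y \<in> c ` I" for y
      using that assms(3) inv by auto
  qed (use assms(4) in auto)
  then show thesis
    using inv by (intro that[of g]) auto
qed

context compact_Hausdorff
begin

lemma small_oscillation_cover:
  assumes "finite E" and cont: "\<And>f. f \<in> E \<Longrightarrow> cont f" and "\<eta> > 0"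
  obtains \<U> where "finite \<U>" and "\<And>U. U \<in> \<U> \<Longrightarrow> openin K U" and "\<Union>\<U> = topspace K"
    and "\<And>U f x y. U \<in> \<U> \<Longrightarrow> f \<in> E \<Longrightarrow> x \<in> U \<Longrightarrow> y \<in> U \<Longrightarrow> \<bar>f x - f y\<bar> < \<eta>"
proof -
  define N where "N x = \<Inter>(insert (topspace K) ((\<lambda>f. {y \<in> topspace K. f x - \<eta> / 2 < f y} \<inter>
      {y \<in> topspace K. f y < f x + \<eta> / 2}) ` E))" for x
  have N_open: "openin K (N x)" for x
    unfolding N_def using assms(1) cont
    by (intro openin_Inter) (auto intro!: openin_Int openin_less_level openin_greater_level)
  have N_mem: "x \<in> N x" if "x \<in> topspace K" for x
    using that \<open>\<eta> > 0\<close> by (auto simp: N_def)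
  have N_small: "\<bar>f y - f z\<bar> < \<eta>" if "f \<in> E" "y \<in> N x" "z \<in> N x" for f x y z
  proof -
    have "f x - \<eta> / 2 < f y \<and> f y < f x + \<eta> / 2" "f x - \<eta> / 2 < f z \<and> f z < f x + \<eta> / 2"
      using that by (auto simp: N_def)
    then show ?thesis
      by (simp add: abs_less_iff)
  qed
  have "topspace K \<subseteq> \<Union>(N ` topspace K)" "\<forall>U\<in>N ` topspace K. openin K U"
    using N_open N_mem by auto
  then obtain \<F> where \<F>: "finite \<F>" "\<F> \<subseteq> N ` topspace K" "topspace K \<subseteq> \<Union>\<F>"
    using compact[unfolded compact_space_alt, rule_format, of "N ` topspace K"] by auto
  show thesis
  proof (rule that[of \<F>])
    show \<F>_open: "openin K U" if "U \<in> \<F>" for U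
      using that \<F>(2) N_open by auto
    show "\<Union>\<F> = topspace K"
      using \<F>(3) \<F>_open[THEN openin_subset] by (intro equalityI Union_least) auto
    show "\<bar>f x - f y\<bar> < \<eta>" if "U \<in> \<F>" "f \<in> E" "x \<in> U" "y \<in> U" for U f x y
      using that \<F>(2) N_small by auto
  qed (rule \<F>(1))
qed

text \<open>
  The factor \<open>3 / 4\<close> could be any number below \<open>1\<close>: iterated approximations with this property
  converge geometrically.
\<close>
definition superposes ::
    "nat \<Rightarrow> ('a \<Rightarrow> real) \<Rightarrow> real \<Rightarrow> (nat \<Rightarrow> 'a \<Rightarrow> real) \<Rightarrow> bool" where
  "superposes N h M \<psi> \<longleftrightarrow> (\<exists>g. (\<forall>i<N. continuous_on UNIV (g i) \<and> (\<forall>y :: real. \<bar>g i y\<bar> \<le> M)) \<and>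
     (\<forall>x\<in>topspace K. \<bar>h x - (\<Sum>i<N. g i (\<psi> i x))\<bar> \<le> 3 / 4 * M))"

definition stably_superposes ::
    "nat \<Rightarrow> ('a \<Rightarrow> real) \<Rightarrow> real \<Rightarrow> (nat \<Rightarrow> 'a \<Rightarrow> real) \<Rightarrow> real \<Rightarrow> bool" where
  "stably_superposes N h M \<psi> \<delta> \<longleftrightarrow>
     (\<forall>\<psi>'. (\<forall>i<N. \<forall>x\<in>topspace K. \<bar>\<psi>' i x - \<psi> i x\<bar> \<le> \<delta>) \<longrightarrow> superposes N h M \<psi>')"

text \<open>Rational bounds and tolerances keep the number of requirements countable.\<close>
definition closed_under_superposition :: "nat \<Rightarrow> ('a \<Rightarrow> real) set \<Rightarrow> bool" where
  "closed_under_superposition N H \<longleftrightarrow> (\<forall>h\<in>H. \<forall>q\<in>\<rat>. \<forall>e\<in>\<rat>. \<forall>\<phi>.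
     0 < q \<and> (\<forall>x\<in>topspace K. \<bar>h x\<bar> \<le> q) \<and> 0 < e \<and> (\<forall>i<N. \<phi> i \<in> H) \<longrightarrow>
     (\<exists>\<psi>. (\<forall>i<N. \<psi> i \<in> H \<and> (\<forall>x\<in>topspace K. \<bar>\<psi> i x - \<phi> i x\<bar> \<le> e)) \<and>
        (\<exists>\<delta>>0. stably_superposes N h q \<psi> \<delta>)))"

definition superposes_all :: "nat \<Rightarrow> ('a \<Rightarrow> real) set \<Rightarrow> (nat \<Rightarrow> 'a \<Rightarrow> real) \<Rightarrow> bool" where
  "superposes_all N H \<psi> \<longleftrightarrow> (\<forall>h\<in>H. \<forall>q\<in>\<rat>. 0 < q \<and> (\<forall>x\<in>topspace K. \<bar>h x\<bar> \<le> q) \<longrightarrow>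
     superposes N h q \<psi>)"

text \<open>
  The functions \<open>q V\<close> are a substitute for a partition of unity subordinate to a cover of order at
  most \<open>m\<close>: at each point at most \<open>m\<close> of them are nonzero and one of them is \<open>1\<close>.
\<close>
lemma levelled_cover:
  assumes dim: "covering_dim_le K (int m - 1)"
    and E: "finite E" "\<And>f. f \<in> E \<Longrightarrow> cont f" and "\<eta> > 0"
  obtains \<V> and q :: "'a set \<Rightarrow> 'a \<Rightarrow> real"
  where "finite \<V>" and "\<And>V. V \<in> \<V> \<Longrightarrow> cont (q V)"
    and "\<And>x. x \<in> topspace K \<Longrightarrow> card {V \<in> \<V>. x \<in> V} \<le> m"
    and "\<And>V x. V \<in> \<V> \<Longrightarrow> x \<in> topspace K \<Longrightarrow> 0 \<le> q V x \<and> q V x \<le> 1"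
    and "\<And>V x. V \<in> \<V> \<Longrightarrow> x \<in> topspace K \<Longrightarrow> x \<notin> V \<Longrightarrow> q V x = 0"
    and "\<And>x. x \<in> topspace K \<Longrightarrow> \<exists>V\<in>\<V>. q V x = 1"
    and "\<And>V f x y. V \<in> \<V> \<Longrightarrow> f \<in> E \<Longrightarrow> x \<in> V \<Longrightarrow> y \<in> V \<Longrightarrow> \<bar>f x - f y\<bar> < \<eta>"
proof -
  obtain \<U> where \<U>: "finite \<U>" "\<And>U. U \<in> \<U> \<Longrightarrow> openin K U" "\<Union>\<U> = topspace K"
      "\<And>U f x y. U \<in> \<U> \<Longrightarrow> f \<in> E \<Longrightarrow> x \<in> U \<Longrightarrow> y \<in> U \<Longrightarrow> \<bar>f x - f y\<bar> < \<eta>"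
    by (rule small_oscillation_cover[OF E \<open>\<eta> > 0\<close>]) auto
  have "finite \<U> \<and> (\<forall>U\<in>\<U>. openin K U) \<and> \<Union>\<U> = topspace K"
    using \<U> by auto
  from dim[unfolded covering_dim_le_def, THEN conjunct2, rule_format, OF this]
  obtain \<V> where \<V>: "finite \<V>" "\<forall>V\<in>\<V>. openin K V" "\<Union>\<V> = topspace K" "\<forall>V\<in>\<V>. \<exists>U\<in>\<U>. V \<subseteq> U"
      "\<forall>x\<in>topspace K. int (card {V \<in> \<V>. x \<in> V}) \<le> int m - 1 + 1"
    by (elim exE conjE)
  obtain C where C: "\<And>V. V \<in> \<V> \<Longrightarrow> closedin K (C V)" "\<And>V. V \<in> \<V> \<Longrightarrow> C V \<subseteq> V"
      "topspace K \<subseteq> (\<Union>V\<in>\<V>. C V)"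
    by (rule closed_shrinking[of \<V>]) (use \<V> in auto)
  have "\<forall>V\<in>\<V>. \<exists>q. cont q \<and> (\<forall>x\<in>topspace K. 0 \<le> q x \<and> q x \<le> 1) \<and>
      (\<forall>x\<in>topspace K - V. q x = 0) \<and> (\<forall>x\<in>C V. q x = 1)"
  proof
    fix V
    assume V: "V \<in> \<V>"
    have "closedin K (topspace K - V)" "(topspace K - V) \<inter> C V = {}"
      using V \<V>(2) C(2) by auto
    then obtain q where "cont q" "\<And>x. x \<in> topspace K \<Longrightarrow> 0 \<le> q x \<and> q x \<le> 1"
        "\<And>x. x \<in> topspace K - V \<Longrightarrow> q x = 0" "\<And>x. x \<in> C V \<Longrightarrow> q x = 1"
      using Urysohn_01[OF _ C(1)[OF V]] by metis
    then show "\<exists>q. cont q \<and> (\<forall>x\<in>topspace K. 0 \<le> q x \<and> q x \<le> 1) \<and>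
        (\<forall>x\<in>topspace K - V. q x = 0) \<and> (\<forall>x\<in>C V. q x = 1)"
      by (intro exI[of _ q]) auto
  qed
  from bchoice[OF this] obtain q where q: "\<forall>V\<in>\<V>. cont (q V) \<and> (\<forall>x\<in>topspace K. 0 \<le> q V x \<and> q V x \<le> 1) \<and>
      (\<forall>x\<in>topspace K - V. q V x = 0) \<and> (\<forall>x\<in>C V. q V x = 1)"
    by (elim exE)
  show thesis
  proof (rule that[of \<V> q])
    show "card {V \<in> \<V>. x \<in> V} \<le> m" if "x \<in> topspace K" for x
      using \<V>(5) that by simp
    show "\<exists>V\<in>\<V>. q V x = 1" if x: "x \<in> topspace K" for x
    proof -
      obtain V where "V \<in> \<V>" "x \<in> C V"
        using C(3) x by auto
      then show ?thesis
        using q by (intro bexI[of _ V]) auto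
    qed
    show "\<bar>f x - f y\<bar> < \<eta>" if V: "V \<in> \<V>" and "f \<in> E" "x \<in> V" "y \<in> V" for V f x y
    proof -
      obtain U where "U \<in> \<U>" "V \<subseteq> U"
        using \<V>(4) V by auto
      then show ?thesis
        using that by (intro \<U>(4)[of U]) auto
    qed
  qed (use \<V>(1) q in auto)
qed

text \<open>
  Let \<open>q V\<close> be \<open>N\<close> times the functions of a levelled cover on whose members \<open>h\<close> and all \<open>\<phi> i\<close> are
  almost constant.  For \<open>i < N\<close> call a point \<open>x\<close> good if no \<open>q V x\<close> lies strictly between \<open>i\<close> and
  \<open>i + 1\<close>.  The good points for \<open>i\<close> fall into disjoint closed pieces according to the set \<open>key i x\<close>
  of those \<open>V\<close> for which \<open>q V x\<close> is above the threshold \<open>i + 1 / 2\<close>, and each piece lies in a member of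
  the cover.  Change \<open>\<phi> i\<close> slightly to a function \<open>\<psi> i\<close> that is constant on each piece, with different
  values on different pieces; then \<open>g i\<close> can be chosen so that \<open>g i \<circ> \<psi> i\<close> is nearly \<open>h / N\<close> on the
  good points.

  Each of the at most \<open>m\<close> nonzero numbers \<open>q V x\<close> spoils at most one \<open>i\<close>, and a bad \<open>i\<close> costs at most
  \<open>2 * M / N\<close>.  With \<open>N = 4 * m + 1\<close> the bad indices cost less than \<open>M / 2\<close> together.  One eighth of
  \<open>M\<close> is spent on the oscillation of \<open>h\<close> on the pieces and another one on stability.
\<close>
lemma superposition_step:
  assumes dim: "covering_dim_le K (int m - 1)" and N: "N = 4 * m + 1"
    and h: "cont h" "M > 0" "\<And>x. x \<in> topspace K \<Longrightarrow> \<bar>h x\<bar> \<le> M"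
    and \<phi>: "\<And>i. i < N \<Longrightarrow> cont (\<phi> i)" and "\<epsilon> > 0"
  obtains \<psi> \<delta> where "\<And>i. i < N \<Longrightarrow> cont (\<psi> i)"
    and "\<And>i x. i < N \<Longrightarrow> x \<in> topspace K \<Longrightarrow> \<bar>\<psi> i x - \<phi> i x\<bar> \<le> \<epsilon>"
    and "\<delta> > 0" and "stably_superposes N h M \<psi> \<delta>"
proof -
  have N0: "real N > 0"
    by (simp add: N)
  define \<eta> where "\<eta> = min (M / 8) (\<epsilon> / 2)"
  have \<eta>: "\<eta> > 0" "\<eta> \<le> M / 8" "2 * \<eta> \<le> \<epsilon>"
    using h(2) \<open>\<epsilon> > 0\<close> by (auto simp: \<eta>_def)
  let ?E = "insert h (\<phi> ` {..<N})"
  obtain \<V> and p :: "'a set \<Rightarrow> 'a \<Rightarrow> real" where \<V>: "finite \<V>" "\<And>V. V \<in> \<V> \<Longrightarrow> cont (p V)"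
    "\<And>x. x \<in> topspace K \<Longrightarrow> card {V \<in> \<V>. x \<in> V} \<le> m"
    "\<And>V x. V \<in> \<V> \<Longrightarrow> x \<in> topspace K \<Longrightarrow> 0 \<le> p V x \<and> p V x \<le> 1"
    "\<And>V x. V \<in> \<V> \<Longrightarrow> x \<in> topspace K \<Longrightarrow> x \<notin> V \<Longrightarrow> p V x = 0"
    "\<And>x. x \<in> topspace K \<Longrightarrow> \<exists>V\<in>\<V>. p V x = 1"
    "\<And>V f x y. V \<in> \<V> \<Longrightarrow> f \<in> ?E \<Longrightarrow> x \<in> V \<Longrightarrow> y \<in> V \<Longrightarrow> \<bar>f x - f y\<bar> < \<eta>"
  proof (rule levelled_cover[OF dim _ _ \<eta>(1), of ?E])
    show "cont f" if "f \<in> ?E" for f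
      using that h(1) \<phi> by auto
  qed auto
  define q where "q V x = real N * p V x" for V x
  have q_cont: "cont (q V)" if "V \<in> \<V>" for V
    unfolding q_def using \<V>(2)[OF that] by (intro continuous_intros)
  have q_0: "q V x = 0" if "V \<in> \<V>" "x \<in> topspace K" "x \<notin> V" for V x
    using \<V>(5)[OF that] by (simp add: q_def)
  have q_N: "\<exists>V\<in>\<V>. q V x = real N" if "x \<in> topspace K" for x
    using \<V>(6)[OF that] by (auto simp: q_def)
  define key where "key i x = {V \<in> \<V>. real i + 1 / 2 < q V x}" for i :: nat and x
  define good where "good i x \<longleftrightarrow> (\<forall>V\<in>\<V>. q V x \<le> real i \<or> real i + 1 \<le> q V x)" for i :: nat and x
  define clamp :: "real \<Rightarrow> real" where "clamp t = max 0 (min 1 t)" for t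
  \<comment> \<open>\<open>\<Lambda> i S\<close> is a bump function for the piece \<open>key i x = S\<close>: it vanishes off the points with key \<open>S\<close>
    and is \<open>1\<close> at the good ones among them\<close>
  define \<Lambda> where "\<Lambda> i S x = (\<Prod>V\<in>\<V>. if V \<in> S then clamp (2 * (q V x - real i) - 1)
      else clamp (1 - 2 * (q V x - real i)))" for i :: nat and S x
  have \<Lambda>_cont: "cont (\<Lambda> i S)" for i S
    unfolding \<Lambda>_def
  proof (intro continuous_map_prod \<V>(1))
    fix V
    assume "V \<in> \<V>"
    then show "cont (\<lambda>x. if V \<in> S then clamp (2 * (q V x - real i) - 1) else clamp (1 - 2 * (q V x - real i)))"
      unfolding clamp_def using q_cont[of V] by (cases "V \<in> S") (auto intro!: continuous_intros)
  qed
  have \<Lambda>_range: "0 \<le> \<Lambda> i S x" "\<Lambda> i S x \<le> 1" for i S x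
    unfolding \<Lambda>_def by (auto intro!: prod_nonneg prod_le_1 simp: clamp_def)
  have \<Lambda>_0: "\<Lambda> i S x = 0" if "S \<subseteq> \<V>" "S \<noteq> key i x" for i S x
  proof -
    have "\<exists>V\<in>\<V>. (V \<in> S) \<noteq> (V \<in> key i x)"
      using that unfolding key_def by auto
    then obtain V where V: "V \<in> \<V>" "(V \<in> S) \<noteq> (real i + 1 / 2 < q V x)"
      unfolding key_def by auto
    then have "(if V \<in> S then clamp (2 * (q V x - real i) - 1) else clamp (1 - 2 * (q V x - real i))) = 0"
      by (auto simp: clamp_def)
    then show ?thesis
      unfolding \<Lambda>_def by (intro prod_zero \<V>(1) bexI[OF _ V(1)])
  qed
  have \<Lambda>_1: "\<Lambda> i (key i x) x = 1" if "good i x" for i x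
    unfolding \<Lambda>_def
  proof (rule prod.neutral, rule ballI)
    fix V
    assume "V \<in> \<V>"
    then have "q V x \<le> real i \<or> real i + 1 \<le> q V x"
      using that by (simp add: good_def)
    then show "(if V \<in> key i x then clamp (2 * (q V x - real i) - 1) else clamp (1 - 2 * (q V x - real i))) = 1"
      using \<open>V \<in> \<V>\<close> by (auto simp: key_def clamp_def)
  qed
  have few_bad: "card {i. i < N \<and> \<not> good i x} \<le> m" if x: "x \<in> topspace K" for x
  proof -
    have "\<forall>i\<in>{i. i < N \<and> \<not> good i x}. \<exists>V. V \<in> \<V> \<and> real i < q V x \<and> q V x < real i + 1"
      by (auto simp: good_def not_le)
    from bchoice[OF this] obtain v where v: "\<forall>i\<in>{i. i < N \<and> \<not> good i x}.
        v i \<in> \<V> \<and> real i < q (v i) x \<and> q (v i) x < real i + 1"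
      by (elim exE)
    have "inj_on v {i. i < N \<and> \<not> good i x}"
    proof (rule inj_onI)
      fix i j
      assume "i \<in> {i. i < N \<and> \<not> good i x}" "j \<in> {i. i < N \<and> \<not> good i x}" "v i = v j"
      then have "real i < q (v i) x" "q (v i) x < real i + 1" "real j < q (v i) x" "q (v i) x < real j + 1"
        using v by auto
      then have "real i < real j + 1" "real j < real i + 1"
        by linarith+
      then show "i = j"
        by linarith
    qed
    moreover have "v ` {i. i < N \<and> \<not> good i x} \<subseteq> {V \<in> \<V>. x \<in> V}"
    proof
      fix V
      assume "V \<in> v ` {i. i < N \<and> \<not> good i x}"
      then obtain i where i: "V = v i" "i < N" "\<not> good i x"
        by auto
      then have "V \<in> \<V>" "q V x > 0"
        using v of_nat_0_le_iff[of i, where 'a = real] by (auto simp: order_le_less_trans)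
      then show "V \<in> {V \<in> \<V>. x \<in> V}"
        using q_0 x by force
    qed
    ultimately have "card {i. i < N \<and> \<not> good i x} \<le> card {V \<in> \<V>. x \<in> V}"
      using \<V>(1) by (intro card_inj_on_le[of v]) auto
    with \<V>(3)[OF x] show ?thesis
      by linarith
  qed
  have key_near: "\<bar>f x - f y\<bar> < \<eta>"
    if "i < N" and xy: "x \<in> topspace K" "y \<in> topspace K" "key i x = key i y" and f: "f \<in> ?E" for i x y f
  proof -
    obtain V where V: "V \<in> \<V>" "q V x = real N"
      using q_N[OF xy(1)] by auto
    have "V \<in> key i x"
      using V \<open>i < N\<close> by (simp add: key_def)
    then have "real i + 1 / 2 < q V x" "real i + 1 / 2 < q V y"
      using xy(3) by (auto simp: key_def)
    then have "q V x \<noteq> 0" "q V y \<noteq> 0"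
      by auto
    then have "x \<in> V" "y \<in> V"
      using q_0[OF V(1)] xy by auto
    then show ?thesis
      using \<V>(7)[OF V(1) f] by blast
  qed
  define pt where "pt i S = (SOME x. x \<in> topspace K \<and> key i x = S)" for i S
  have pt: "pt i (key i x) \<in> topspace K" "key i x = key i (pt i (key i x))" if "x \<in> topspace K" for i x
    using someI[of "\<lambda>y. y \<in> topspace K \<and> key i y = key i x" x] that by (simp_all add: pt_def)
  have "\<forall>i. \<exists>c. inj_on c (Pow \<V>) \<and> (\<forall>S\<in>Pow \<V>. \<bar>c S - \<phi> i (pt i S)\<bar> < \<eta>)"
    using \<V>(1) \<eta>(1) by (intro allI distinct_perturbation) auto
  from choice[OF this] obtain c where c: "\<forall>i. inj_on (c i) (Pow \<V>) \<and> (\<forall>S\<in>Pow \<V>. \<bar>c i S - \<phi> i (pt i S)\<bar> < \<eta>)"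
    by (elim exE)
  \<comment> \<open>truncation takes care of sets \<open>S\<close> that are no keys, for which \<open>pt i S\<close> is arbitrary\<close>
  define v where "v i S = max (- M) (min M (h (pt i S))) / real N" for i S
  have v: "\<bar>v i S\<bar> \<le> M / real N" for i S
    using h(2) N0 by (simp add: v_def abs_le_iff divide_right_mono)
  have "\<forall>i. \<exists>g. continuous_on UNIV g \<and> (\<forall>y. \<bar>g y\<bar> \<le> M / real N) \<and> (\<forall>S\<in>Pow \<V>. g (c i S) = v i S)"
  proof
    fix i
    obtain g where "continuous_on UNIV g" "\<And>y. \<bar>g y\<bar> \<le> M / real N" "\<And>S. S \<in> Pow \<V> \<Longrightarrow> g (c i S) = v i S"
      by (rule bounded_interpolation[of "Pow \<V>" "c i" "v i" "M / real N"])
        (use \<V>(1) c v h(2) in auto)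
    then show "\<exists>g. continuous_on UNIV g \<and> (\<forall>y. \<bar>g y\<bar> \<le> M / real N) \<and> (\<forall>S\<in>Pow \<V>. g (c i S) = v i S)"
      by (intro exI[of _ g]) auto
  qed
  from choice[OF this] obtain g where g: "\<forall>i. continuous_on UNIV (g i) \<and> (\<forall>y. \<bar>g i y\<bar> \<le> M / real N) \<and>
      (\<forall>S\<in>Pow \<V>. g i (c i S) = v i S)"
    by (elim exE)
  define \<psi> where "\<psi> i x = \<phi> i x + (\<Sum>S\<in>Pow \<V>. \<Lambda> i S x * (c i S - \<phi> i x))" for i x
  have \<psi>_cont: "cont (\<psi> i)" if "i < N" for i
    unfolding \<psi>_def using \<V>(1) by (intro continuous_intros \<phi>[OF that] \<Lambda>_cont) auto
  have key_Pow: "key i x \<in> Pow \<V>" for i x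
    by (auto simp: key_def)
  have \<psi>_eq: "\<psi> i x = \<phi> i x + \<Lambda> i (key i x) x * (c i (key i x) - \<phi> i x)" for i x
  proof -
    have "(\<Sum>S\<in>Pow \<V> - {key i x}. \<Lambda> i S x * (c i S - \<phi> i x)) = 0"
      using \<Lambda>_0 by (intro sum.neutral) auto
    then show ?thesis
      using sum.remove[OF _ key_Pow[of i x], of "\<lambda>S. \<Lambda> i S x * (c i S - \<phi> i x)"] \<V>(1)
      by (simp add: \<psi>_def)
  qed
  have \<psi>_near: "\<bar>\<psi> i x - \<phi> i x\<bar> \<le> \<epsilon>" if i: "i < N" and x: "x \<in> topspace K" for i x
  proof -
    have "\<bar>\<phi> i x - \<phi> i (pt i (key i x))\<bar> < \<eta>"
      using i by (intro key_near[OF i x pt[OF x]]) auto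
    moreover have "\<bar>c i (key i x) - \<phi> i (pt i (key i x))\<bar> < \<eta>"
      using c key_Pow by auto
    ultimately have "\<bar>c i (key i x) - \<phi> i x\<bar> \<le> \<epsilon>"
      using \<eta>(3) by linarith
    moreover have "\<bar>\<psi> i x - \<phi> i x\<bar> = \<Lambda> i (key i x) x * \<bar>c i (key i x) - \<phi> i x\<bar>"
      using \<Lambda>_range by (simp add: \<psi>_eq abs_mult)
    ultimately show ?thesis
      using \<Lambda>_range[of i "key i x" x] mult_left_le_one_le[of "\<bar>c i (key i x) - \<phi> i x\<bar>" "\<Lambda> i (key i x) x"]
      by linarith
  qed
  have approx: "\<bar>h x - (\<Sum>i<N. g i (\<psi> i x))\<bar> \<le> 5 / 8 * M" if x: "x \<in> topspace K" for x
  proof -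
    have summand: "\<bar>h x / real N - g i (\<psi> i x)\<bar> \<le> \<eta> / real N + (if good i x then 0 else 2 * M / real N)"
      if i: "i < N" for i
    proof (cases "good i x")
      case True
      then have "g i (\<psi> i x) = v i (key i x)"
        using g key_Pow[of i x] by (simp add: \<psi>_eq \<Lambda>_1)
      also have "\<dots> = h (pt i (key i x)) / real N"
        using h(3)[OF pt(1)[OF x, of i]] by (simp add: v_def abs_le_iff)
      finally have "h x / real N - g i (\<psi> i x) = (h x - h (pt i (key i x))) / real N"
        by (simp add: diff_divide_distrib)
      moreover have "\<bar>h x - h (pt i (key i x))\<bar> < \<eta>"
        by (intro key_near[OF i x pt[OF x]]) auto
      ultimately show ?thesis
        using True N0 by (simp add: abs_divide divide_right_mono)
    next
      case False
      have "\<bar>h x / real N\<bar> \<le> M / real N"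
        using h(3)[OF x] N0 by (simp add: abs_divide divide_right_mono)
      moreover have "\<bar>g i (\<psi> i x)\<bar> \<le> M / real N"
        using g by auto
      moreover have "2 * M / real N = M / real N + M / real N" "\<eta> / real N \<ge> 0"
        using \<eta>(1) N0 by simp_all
      ultimately have "\<bar>h x / real N - g i (\<psi> i x)\<bar> \<le> \<eta> / real N + 2 * M / real N"
        by linarith
      with False show ?thesis
        by simp
    qed
    have "h x = (\<Sum>i<N. h x / real N)"
      using N0 by simp
    then have "\<bar>h x - (\<Sum>i<N. g i (\<psi> i x))\<bar> = \<bar>\<Sum>i<N. h x / real N - g i (\<psi> i x)\<bar>"
      by (simp add: sum_subtractf)
    also have "\<dots> \<le> (\<Sum>i<N. \<bar>h x / real N - g i (\<psi> i x)\<bar>)"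
      by (rule sum_abs)
    also have "\<dots> \<le> (\<Sum>i<N. \<eta> / real N + (if good i x then 0 else 2 * M / real N))"
      using summand by (intro sum_mono) auto
    also have "\<dots> = \<eta> + (\<Sum>i\<in>{i. i < N \<and> \<not> good i x}. 2 * M / real N)"
    proof -
      have bad: "{i. i < N \<and> \<not> good i x} = {i \<in> {..<N}. \<not> good i x}"
        by auto
      have "(\<Sum>i<N. if good i x then 0 else 2 * M / real N) =
          (\<Sum>i\<in>{i. i < N \<and> \<not> good i x}. 2 * M / real N)"
        unfolding bad sum.inter_filter[OF finite_lessThan] by (intro sum.cong) auto
      moreover have "(\<Sum>i<N. \<eta> / real N) = \<eta>"
        using N0 by simp
      ultimately show ?thesis
        by (simp only: sum.distrib)
    qed
    also have "\<dots> \<le> M / 8 + real m * (2 * M / real N)"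
      unfolding sum_constant using few_bad[OF x] \<eta>(2) h(2) N0
      by (intro add_mono mult_right_mono) auto
    also have "\<dots> \<le> M / 8 + M / 2"
      using h(2) by (simp add: N field_simps)
    finally show ?thesis
      by simp
  qed
  have "\<forall>i\<in>{..<N}. \<exists>\<delta>>0. \<forall>x\<in>topspace K. \<forall>y. \<bar>y - \<psi> i x\<bar> < \<delta> \<longrightarrow> \<bar>g i y - g i (\<psi> i x)\<bar> < M / (8 * real N)"
  proof
    fix i
    assume "i \<in> {..<N}"
    then have "cont (\<psi> i)" "continuous_on UNIV (g i)" "M / (8 * real N) > 0"
      using \<psi>_cont g h(2) N0 by auto
    then obtain \<delta> where "\<delta> > 0"
        "\<And>x y. x \<in> topspace K \<Longrightarrow> \<bar>y - \<psi> i x\<bar> < \<delta> \<Longrightarrow> \<bar>g i y - g i (\<psi> i x)\<bar> < M / (8 * real N)"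
      by (rule uniform_modulus) auto
    then show "\<exists>\<delta>>0. \<forall>x\<in>topspace K. \<forall>y. \<bar>y - \<psi> i x\<bar> < \<delta> \<longrightarrow> \<bar>g i y - g i (\<psi> i x)\<bar> < M / (8 * real N)"
      by (intro exI[of _ \<delta>]) auto
  qed
  from bchoice[OF this] obtain \<delta> where \<delta>: "\<forall>i\<in>{..<N}. \<delta> i > 0 \<and> (\<forall>x\<in>topspace K. \<forall>y.
      \<bar>y - \<psi> i x\<bar> < \<delta> i \<longrightarrow> \<bar>g i y - g i (\<psi> i x)\<bar> < M / (8 * real N))"
    by (elim exE)
  define d where "d = Min (\<delta> ` {..<N}) / 2"
  have "N > 0"
    by (simp add: N)
  have d: "d > 0"
    using \<delta> \<open>N > 0\<close> by (auto simp: d_def lessThan_empty_iff)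
  have d_less: "d < \<delta> i" if "i < N" for i
  proof -
    have "Min (\<delta> ` {..<N}) \<le> \<delta> i"
      using that by (intro Min_le) auto
    with d show ?thesis
      by (simp add: d_def)
  qed
  show thesis
  proof (rule that[OF \<psi>_cont \<psi>_near d])
    show "stably_superposes N h M \<psi> d"
      unfolding stably_superposes_def superposes_def
    proof (intro allI impI exI[of _ g] conjI ballI)
      show "continuous_on UNIV (g i)" for i
        using g by simp
      show "\<bar>g i y\<bar> \<le> M" for i y
      proof -
        have "\<bar>g i y\<bar> \<le> M / real N"
          using g by simp
        also have "\<dots> \<le> M"
          using h(2) by (simp add: N field_simps)
        finally show ?thesis .
      qed
      fix \<psi>' x
      assume \<psi>': "\<forall>i<N. \<forall>x\<in>topspace K. \<bar>\<psi>' i x - \<psi> i x\<bar> \<le> d" and x: "x \<in> topspace K"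
      have "\<bar>g i (\<psi>' i x) - g i (\<psi> i x)\<bar> \<le> M / (8 * real N)" if "i < N" for i
      proof -
        have "\<bar>\<psi>' i x - \<psi> i x\<bar> < \<delta> i"
          using \<psi>' that x d_less[OF that] by (meson order_le_less_trans)
        then show ?thesis
          using \<delta> that x by (simp add: less_imp_le)
      qed
      then have "(\<Sum>i<N. \<bar>g i (\<psi>' i x) - g i (\<psi> i x)\<bar>) \<le> (\<Sum>i<N. M / (8 * real N))"
        by (intro sum_mono) auto
      also have "\<dots> = M / 8"
        using N0 by simp
      finally have "\<bar>(\<Sum>i<N. g i (\<psi>' i x)) - (\<Sum>i<N. g i (\<psi> i x))\<bar> \<le> M / 8"
        unfolding sum_subtractf[symmetric] by (rule order_trans[OF sum_abs])
      with approx[OF x] show "\<bar>h x - (\<Sum>i<N. g i (\<psi>' i x))\<bar> \<le> 3 / 4 * M"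
        by linarith
    qed
  qed
qed

end

section \<open>Uniform closures of countable sets of functions\<close>

text \<open>
  A downward Loewenheim-Skolem argument for finitary operations with countably many values.
\<close>
lemma countable_closure:
  fixes F :: "'b list \<Rightarrow> 'b set"
  assumes "countable A" and "\<And>l. countable (F l)"
  obtains H where "countable H" and "A \<subseteq> H" and "\<And>l. l \<in> lists H \<Longrightarrow> F l \<subseteq> H"
proof -
  define H where "H = rec_nat A (\<lambda>_ S. S \<union> (\<Union>l\<in>lists S. F l))"
  have H: "H 0 = A" "H (Suc k) = H k \<union> (\<Union>l\<in>lists (H k). F l)" for k
    by (simp_all add: H_def)
  have count: "countable (H k)" for k
  proof (induction k)
    case (Suc k)
    then have "countable (\<Union>l\<in>lists (H k). F l)"
      using assms(2) by (intro countable_UN countable_lists)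
    with Suc show ?case
      by (simp add: H(2))
  qed (simp add: H(1) assms(1))
  have mono: "H j \<subseteq> H k" if "j \<le> k" for j k
    by (rule lift_Suc_mono_le[OF _ that]) (simp add: H(2))
  have level: "\<exists>k. l \<in> lists (H k)" if "l \<in> lists (\<Union>k. H k)" for l
    using that
  proof (induction l)
    case (Cons x l)
    then obtain j k where "x \<in> H j" "l \<in> lists (H k)"
      by auto
    then have "x # l \<in> lists (H (max j k))"
      using mono[of j "max j k"] mono[of k "max j k"] by (auto simp: in_lists_conv_set)
    then show ?case ..
  qed simp
  show thesis
  proof (rule that[of "\<Union>k. H k"])
    show "countable (\<Union>k. H k)"
      using count by simp
    show "A \<subseteq> (\<Union>k. H k)"
      using H(1) by auto
    show "F l \<subseteq> (\<Union>k. H k)" if l: "l \<in> lists (\<Union>k. H k)" for l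
    proof -
      obtain k where "l \<in> lists (H k)"
        using level[OF l] by (elim exE)
      then have "F l \<subseteq> H (Suc k)"
        by (auto simp: H(2))
      then show ?thesis
        by auto
    qed
  qed
qed

definition uniform_closure :: "'a topology \<Rightarrow> ('a \<Rightarrow> real) set \<Rightarrow> ('a \<Rightarrow> real) set" where
  "uniform_closure X H = {f. \<forall>e>0. \<exists>g\<in>H. \<forall>x\<in>topspace X. \<bar>f x - g x\<bar> < e}"

lemma uniform_closureI:
  assumes "\<And>e. e > 0 \<Longrightarrow> \<exists>g\<in>H. \<forall>x\<in>topspace X. \<bar>f x - g x\<bar> < e"
  shows "f \<in> uniform_closure X H"
  using assms by (simp add: uniform_closure_def)

lemma uniform_closureE:
  assumes "f \<in> uniform_closure X H" and "e > 0"
  obtains g where "g \<in> H" and "\<And>x. x \<in> topspace X \<Longrightarrow> \<bar>f x - g x\<bar> < e"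
proof -
  have "\<exists>g\<in>H. \<forall>x\<in>topspace X. \<bar>f x - g x\<bar> < e"
    using assms by (simp add: uniform_closure_def)
  then show thesis
    using that by auto
qed

lemma uniform_closure_limit:
  assumes "\<And>e. e > 0 \<Longrightarrow> \<exists>g\<in>uniform_closure X H. \<forall>x\<in>topspace X. \<bar>f x - g x\<bar> < e"
  shows "f \<in> uniform_closure X H"
proof (rule uniform_closureI)
  fix e :: real
  assume "e > 0"
  then have e: "e / 2 > 0"
    by simp
  obtain g where g: "g \<in> uniform_closure X H" "\<And>x. x \<in> topspace X \<Longrightarrow> \<bar>f x - g x\<bar> < e / 2"
    using assms[OF e] by auto
  obtain h where h: "h \<in> H" "\<And>x. x \<in> topspace X \<Longrightarrow> \<bar>g x - h x\<bar> < e / 2"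
    by (rule uniform_closureE[OF g(1) e]) auto
  have "\<bar>f x - h x\<bar> < e" if "x \<in> topspace X" for x
    using g(2)[OF that] h(2)[OF that] by linarith
  with h(1) show "\<exists>g\<in>H. \<forall>x\<in>topspace X. \<bar>f x - g x\<bar> < e"
    by auto
qed

text \<open>
  Only rational constants are required, so that \<open>H\<close> can be countable; the uniform closure of \<open>H\<close>
  nevertheless is a real algebra, closed under composition with continuous functions on the reals.
\<close>
locale rational_subalgebra = compact_Hausdorff +
  fixes H :: "('a \<Rightarrow> real) set"
  assumes H_cont: "h \<in> H \<Longrightarrow> continuous_map K euclideanreal h"
    and H_const: "r \<in> \<rat> \<Longrightarrow> (\<lambda>_. r) \<in> H"
    and H_add: "f \<in> H \<Longrightarrow> g \<in> H \<Longrightarrow> (\<lambda>x. f x + g x) \<in> H"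
    and H_mult: "f \<in> H \<Longrightarrow> g \<in> H \<Longrightarrow> (\<lambda>x. f x * g x) \<in> H"
begin

abbreviation cl :: "('a \<Rightarrow> real) set" where
  "cl \<equiv> uniform_closure K H"

lemma cl_cont:
  assumes "f \<in> cl"
  shows "cont f"
proof (rule continuous_map_uniform_approx)
  fix e :: real
  assume "e > 0"
  then obtain g where "g \<in> H" "\<And>x. x \<in> topspace K \<Longrightarrow> \<bar>f x - g x\<bar> < e"
    by (rule uniform_closureE[OF assms]) auto
  then show "\<exists>g. cont g \<and> (\<forall>x\<in>topspace K. \<bar>f x - g x\<bar> < e)"
    using H_cont by auto
qed

lemma cl_const: "(\<lambda>_. c) \<in> cl"
proof (rule uniform_closureI)
  fix e :: real
  assume "e > 0"
  then obtain r where "r \<in> \<rat>" "c < r" "r < c + e"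
    using Rats_dense_in_real[of c "c + e"] by auto
  then show "\<exists>g\<in>H. \<forall>x\<in>topspace K. \<bar>c - g x\<bar> < e"
    using H_const by (intro bexI[of _ "\<lambda>_. r"]) auto
qed

lemma cl_add:
  assumes "f \<in> cl" and "g \<in> cl"
  shows "(\<lambda>x. f x + g x) \<in> cl"
proof (rule uniform_closureI)
  fix e :: real
  assume "e > 0"
  then have e: "e / 2 > 0"
    by simp
  obtain f' where f': "f' \<in> H" "\<And>x. x \<in> topspace K \<Longrightarrow> \<bar>f x - f' x\<bar> < e / 2"
    by (rule uniform_closureE[OF assms(1) e]) auto
  obtain g' where g': "g' \<in> H" "\<And>x. x \<in> topspace K \<Longrightarrow> \<bar>g x - g' x\<bar> < e / 2"
    by (rule uniform_closureE[OF assms(2) e]) auto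
  have "\<bar>f x + g x - (f' x + g' x)\<bar> < e" if "x \<in> topspace K" for x
    using f'(2)[OF that] g'(2)[OF that] by linarith
  with H_add[OF f'(1) g'(1)] show "\<exists>h\<in>H. \<forall>x\<in>topspace K. \<bar>f x + g x - h x\<bar> < e"
    by (intro bexI) auto
qed

lemma cl_mult:
  assumes "f \<in> cl" and "g \<in> cl"
  shows "(\<lambda>x. f x * g x) \<in> cl"
proof (rule uniform_closureI)
  fix e :: real
  assume "e > 0"
  obtain A where A: "A > 0" "\<And>x. x \<in> topspace K \<Longrightarrow> \<bar>f x\<bar> \<le> A"
    by (rule cont_bounded[OF cl_cont[OF assms(1)]]) auto
  obtain B where B: "B > 0" "\<And>x. x \<in> topspace K \<Longrightarrow> \<bar>g x\<bar> \<le> B"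
    by (rule cont_bounded[OF cl_cont[OF assms(2)]]) auto
  define \<epsilon> where "\<epsilon> = min 1 (e / (A + B + 1))"
  have AB: "A + B + 1 > 0"
    using A(1) B(1) by simp
  then have \<epsilon>: "\<epsilon> > 0" "\<epsilon> \<le> 1" "\<epsilon> \<le> e / (A + B + 1)"
    using \<open>e > 0\<close> by (auto simp: \<epsilon>_def)
  have small: "\<epsilon> * (A + B + 1) \<le> e"
    using \<epsilon>(3) AB by (simp only: pos_le_divide_eq)
  obtain f' where f': "f' \<in> H" "\<And>x. x \<in> topspace K \<Longrightarrow> \<bar>f x - f' x\<bar> < \<epsilon>"
    by (rule uniform_closureE[OF assms(1) \<epsilon>(1)]) auto
  obtain g' where g': "g' \<in> H" "\<And>x. x \<in> topspace K \<Longrightarrow> \<bar>g x - g' x\<bar> < \<epsilon>"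
    by (rule uniform_closureE[OF assms(2) \<epsilon>(1)]) auto
  have "\<bar>f x * g x - f' x * g' x\<bar> < e" if x: "x \<in> topspace K" for x
  proof -
    have "f x * g x - f' x * g' x = f x * (g x - g' x) + (f x - f' x) * g' x"
      by (simp add: algebra_simps)
    then have "\<bar>f x * g x - f' x * g' x\<bar> \<le> \<bar>f x\<bar> * \<bar>g x - g' x\<bar> + \<bar>f x - f' x\<bar> * \<bar>g' x\<bar>"
      by (metis abs_mult abs_triangle_ineq)
    also have "\<dots> \<le> A * \<epsilon> + \<epsilon> * \<bar>g' x\<bar>"
      using A f'(2)[OF x] g'(2)[OF x] x by (intro add_mono mult_mono) auto
    also have "\<dots> < A * \<epsilon> + \<epsilon> * (B + 1)"
      using B(2)[OF x] g'(2)[OF x] \<epsilon>(1,2) by (intro add_strict_left_mono mult_strict_left_mono) auto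
    also have "\<dots> \<le> e"
      using small by (simp add: algebra_simps)
    finally show ?thesis .
  qed
  with H_mult[OF f'(1) g'(1)] show "\<exists>h\<in>H. \<forall>x\<in>topspace K. \<bar>f x * g x - h x\<bar> < e"
    by (intro bexI) auto
qed

lemma cl_diff:
  assumes "f \<in> cl" and "g \<in> cl"
  shows "(\<lambda>x. f x - g x) \<in> cl"
  using cl_add[OF assms(1) cl_mult[OF cl_const[of "-1"] assms(2)]] by simp

lemma cl_sum:
  assumes "\<And>i. i < (n :: nat) \<Longrightarrow> f i \<in> cl"
  shows "(\<lambda>x. \<Sum>i<n. f i x) \<in> cl"
  using assms
proof (induction n)
  case 0
  then show ?case
    using cl_const[of 0] by simp
next
  case (Suc n)
  then have "(\<lambda>x. (\<Sum>i<n. f i x) + f n x) \<in> cl"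
    by (intro cl_add) auto
  then show ?case
    by simp
qed

lemma cl_polynomial:
  assumes "real_polynomial_function p" and "f \<in> cl"
  shows "(\<lambda>x. p (f x)) \<in> cl"
  using assms(1)
proof (induction p)
  case (linear p)
  then obtain c where "p = (\<lambda>y. y * c)"
    using real_bounded_linear by auto
  then show ?case
    using cl_mult[OF assms(2) cl_const[of c]] by simp
qed (auto intro: cl_const cl_add cl_mult)

lemma cl_comp:
  assumes "continuous_on UNIV (g :: real \<Rightarrow> real)" and f: "f \<in> cl"
  shows "(\<lambda>x. g (f x)) \<in> cl"
proof (rule uniform_closure_limit)
  fix e :: real
  assume "e > 0"
  obtain M where M: "M > 0" "\<And>x. x \<in> topspace K \<Longrightarrow> \<bar>f x\<bar> \<le> M"
    by (rule cont_bounded[OF cl_cont[OF f]]) auto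
  have "continuous_on {- M..M} g"
    using assms(1) continuous_on_subset by blast
  then obtain p where p: "real_polynomial_function p" "\<And>y. y \<in> {- M..M} \<Longrightarrow> \<bar>g y - p y\<bar> < e"
    by (rule Stone_Weierstrass_real_polynomial_function[OF compact_Icc _ \<open>e > 0\<close>]) auto
  have "\<bar>g (f x) - p (f x)\<bar> < e" if "x \<in> topspace K" for x
    using p(2)[of "f x"] M(2)[OF that] by (simp add: abs_le_iff)
  with cl_polynomial[OF p(1) f] show "\<exists>h\<in>cl. \<forall>x\<in>topspace K. \<bar>g (f x) - h x\<bar> < e"
    by (intro bexI) auto
qed

section \<open>Exact superpositions\<close>

text \<open>
  Each approximation removes an eighth of the bound on the remainder, and the new remainder stays in
  the closed algebra, so that the same inner functions \<open>\<theta>\<close> serve again.  The outer functions add up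
  to uniformly convergent series.
\<close>
lemma superposition_if_approximate:
  assumes \<theta>: "\<And>i. i < N \<Longrightarrow> \<theta> i \<in> cl"
    and good: "superposes_all N H \<theta>"
    and f: "f \<in> cl"
  obtains G :: "nat \<Rightarrow> real \<Rightarrow> real" where "\<And>i. i < N \<Longrightarrow> continuous_on UNIV (G i)"
    and "\<And>x. x \<in> topspace K \<Longrightarrow> f x = (\<Sum>i<N. G i (\<theta> i x))"
proof -
  obtain M' where M': "\<And>x. x \<in> topspace K \<Longrightarrow> \<bar>f x\<bar> \<le> M'"
    by (rule cont_bounded[OF cl_cont[OF f]]) auto
  obtain M0 :: nat where "max 1 M' \<le> real M0"
    using real_arch_simple[of "max 1 M'"] by (elim exE)
  then have M0: "real M0 > 0" "\<And>x. x \<in> topspace K \<Longrightarrow> \<bar>f x\<bar> \<le> real M0"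
    using M' by (auto intro: order_trans)
  define M where "M k = real M0 * (7 / 8) ^ k" for k
  have M: "M k > 0" "M k \<in> \<rat>" "M (Suc k) = 7 / 8 * M k" for k
    using M0(1) by (auto simp: M_def intro!: Rats_mult Rats_power Rats_divide)
  define P where "P k r \<longleftrightarrow> r \<in> cl \<and> (\<forall>x\<in>topspace K. \<bar>r x\<bar> \<le> M k)" for k r
  define Q where "Q k r r' \<longleftrightarrow> (\<exists>g. (\<forall>i<N. continuous_on UNIV (g i) \<and> (\<forall>y. \<bar>g i y\<bar> \<le> 2 * M k)) \<and>
      (\<forall>x. r' x = r x - (\<Sum>i<N. g i (\<theta> i x))))" for k and r r' :: "'a \<Rightarrow> real"
  have "\<exists>r. \<forall>k. (P k (r k) \<and> (k = 0 \<longrightarrow> r k = f)) \<and> Q k (r k) (r (Suc k))"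
  proof (rule dependent_nat_choice)
    show "\<exists>r. P 0 r \<and> (0 = (0 :: nat) \<longrightarrow> r = f)"
      using f M0(2) by (intro exI[of _ f]) (simp add: P_def M_def)
  next
    fix r k
    assume "P k r \<and> (k = 0 \<longrightarrow> r = f)"
    then have r: "r \<in> cl" "\<And>x. x \<in> topspace K \<Longrightarrow> \<bar>r x\<bar> \<le> M k"
      by (auto simp: P_def)
    have "M k / 16 > 0"
      using M(1)[of k] by simp
    then obtain h where h: "h \<in> H" "\<And>x. x \<in> topspace K \<Longrightarrow> \<bar>r x - h x\<bar> < M k / 16"
      by (rule uniform_closureE[OF r(1)]) auto
    \<comment> \<open>\<open>17/16 * M k\<close> bounds the norm of \<open>h\<close>, and \<open>3/4 * 17/16 + 1/16 \<le> 7/8\<close> is the contraction\<close>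
    have "superposes N h (17 / 16 * M k) \<theta>"
    proof (rule good[unfolded superposes_all_def, rule_format, OF h(1)], safe)
      show "17 / 16 * M k \<in> \<rat>" "17 / 16 * M k > 0"
        using M[of k] by (auto intro!: Rats_mult Rats_divide)
      show "\<bar>h x\<bar> \<le> 17 / 16 * M k" if "x \<in> topspace K" for x
        using h(2)[OF that] r(2)[OF that] by linarith
    qed
    then obtain g where g: "\<forall>i<N. continuous_on UNIV (g i) \<and> (\<forall>y. \<bar>g i y\<bar> \<le> 17 / 16 * M k)"
        "\<forall>x\<in>topspace K. \<bar>h x - (\<Sum>i<N. g i (\<theta> i x))\<bar> \<le> 3 / 4 * (17 / 16 * M k)"
      unfolding superposes_def by (elim exE conjE)
    define r' where "r' x = r x - (\<Sum>i<N. g i (\<theta> i x))" for x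
    have "\<bar>r' x\<bar> \<le> M (Suc k)" if x: "x \<in> topspace K" for x
    proof -
      have "\<bar>h x - (\<Sum>i<N. g i (\<theta> i x))\<bar> \<le> 3 / 4 * (17 / 16 * M k)"
        using g(2) x by simp
      then show ?thesis
        using h(2)[OF x] M(1)[of k] unfolding r'_def M(3) by linarith
    qed
    moreover have "r' \<in> cl"
    proof -
      have "(\<lambda>x. g i (\<theta> i x)) \<in> cl" if "i < N" for i
        using g(1) \<theta>[OF that] that by (intro cl_comp[of "g i" "\<theta> i"]) auto
      then have "(\<lambda>x. \<Sum>i<N. g i (\<theta> i x)) \<in> cl"
        by (rule cl_sum)
      then show ?thesis
        unfolding r'_def by (rule cl_diff[OF r(1)])
    qed
    ultimately have "P (Suc k) r'"
      by (simp add: P_def)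
    moreover have "Q k r r'"
      unfolding Q_def r'_def
    proof (intro exI[of _ g] conjI allI impI)
      show "\<bar>g i y\<bar> \<le> 2 * M k" if "i < N" for i y
      proof -
        have "\<bar>g i y\<bar> \<le> 17 / 16 * M k"
          using g(1) that by simp
        then show ?thesis
          using M(1)[of k] by linarith
      qed
    qed (use g(1) in auto)
    ultimately show "\<exists>r'. (P (Suc k) r' \<and> (Suc k = 0 \<longrightarrow> r' = f)) \<and> Q k r r'"
      by (intro exI[of _ r']) simp
  qed
  then obtain r where r: "\<And>k. P k (r k)" "r 0 = f" "\<forall>k. Q k (r k) (r (Suc k))"
    by auto
  from choice[OF r(3)[unfolded Q_def]] obtain g where g: "\<forall>k. (\<forall>i<N. continuous_on UNIV (g k i) \<and>
      (\<forall>y. \<bar>g k i y\<bar> \<le> 2 * M k)) \<and> (\<forall>x. r (Suc k) x = r k x - (\<Sum>i<N. g k i (\<theta> i x)))"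
    by (elim exE)
  have summ_M: "summable (\<lambda>k. 2 * M k)"
    unfolding M_def by (intro summable_mult summable_geometric) auto
  define G where "G i y = (\<Sum>k. g k i y)" for i y
  have G_cont: "continuous_on UNIV (G i)" if i: "i < N" for i
  proof -
    have lim: "uniform_limit UNIV (\<lambda>n y. \<Sum>k<n. g k i y) (\<lambda>y. \<Sum>k. g k i y) sequentially"
      using g i by (intro Weierstrass_m_test[OF _ summ_M]) auto
    have "\<forall>\<^sub>F n in sequentially. continuous_on UNIV (\<lambda>y. \<Sum>k<n. g k i y)"
      using g i by (intro always_eventually allI continuous_on_sum) auto
    then show ?thesis
      unfolding G_def by (rule uniform_limit_theorem[OF _ lim]) simp
  qed
  have "f x = (\<Sum>i<N. G i (\<theta> i x))" if x: "x \<in> topspace K" for x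
  proof -
    have rem: "r n x = f x - (\<Sum>i<N. \<Sum>k<n. g k i (\<theta> i x))" for n
    proof (induction n)
      case (Suc n)
      then show ?case
        using g by (simp add: sum.distrib)
    qed (simp add: r(2))
    have "(\<lambda>n. \<Sum>i<N. \<Sum>k<n. g k i (\<theta> i x)) \<longlonglongrightarrow> (\<Sum>i<N. G i (\<theta> i x))"
    proof (rule tendsto_sum)
      fix i
      assume "i \<in> {..<N}"
      then have "summable (\<lambda>k. g k i (\<theta> i x))"
        using g by (intro summable_comparison_test'[OF summ_M, of 0]) auto
      then show "(\<lambda>n. \<Sum>k<n. g k i (\<theta> i x)) \<longlonglongrightarrow> G i (\<theta> i x)"
        unfolding G_def by (rule summable_LIMSEQ)
    qed
    then have "(\<lambda>n. f x - (\<Sum>i<N. \<Sum>k<n. g k i (\<theta> i x))) \<longlonglongrightarrow> f x - (\<Sum>i<N. G i (\<theta> i x))"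
      by (intro tendsto_diff tendsto_const)
    then have "(\<lambda>n. r n x) \<longlonglongrightarrow> f x - (\<Sum>i<N. G i (\<theta> i x))"
      by (simp only: rem)
    moreover have "(\<lambda>n. r n x) \<longlonglongrightarrow> 0"
    proof (rule Lim_null_comparison)
      show "\<forall>\<^sub>F n in sequentially. norm (r n x) \<le> M n"
        using r(1) x by (intro always_eventually allI) (simp add: P_def)
      show "M \<longlonglongrightarrow> 0"
        unfolding M_def by (intro tendsto_mult_right_zero LIMSEQ_power_zero) auto
    qed
    ultimately show ?thesis
      using LIMSEQ_unique by fastforce
  qed
  with G_cont show thesis
    by (rule that)
qed

text \<open>
  A Baire category argument: the requirements are countably many, each holds stably near functions
  which can be found in \<open>H\<close> arbitrarily close to any given ones, so they can be met one after
  another by a convergent sequence.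
\<close>
lemma common_inner_functions:
  assumes count: "countable H"
    and step: "closed_under_superposition N H"
  obtains \<theta> where "\<And>i. i < N \<Longrightarrow> \<theta> i \<in> cl"
    and "superposes_all N H \<theta>"
proof -
  define R where "R = {(h, q). h \<in> H \<and> q \<in> \<rat> \<and> q > 0 \<and> (\<forall>x\<in>topspace K. \<bar>h x\<bar> \<le> q)}"
  have "R \<subseteq> H \<times> \<rat>"
    by (auto simp: R_def)
  then have "countable R"
    by (rule countable_subset) (use count countable_rat in auto)
  have "((\<lambda>_. 0), 1) \<in> R"
    using H_const[of 0] by (simp add: R_def)
  then have "R \<noteq> {}"
    by auto
  \<comment> \<open>the \<open>k\<close>-th step of the construction meets the \<open>k\<close>-th requirement \<open>\<rho> k\<close>\<close>
  define \<rho> where "\<rho> = from_nat_into R"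
  have \<rho>: "range \<rho> = R"
    unfolding \<rho>_def by (rule range_from_nat_into[OF \<open>R \<noteq> {}\<close> \<open>countable R\<close>])
  define P where "P k s \<longleftrightarrow> (\<forall>i<N. fst s i \<in> H) \<and> 0 < snd s \<and> snd s \<le> (1 / 2) ^ k"
    for k :: nat and s :: "(nat \<Rightarrow> 'a \<Rightarrow> real) \<times> real"
  define Q where "Q k s s' \<longleftrightarrow> (\<forall>i<N. \<forall>x\<in>topspace K. \<bar>fst s' i x - fst s i x\<bar> \<le> snd s / 2) \<and>
      snd s' \<le> snd s / 2 \<and> stably_superposes N (fst (\<rho> k)) (snd (\<rho> k)) (fst s') (snd s')"
    for k and s s' :: "(nat \<Rightarrow> 'a \<Rightarrow> real) \<times> real"
  have "\<exists>s. \<forall>k. P k (s k) \<and> Q k (s k) (s (Suc k))"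
  proof (rule dependent_nat_choice)
    show "\<exists>s. P 0 s"
      using H_const[of 0] by (intro exI[of _ "(\<lambda>_ _. 0, 1)"]) (simp add: P_def)
  next
    fix s k
    assume s: "P k s"
    then have "0 < snd s / 2"
      by (simp add: P_def)
    then obtain e where e: "e \<in> \<rat>" "0 < e" "e < snd s / 2"
      using Rats_dense_in_real by blast
    have "\<rho> k \<in> R"
      using \<rho> by auto
    then have "\<exists>\<psi>. (\<forall>i<N. \<psi> i \<in> H \<and> (\<forall>x\<in>topspace K. \<bar>\<psi> i x - fst s i x\<bar> \<le> e)) \<and>
        (\<exists>\<delta>>0. stably_superposes N (fst (\<rho> k)) (snd (\<rho> k)) \<psi> \<delta>)"
      using s e by (intro step[unfolded closed_under_superposition_def, rule_format])
        (auto simp: R_def P_def)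
    then obtain \<psi> \<delta> where \<psi>: "\<forall>i<N. \<psi> i \<in> H \<and> (\<forall>x\<in>topspace K. \<bar>\<psi> i x - fst s i x\<bar> \<le> e)" "\<delta> > 0"
        "stably_superposes N (fst (\<rho> k)) (snd (\<rho> k)) \<psi> \<delta>"
      by (elim exE conjE)
    define s' where "s' = (\<psi>, min \<delta> (snd s / 2))"
    have "stably_superposes N (fst (\<rho> k)) (snd (\<rho> k)) \<psi> (min \<delta> (snd s / 2))"
      using \<psi>(3) unfolding stably_superposes_def by auto
    moreover have "\<bar>\<psi> i x - fst s i x\<bar> \<le> snd s / 2" if "i < N" "x \<in> topspace K" for i x
      using \<psi>(1) that e(3) by (meson less_imp_le order_trans)
    ultimately have "Q k s s'"
      unfolding Q_def s'_def by simp
    moreover have "min \<delta> (snd s / 2) \<le> (1 / 2) ^ Suc k"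
    proof -
      have "snd s / 2 \<le> (1 / 2) ^ Suc k"
        using s by (simp add: P_def)
      then show ?thesis
        by (rule order_trans[OF min.cobounded2])
    qed
    then have "P (Suc k) s'"
      using s \<psi>(1,2) by (simp add: P_def s'_def)
    ultimately show "\<exists>s'. P (Suc k) s' \<and> Q k s s'"
      by (intro exI conjI)
  qed
  then obtain s where s: "\<And>k. P k (s k)" "\<And>k. Q k (s k) (s (Suc k))"
    by auto
  define \<psi> \<delta> where "\<psi> k = fst (s k)" and "\<delta> k = snd (s k)" for k
  have \<psi>_H: "\<psi> k i \<in> H" if "i < N" for k i
    using s(1)[of k] that by (simp add: P_def \<psi>_def)
  have \<delta>: "0 < \<delta> k" "\<delta> k \<le> (1 / 2) ^ k" "\<delta> (Suc k) \<le> \<delta> k / 2" for k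
    using s(1)[of k] s(2)[of k] by (simp_all add: P_def Q_def \<delta>_def)
  have move: "\<bar>\<psi> (Suc k) i x - \<psi> k i x\<bar> \<le> \<delta> k / 2" if "i < N" "x \<in> topspace K" for k i x
    using s(2)[of k] that by (simp add: Q_def \<psi>_def \<delta>_def)
  have stable: "stably_superposes N (fst (\<rho> k)) (snd (\<rho> k)) (\<psi> (Suc k)) (\<delta> (Suc k))" for k
    using s(2)[of k] by (simp add: Q_def \<psi>_def \<delta>_def)
  have stay: "\<bar>\<psi> (k + j) i x - \<psi> k i x\<bar> \<le> \<delta> k - \<delta> (k + j)" if "i < N" "x \<in> topspace K" for k j i x
  proof (induction j)
    case (Suc j)
    then show ?case
      using move[OF that, of "k + j"] \<delta>(3)[of "k + j"] unfolding add_Suc_right by linarith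
  qed simp
  have near: "\<bar>\<psi> n i x - \<psi> k i x\<bar> \<le> \<delta> k" if "i < N" "x \<in> topspace K" "k \<le> n" for k n i x
    using stay[OF that(1,2), of k "n - k"] \<delta>(1)[of n] that(3) by simp
  have \<delta>_small: "\<exists>k. \<delta> k < e" if "e > 0" for e
  proof -
    obtain k where "(1 / 2 :: real) ^ k < e"
      using real_arch_pow_inv[OF \<open>e > 0\<close>, of "1 / 2"] by auto
    then show ?thesis
      using \<delta>(2)[of k] by (intro exI[of _ k]) linarith
  qed
  define \<theta> where "\<theta> i x = lim (\<lambda>k. \<psi> k i x)" for i x
  have \<theta>_near: "\<bar>\<theta> i x - \<psi> k i x\<bar> \<le> \<delta> k" if ix: "i < N" "x \<in> topspace K" for i x k
  proof -
    have "Cauchy (\<lambda>k. \<psi> k i x)"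
    proof (rule metric_CauchyI)
      fix e :: real
      assume "e > 0"
      then obtain k where k: "\<delta> k < e / 2"
        using \<delta>_small[of "e / 2"] by auto
      have "dist (\<psi> m i x) (\<psi> n i x) < e" if "m \<ge> k" "n \<ge> k" for m n
        using near[OF ix that(1)] near[OF ix that(2)] k unfolding dist_real_def by linarith
      then show "\<exists>k. \<forall>m\<ge>k. \<forall>n\<ge>k. dist (\<psi> m i x) (\<psi> n i x) < e"
        by auto
    qed
    then have "(\<lambda>n. \<psi> n i x) \<longlonglongrightarrow> \<theta> i x"
      unfolding \<theta>_def by (simp add: Cauchy_convergent_iff convergent_LIMSEQ_iff)
    then have "(\<lambda>n. \<bar>\<psi> n i x - \<psi> k i x\<bar>) \<longlonglongrightarrow> \<bar>\<theta> i x - \<psi> k i x\<bar>"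
      by (intro tendsto_intros)
    then show ?thesis
      using near[OF ix] by (intro LIMSEQ_le_const2[of _ _ "\<delta> k"]) auto
  qed
  show thesis
  proof (rule that[of \<theta>])
    show "\<theta> i \<in> cl" if i: "i < N" for i
    proof (rule uniform_closureI)
      fix e :: real
      assume "e > 0"
      then obtain k where "\<delta> k < e"
        using \<delta>_small by auto
      then have "\<bar>\<theta> i x - \<psi> k i x\<bar> < e" if "x \<in> topspace K" for x
        using \<theta>_near[OF i that, of k] by linarith
      then show "\<exists>g\<in>H. \<forall>x\<in>topspace K. \<bar>\<theta> i x - g x\<bar> < e"
        using \<psi>_H[OF i] by (intro bexI[of _ "\<psi> k i"]) auto
    qed
    show "superposes_all N H \<theta>"
      unfolding superposes_all_def
    proof (intro ballI impI)
      fix h q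
      assume hq: "h \<in> H" "q \<in> \<rat>" "0 < q \<and> (\<forall>x\<in>topspace K. \<bar>h x\<bar> \<le> q)"
      have "(h, q) \<in> range \<rho>"
        unfolding \<rho> using hq by (simp add: R_def)
      then obtain k where k: "\<rho> k = (h, q)"
        by (metis rangeE)
      show "superposes N h q \<theta>"
        using stable[of k] \<theta>_near k by (simp add: stably_superposes_def)
    qed
  qed
qed

end

context compact_Hausdorff
begin

text \<open>
  A countable algebra closed under the approximation step does the work of a metrizable quotient of
  \<open>K\<close> whose dimension is not larger.
\<close>
lemma countable_superposition_algebra:
  assumes dim: "covering_dim_le K (int m - 1)" and N: "N = 4 * m + 1"
    and A: "countable A" "\<And>f. f \<in> A \<Longrightarrow> cont f"
  obtains H where "countable H" and "A \<subseteq> H" and "rational_subalgebra K H"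
    and "closed_under_superposition N H"
proof -
  define ok where "ok h q (e :: real) \<phi> \<psi> \<longleftrightarrow> (\<forall>i<N. cont (\<psi> i) \<and> (\<forall>x\<in>topspace K. \<bar>\<psi> i x - \<phi> i x\<bar> \<le> e)) \<and>
      (\<exists>\<delta>>0. stably_superposes N h q \<psi> \<delta>)" for h q e \<phi> \<psi>
  define st where "st h q e l = (SOME \<psi>. ok h q e (\<lambda>i. l ! i) \<psi>)" for h q e l
  \<comment> \<open>the list holds the arguments of all operations at once: its first two entries for the algebra
    operations, its head \<open>h\<close> and its tail \<open>\<phi>\<close> for the approximation step\<close>
  define F where "F l = (\<lambda>r _. r) ` \<rat> \<union> {\<lambda>x. (l ! 0) x + (l ! 1) x, \<lambda>x. (l ! 0) x * (l ! 1) x} \<union>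
      (\<lambda>(q, e, i). st (l ! 0) q e (tl l) i) ` (\<rat> \<times> \<rat> \<times> UNIV)" for l :: "('a \<Rightarrow> real) list"
  have "countable (F l)" for l
    unfolding F_def by (intro countable_Un countable_image countable_SIGMA countable_rat) auto
  then obtain H' where H': "countable H'" "A \<subseteq> H'" "\<And>l. l \<in> lists H' \<Longrightarrow> F l \<subseteq> H'"
    using countable_closure[OF A(1), of F] by metis
  define H where "H = {f \<in> H'. cont f}"
  have pair: "[f, g] \<in> lists H'" if "f \<in> H" "g \<in> H" for f g
    using that by (simp add: H_def)
  show thesis
  proof (rule that[of H])
    show "countable H"
      unfolding H_def using H'(1) by (rule countable_subset[rotated]) auto
    show "A \<subseteq> H"
      using H'(2) A(2) by (auto simp: H_def)
    show "rational_subalgebra K H"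
    proof unfold_locales
      show "cont h" if "h \<in> H" for h
        using that by (simp add: H_def)
      show "(\<lambda>_. r) \<in> H" if "r \<in> \<rat>" for r
        using H'(3)[of "[]"] that by (auto simp: H_def F_def)
      show "(\<lambda>x. f x + g x) \<in> H" if "f \<in> H" "g \<in> H" for f g
        using H'(3)[OF pair[OF that]] that by (auto simp: H_def F_def intro!: continuous_intros)
      show "(\<lambda>x. f x * g x) \<in> H" if "f \<in> H" "g \<in> H" for f g
        using H'(3)[OF pair[OF that]] that by (auto simp: H_def F_def intro!: continuous_intros)
    qed
    show "closed_under_superposition N H"
      unfolding closed_under_superposition_def
    proof (intro ballI allI impI)
      fix h and q e :: real and \<phi> :: "nat \<Rightarrow> 'a \<Rightarrow> real"
      assume h: "h \<in> H" and "q \<in> \<rat>" "e \<in> \<rat>"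
        and asm: "0 < q \<and> (\<forall>x\<in>topspace K. \<bar>h x\<bar> \<le> q) \<and> 0 < e \<and> (\<forall>i<N. \<phi> i \<in> H)"
      then have q: "q \<in> \<rat>" "q > 0" "\<And>x. x \<in> topspace K \<Longrightarrow> \<bar>h x\<bar> \<le> q"
        and e: "e \<in> \<rat>" "e > 0" and \<phi>: "\<And>i. i < N \<Longrightarrow> \<phi> i \<in> H"
        by auto
      let ?l = "map \<phi> [0..<N]"
      have nth: "?l ! i = \<phi> i" if "i < N" for i
        using that by simp
      have l_cont: "cont h" "\<And>i. i < N \<Longrightarrow> cont (?l ! i)"
        using h \<phi> by (auto simp: H_def)
      have "\<exists>\<psi>. ok h q e (\<lambda>i. ?l ! i) \<psi>"
      proof (rule superposition_step[OF dim N l_cont(1) q(2,3) l_cont(2) e(2)])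
        fix \<psi> \<delta>
        assume "\<And>i. i < N \<Longrightarrow> cont (\<psi> i)" "\<delta> > 0" "stably_superposes N h q \<psi> \<delta>"
          "\<And>i x. i < N \<Longrightarrow> x \<in> topspace K \<Longrightarrow> \<bar>\<psi> i x - (?l ! i) x\<bar> \<le> e"
        then show "\<exists>\<psi>. ok h q e (\<lambda>i. ?l ! i) \<psi>"
          unfolding ok_def by (intro exI[of _ \<psi>] conjI allI impI ballI exI[of _ \<delta>])
      qed
      then have ok: "ok h q e (\<lambda>i. ?l ! i) (st h q e ?l)"
        unfolding st_def by (rule someI_ex)
      have "h # ?l \<in> lists H'"
        using h \<phi> by (auto simp: H_def)
      then have "F (h # ?l) \<subseteq> H'"
        by (rule H'(3))
      moreover have "st h q e ?l i \<in> F (h # ?l)" for i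
        unfolding F_def using q(1) e(1) by (intro UnI2 image_eqI[of _ _ "(q, e, i)"]) auto
      ultimately have "st h q e ?l i \<in> H" if "i < N" for i
        using ok that by (auto simp: H_def ok_def)
      then show "\<exists>\<psi>. (\<forall>i<N. \<psi> i \<in> H \<and> (\<forall>x\<in>topspace K. \<bar>\<psi> i x - \<phi> i x\<bar> \<le> e)) \<and>
          (\<exists>\<delta>>0. stably_superposes N h q \<psi> \<delta>)"
        using ok nth by (intro exI[of _ "st h q e ?l"]) (auto simp: ok_def)
    qed
  qed
qed

lemma countable_set_superposition:
  assumes dim: "covering_dim_le K (int m - 1)" and N: "N = 4 * m + 1"
    and A: "countable A" "\<And>f. f \<in> A \<Longrightarrow> cont f"
  obtains \<theta> where "\<And>i. i < N \<Longrightarrow> cont (\<theta> i)"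
    and "\<And>f. f \<in> uniform_closure K A \<Longrightarrow> \<exists>G :: nat \<Rightarrow> real \<Rightarrow> real.
      (\<forall>i<N. continuous_on UNIV (G i)) \<and> (\<forall>x\<in>topspace K. f x = (\<Sum>i<N. G i (\<theta> i x)))"
proof -
  obtain H where H: "countable H" "A \<subseteq> H" "rational_subalgebra K H"
    and step: "closed_under_superposition N H"
    by (rule countable_superposition_algebra[OF dim N A])
  interpret H: rational_subalgebra K H
    by (rule H(3))
  obtain \<theta> where \<theta>: "\<And>i. i < N \<Longrightarrow> \<theta> i \<in> uniform_closure K H"
    and good: "superposes_all N H \<theta>"
    by (rule H.common_inner_functions[OF H(1) step]) auto
  show thesis
  proof (rule that[of \<theta>])
    show "cont (\<theta> i)" if "i < N" for i
      using H.cl_cont[OF \<theta>[OF that]] .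
    fix f
    assume "f \<in> uniform_closure K A"
    then have fH: "f \<in> uniform_closure K H"
      using H(2) unfolding uniform_closure_def by (simp add: subset_eq) metis
    obtain G :: "nat \<Rightarrow> real \<Rightarrow> real" where "\<And>i. i < N \<Longrightarrow> continuous_on UNIV (G i)"
        "\<And>x. x \<in> topspace K \<Longrightarrow> f x = (\<Sum>i<N. G i (\<theta> i x))"
      by (rule H.superposition_if_approximate[OF \<theta> good fH]) auto
    then show "\<exists>G :: nat \<Rightarrow> real \<Rightarrow> real. (\<forall>i<N. continuous_on UNIV (G i)) \<and>
        (\<forall>x\<in>topspace K. f x = (\<Sum>i<N. G i (\<theta> i x)))"
      by (intro exI[of _ G]) auto
  qed
qed

text \<open>
  Every continuous function is a uniform limit of functions indexed by a countable set of basic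
  sets, hence by a member of a cofinal family, and each member needs finitely many inner functions.
\<close>
lemma basic_finite_dimensional:
  assumes nice: "nice_space K" and fd: "finite_dimensional K" and unc: "natLeq <o weight K"
  shows "basic K =o cof_subset (ctbl_inf_subsets (weight K))"
proof -
  obtain B where B: "is_base K B" "weight K = |B|"
    by (rule weight_attained)
  have unc_B: "uncountable B"
  proof
    assume "countable B"
    have "|B| \<le>o natLeq"
      using countable_ordLeq_infinite[OF \<open>countable B\<close> infinite_UNIV_nat] card_of_nat
      by (rule ordLeq_ordIso_trans)
    then show False
      using unc unfolding B(2) using not_ordLess_ordLeq by blast
  qed
  then have inf_B: "infinite B"
    using countable_finite by auto
  have Field: "Field (weight K) = B"
    by (simp add: B(2) Field_card_of)
  obtain D where D: "D \<subseteq> topspace K" "subtopology K D = discrete_topology D" "|D| =o |B|"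
    using nice unfolding nice_space_def B(2) by auto
  then obtain b where b: "bij_betw b D B"
    using card_of_ordIso by blast
  obtain \<Phi> where \<Phi>: "basic_family K \<Phi>" "basic K = |\<Phi>|" "\<And>\<Psi>. basic_family K \<Psi> \<Longrightarrow> basic K \<le>o |\<Psi>|"
    by (rule basic_attained) auto
  have lower: "cof_subset (ctbl_inf_subsets (weight K)) \<le>o basic K"
    unfolding \<Phi>(2) using b unc_B
    by (intro cof_subset_ordLeq_basic_family[OF \<Phi>(1) D(1,2)]) (simp_all add: Field)
  obtain n where "covering_dim_le K n"
    using fd unfolding finite_dimensional_def by auto
  then have dim: "covering_dim_le K (int (nat (n + 1)) - 1)"
    by (simp add: covering_dim_le_def)
  define N where "N = 4 * nat (n + 1) + 1"
  obtain d :: "'a set \<Rightarrow> 'a \<Rightarrow> real" where d: "\<And>V. cont (d V)"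
      "\<And>f e. cont f \<Longrightarrow> e > 0 \<Longrightarrow> \<exists>V\<in>B. \<forall>x\<in>topspace K. \<bar>f x - d V x\<bar> < e"
    by (rule dense_indexed_by_base[OF B(1) inf_B]) auto
  obtain G where G: "G \<subseteq> ctbl_inf_subsets (weight K)" "\<forall>S\<in>ctbl_inf_subsets (weight K). \<exists>T\<in>G. S \<subseteq> T"
      "cof_subset (ctbl_inf_subsets (weight K)) = |G|"
    unfolding cof_subset_def using min_card_attained[OF ex_cofinal[of "ctbl_inf_subsets (weight K)"]]
    by auto
  have inf_G: "infinite G"
    by (rule uncountable_cofinal_infinite[OF _ G(1,2)]) (simp add: Field unc_B)
  have "\<forall>T\<in>G. \<exists>\<theta>. (\<forall>i<N. cont (\<theta> i)) \<and> (\<forall>f\<in>uniform_closure K (d ` T). \<exists>g :: nat \<Rightarrow> real \<Rightarrow> real.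
      (\<forall>i<N. continuous_on UNIV (g i)) \<and> (\<forall>x\<in>topspace K. f x = (\<Sum>i<N. g i (\<theta> i x))))"
  proof
    fix T
    assume "T \<in> G"
    then have "countable (d ` T)"
      using G(1) by (auto simp: ctbl_inf_subsets_def)
    show "\<exists>\<theta>. (\<forall>i<N. cont (\<theta> i)) \<and> (\<forall>f\<in>uniform_closure K (d ` T). \<exists>g :: nat \<Rightarrow> real \<Rightarrow> real.
        (\<forall>i<N. continuous_on UNIV (g i)) \<and> (\<forall>x\<in>topspace K. f x = (\<Sum>i<N. g i (\<theta> i x))))"
    proof (rule countable_set_superposition[OF dim N_def \<open>countable (d ` T)\<close>])
      show "cont f" if "f \<in> d ` T" for f
        using that d(1) by auto
    next
      fix \<theta>
      assume "\<And>i. i < N \<Longrightarrow> cont (\<theta> i)"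
        and "\<And>f. f \<in> uniform_closure K (d ` T) \<Longrightarrow> \<exists>g :: nat \<Rightarrow> real \<Rightarrow> real.
          (\<forall>i<N. continuous_on UNIV (g i)) \<and> (\<forall>x\<in>topspace K. f x = (\<Sum>i<N. g i (\<theta> i x)))"
      then show "\<exists>\<theta>. (\<forall>i<N. cont (\<theta> i)) \<and> (\<forall>f\<in>uniform_closure K (d ` T). \<exists>g :: nat \<Rightarrow> real \<Rightarrow> real.
          (\<forall>i<N. continuous_on UNIV (g i)) \<and> (\<forall>x\<in>topspace K. f x = (\<Sum>i<N. g i (\<theta> i x))))"
        by (intro exI[of _ \<theta>] conjI allI impI ballI)
    qed
  qed
  from bchoice[OF this] obtain \<theta> where \<theta>: "\<forall>T\<in>G. (\<forall>i<N. cont (\<theta> T i)) \<and>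
      (\<forall>f\<in>uniform_closure K (d ` T). \<exists>g :: nat \<Rightarrow> real \<Rightarrow> real.
        (\<forall>i<N. continuous_on UNIV (g i)) \<and> (\<forall>x\<in>topspace K. f x = (\<Sum>i<N. g i (\<theta> T i x))))"
    by (elim exE)
  define \<Psi> where "\<Psi> = (\<Union>T\<in>G. (\<lambda>i. restrict (\<theta> T i) (topspace K)) ` {..<N})"
  have "basic_family K \<Psi>"
    unfolding basic_family_def
  proof (intro conjI ballI)
    show "\<Psi> \<subseteq> cont_funs K"
    proof
      fix \<phi>
      assume "\<phi> \<in> \<Psi>"
      then obtain T i where "T \<in> G" "i < N" "\<phi> = restrict (\<theta> T i) (topspace K)"
        by (auto simp: \<Psi>_def)
      then show "\<phi> \<in> cont_funs K"
        using \<theta> by (auto simp: cont_funs_def intro: continuous_map_eq)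
    qed
    fix f
    assume "f \<in> cont_funs K"
    then have f: "cont f"
      by (simp add: cont_funs_def)
    have "\<forall>k. \<exists>V. V \<in> B \<and> (\<forall>x\<in>topspace K. \<bar>f x - d V x\<bar> < inverse (real (Suc k)))"
      using d(2)[OF f] by (auto simp: Bex_def)
    from choice[OF this] obtain V where V: "\<forall>k. V k \<in> B \<and> (\<forall>x\<in>topspace K. \<bar>f x - d (V k) x\<bar> < inverse (real (Suc k)))"
      by (elim exE)
    obtain S0 where S0: "S0 \<subseteq> B" "countable S0" "infinite S0"
      using infinite_countable_subset'[OF inf_B] by auto
    have "range V \<union> S0 \<in> ctbl_inf_subsets (weight K)"
      using V S0 by (auto simp: ctbl_inf_subsets_def Field)
    then obtain T where T: "T \<in> G" "range V \<union> S0 \<subseteq> T"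
      using G(2) by (meson bspec)
    have "f \<in> uniform_closure K (d ` T)"
    proof (rule uniform_closureI)
      fix e :: real
      assume "e > 0"
      from reals_Archimedean[OF this] obtain k where k: "inverse (real (Suc k)) < e"
        by (elim exE)
      have "V k \<in> T"
        using T(2) by auto
      moreover have "\<bar>f x - d (V k) x\<bar> < e" if "x \<in> topspace K" for x
        using V that k by (meson less_trans)
      ultimately show "\<exists>g\<in>d ` T. \<forall>x\<in>topspace K. \<bar>f x - g x\<bar> < e"
        by auto
    qed
    then obtain g :: "nat \<Rightarrow> real \<Rightarrow> real" where g: "\<forall>i<N. continuous_on UNIV (g i)"
        "\<forall>x\<in>topspace K. f x = (\<Sum>i<N. g i (\<theta> T i x))"
      using bspec[OF conjunct2[OF bspec[OF \<theta> T(1)]], of f] by auto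
    show "\<exists>n \<phi> (g :: nat \<Rightarrow> real \<Rightarrow> real). (\<forall>i\<in>{1..n}. \<phi> i \<in> \<Psi> \<and> continuous_on UNIV (g i)) \<and>
        (\<forall>x\<in>topspace K. f x = (\<Sum>i = 1..n. (g i \<circ> \<phi> i) x))"
    proof (rule exI[of _ N], rule exI[of _ "\<lambda>i. restrict (\<theta> T (i - 1)) (topspace K)"],
        rule exI[of _ "\<lambda>i. g (i - 1)"], intro conjI ballI)
      show "restrict (\<theta> T (i - 1)) (topspace K) \<in> \<Psi>" if "i \<in> {1..N}" for i
        unfolding \<Psi>_def using that T(1) by (intro UN_I[OF T(1)] image_eqI[of _ _ "i - 1"]) auto
      show "continuous_on UNIV (g (i - 1))" if "i \<in> {1..N}" for i
        using g(1) that by auto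
      show "f x = (\<Sum>i = 1..N. (g (i - 1) \<circ> restrict (\<theta> T (i - 1)) (topspace K)) x)"
        if "x \<in> topspace K" for x
        using g(2) that by (simp add: sum.atLeast1_atMost_eq)
    qed
  qed
  then have "basic K \<le>o |\<Psi>|"
    by (rule \<Phi>(3))
  also have "|\<Psi>| \<le>o |G|"
    unfolding \<Psi>_def using inf_G
    by (intro card_of_UNION_ordLeq_infinite ordIso_imp_ordLeq[OF card_of_refl])
      (auto intro: countable_ordLeq_infinite countable_finite)
  finally have "basic K \<le>o cof_subset (ctbl_inf_subsets (weight K))"
    by (simp only: G(3))
  with lower show ?thesis
    by (simp add: ordIso_iff_ordLeq)
qed

end

theorem theorem15:
  fixes K :: "'a topology"
  assumes "compact_space K" and "Hausdorff_space K"
    and "nice_space K"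
  shows "(finite_dimensional K \<and> natLeq <o weight K \<longrightarrow>
            basic K =o cof_subset (ctbl_inf_subsets (weight K))) \<and>
         (\<not> finite_dimensional K \<longrightarrow>
            basic K =o |cont_funs K| \<and> |cont_funs K| =o weight K ^c natLeq)"
proof -
  interpret compact_Hausdorff K
    by (rule compact_Hausdorff.intro[OF assms(1,2)])
  show ?thesis
    using basic_finite_dimensional[OF assms(3)] basic_infinite_dimensional[OF assms(3)] by blast
qed

end
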